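(* Suppose that the following weak inf-sup condition holds, with constants $\eta>0$, $\epsilon>0$ that do not depend on the mesh size or the physical parameters: $$\sup_{0\ne\mathbf w_h\in\mathbf V_h}\frac{(q,\operatorname{div}\mathbf w_h)}{\|\mathbf w_h\|_A}\ \ge\ \frac{\eta}{\sqrt{\lambda+2\mu/d}}\|q\|-\frac{\epsilon}{\sqrt{\lambda+2\mu/d}}\,h\|\nabla q\|\qquad\forall q\in Q_h.$$ Then the iterative method (Steps 1 and 2 of the context) is convergent for any parameters $\gamma\in(1/2,2]$ and $L$ such that $\gamma L=\omega\,\frac{\alpha^2}{\lambda+2\mu/d}\ge \frac{\alpha^2}{\lambda+2\mu/d}$, i.e. $\omega\ge 1$. Additionally, for every iteration $i\ge 1$, $$\|e_p^i\|^2+\frac{|1-\gamma|}{\gamma}\|e_p^i\|_Z^2\ \le\ \frac{1}{1+\frac{\eta^2}{\omega(1+2\theta^* )}}\left(\|e_p^{i-1}\|^2+\frac{|1-\gamma|}{\gamma}\|e_p^{i-1}\|_Z^2\right),$$ where $\theta^*\ge\frac{\epsilon^2C_2\gamma}{4\omega(\gamma-|1-\gamma|)}$ is a root of the quadratic equation $$\left[\frac{2(\gamma-|1-\gamma|)}{\gamma}\right]\theta^2+\left[\frac{\gamma-|1-\gamma|}{\gamma}-\frac{\eta^2|1-\gamma|}{2\omega\gamma}-\frac{\epsilon^2C_2}{2\omega}\right]\theta-\frac{\epsilon^2C_2}{4\omega}=0.$$ Here $\eta$ is the constant in the weak inf-sup condition and $C_2$ is the constant in the upper bound of the spectral equivalence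 $C_1\|q\|_Z^2\le (h\|\nabla q\|)^2\le C_2\|q\|_Z^2$ for all $q\in Q_h$.
   Context: Let $\Omega\subset\mathbb R^d$, $d\le 3$, be a bounded domain with a simplicial partition $\mathcal T_h$; $h_T$ is the diameter of $T\in\mathcal T_h$. Parameters: Lamé constants $\lambda,\mu>0$, $\alpha>0$, $1/\beta\ge 0$, hydraulic conductivity $K>0$, time step $\tau>0$. $(\cdot,\cdot)$ and $\|\cdot\|$ are the $L^2(\Omega)$ inner product and norm. Spaces: $Q_h=\{q\in H^1_0(\Omega): q|_T\in P_1\ \forall T\in\mathcal T_h\}$; $\mathbf V_h\subset (H_0^1(\Omega))^d$ is either the space $\mathbf V_l$ of continuous piecewise linear vector fields vanishing on $\partial\Omega$, or the MINI-element space $\mathbf V_l\oplus\mathbf V_b$, where $\mathbf V_b$ is the space of vector-valued element bubble functions. Forms: $a(\mathbf u,\mathbf v)=2\mu\int_\Omega\varepsilon(\mathbf u):\varepsilon(\mathbf v)+\lambda\int_\Omega\operatorname{div}\mathbf u\operatorname{div}\mathbf v$ with $\varepsilon(\mathbf u)=\frac12(\nabla\mathbf u+\nabla\mathbf u^T)$; $a_p(p,q)=\int_\Omega K\nabla p\cdot\nabla q$; $\|\mathbf v\|_A^2=a(\mathbf v,\mathbf v)$. Lumped inner product: $(p,q)_0=\sum_{T}\frac{|T|}{d+1}\sum_{j=1}^{d+1}(pq)(P_{T,j})$, with $P_{T,j}$ the vertices of $T$. For $p,q\in Q_h$ set $(p,q)_Z=(p,q)_0-(p,q)$ and $\|q\|_Z^2=(q,q)_Z$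 (which is nonnegative). The quantity $h\|\nabla q\|$ denotes $\big(\sum_{T}h_T^2\int_T|\nabla q|^2\big)^{1/2}$. Stabilized scheme: given $(\mathbf u_h^{n-1},p_h^{n-1})\in \mathbf V_h\times Q_h$ and data $\mathbf f_h^n,g_h^n$, the pair $(\mathbf u_h^n,p_h^n)\in\mathbf V_h\times Q_h$ solves, for all $\mathbf v_h\in\mathbf V_h$, $q_h\in Q_h$, with $\bar\partial_t p_h^n=(p_h^n-p_h^{n-1})/\tau$ and $\bar\partial_t\mathbf u_h^n=(\mathbf u_h^n-\mathbf u_h^{n-1})/\tau$, $$a(\mathbf u_h^n,\mathbf v_h)-\alpha(p_h^n,\operatorname{div}\mathbf v_h)=(\mathbf f_h^n,\mathbf v_h),$$ $$\tfrac1\beta(\bar\partial_tp_h^n,q_h)+\alpha(\operatorname{div}\bar\partial_t\mathbf u_h^n,q_h)+a_p(p_h^n,q_h)+L(\bar\partial_tp_h^n,q_h)_0-L(\bar\partial_tp_h^n,q_h)=(g_h^n,q_h).$$ Iterative method for solving this scheme at time $t_n$, with parameter $\gamma>0$: set $\mathbf u_h^{n,0}=\mathbf u_h^{n-1}$, $p_h^{n,0}=p_h^{n-1}$. For $i\ge1$: Step 1: find $p_h^{n,i}\in Q_h$ such that for all $q_h\in Q_h$ $$\tfrac1\beta\Big(\tfrac{p_h^{n,i}-p_h^{n-1}}\tau,q_h\Big)+\gamma L\Big(\tfrac{p_h^{n,i}-p_h^{n-1}}\tau,q_h\Big)_0+a_p(p_h^{n,i},q_h)=-\alpha\Big(\operatorname{div}\tfrac{\mathbf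 u_h^{n,i-1}-\mathbf u_h^{n-1}}\tau,q_h\Big)+L\Big(\tfrac{p_h^{n,i-1}-p_h^{n-1}}\tau,q_h\Big)+(\gamma-1)L\Big(\tfrac{p_h^{n,i-1}-p_h^{n-1}}\tau,q_h\Big)_0+(g_h^n,q_h).$$ Step 2: find $\mathbf u_h^{n,i}\in\mathbf V_h$ such that $a(\mathbf u_h^{n,i},\mathbf v_h)=\alpha(p_h^{n,i},\operatorname{div}\mathbf v_h)+(\mathbf f_h^n,\mathbf v_h)$ for all $\mathbf v_h\in\mathbf V_h$. Errors at iteration $i$: $e_{\mathbf u}^i=\mathbf u_h^{n,i}-\mathbf u_h^n$, $e_p^i=p_h^{n,i}-p_h^n$. Convergence means that these errors tend to zero as $i\to\infty$.
   Formalization: The bound for i = 1 is asserted only if the previous pair (u_h^{n-1}, p_h^{n-1}) satisfies the elasticity equation with load f_h^n; otherwise it can fail (p_h^{n-1} = p_h^n with div(u_h^{n-1} − u_h^n) not orthogonal to Q_h). For i ≥ 2 and for convergence nothing is added. *)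

theory Defs
  imports "HOL-Analysis.Analysis"
begin

section \<open>The space L2\<close>

definition in_L2 :: "'a::euclidean_space set \<Rightarrow> ('a \<Rightarrow> 'b::euclidean_space) \<Rightarrow> bool" where
  "in_L2 \<Omega> f \<longleftrightarrow> f \<in> borel_measurable (lebesgue_on \<Omega>) \<and>
     integrable (lebesgue_on \<Omega>) (\<lambda>x. (norm (f x))\<^sup>2)"

definition L2_inner :: "'a::euclidean_space set \<Rightarrow> ('a \<Rightarrow> 'b::euclidean_space) \<Rightarrow> ('a \<Rightarrow> 'b) \<Rightarrow> real" where
  "L2_inner \<Omega> f g = (LINT x|lebesgue_on \<Omega>. f x \<bullet> g x)"

definition L2_norm :: "'a::euclidean_space set \<Rightarrow> ('a \<Rightarrow> 'b::euclidean_space) \<Rightarrow> real" where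
  "L2_norm \<Omega> f = sqrt (L2_inner \<Omega> f f)"


section \<open>Weak derivatives and the Sobolev space of functions with zero trace\<close>

text \<open>Test functions are the C1 functions with compact support in the open set; smooth test
  functions give the same weak gradients and the same closure.\<close>

definition test_function :: "'a::euclidean_space set \<Rightarrow> ('a \<Rightarrow> real) \<Rightarrow> ('a \<Rightarrow> 'a) \<Rightarrow> bool" where
  "test_function \<Omega> \<phi> d\<phi> \<longleftrightarrow>
     (\<forall>x. GDERIV \<phi> x :> d\<phi> x) \<and> continuous_on UNIV d\<phi> \<and>
     compact (closure {x. \<phi> x \<noteq> 0}) \<and> closure {x. \<phi> x \<noteq> 0} \<subseteq> \<Omega>"

definition has_weak_gradient :: "'a::euclidean_space set \<Rightarrow> ('a \<Rightarrow> real) \<Rightarrow> ('a \<Rightarrow> 'a) \<Rightarrow> bool" where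
  "has_weak_gradient \<Omega> q g \<longleftrightarrow> in_L2 \<Omega> q \<and> in_L2 \<Omega> g \<and>
     (\<forall>\<phi> d\<phi>. test_function \<Omega> \<phi> d\<phi> \<longrightarrow>
        (LINT x|lebesgue_on \<Omega>. q x *\<^sub>R d\<phi> x) = - (LINT x|lebesgue_on \<Omega>. \<phi> x *\<^sub>R g x))"

text \<open>The weak gradient is determined only almost everywhere; one representative is chosen.\<close>

definition grad :: "'a::euclidean_space set \<Rightarrow> ('a \<Rightarrow> real) \<Rightarrow> 'a \<Rightarrow> 'a" where
  "grad \<Omega> q = (SOME g. has_weak_gradient \<Omega> q g)"

definition H1_0 :: "'a::euclidean_space set \<Rightarrow> ('a \<Rightarrow> real) set" where
  "H1_0 \<Omega> = {q. \<exists>g. has_weak_gradient \<Omega> q g \<and>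
     (\<exists>\<phi> d\<phi>. (\<forall>k::nat. test_function \<Omega> (\<phi> k) (d\<phi> k)) \<and>
        (\<lambda>k. L2_norm \<Omega> (\<lambda>x. q x - \<phi> k x)) \<longlonglongrightarrow> 0 \<and>
        (\<lambda>k. L2_norm \<Omega> (\<lambda>x. g x - d\<phi> k x)) \<longlonglongrightarrow> 0)}"

definition H1_0_vec :: "(real^'d) set \<Rightarrow> (real^'d \<Rightarrow> real^'d) set" where
  "H1_0_vec \<Omega> = {v. \<forall>i. (\<lambda>x. v x $ i) \<in> H1_0 \<Omega>}"

definition jacobian :: "(real^'d) set \<Rightarrow> (real^'d \<Rightarrow> real^'d) \<Rightarrow> real^'d \<Rightarrow> real^'d^'d" where
  "jacobian \<Omega> v x = (\<chi> i. grad \<Omega> (\<lambda>y. v y $ i) x)"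

definition strain :: "(real^'d) set \<Rightarrow> (real^'d \<Rightarrow> real^'d) \<Rightarrow> real^'d \<Rightarrow> real^'d^'d" where
  "strain \<Omega> v x = (1/2) *\<^sub>R (jacobian \<Omega> v x + transpose (jacobian \<Omega> v x))"

definition divergence :: "(real^'d) set \<Rightarrow> (real^'d \<Rightarrow> real^'d) \<Rightarrow> real^'d \<Rightarrow> real" where
  "divergence \<Omega> v x = trace (jacobian \<Omega> v x)"


section \<open>Simplicial partitions and finite element spaces\<close>

definition bounded_domain :: "'a::euclidean_space set \<Rightarrow> bool" where
  "bounded_domain \<Omega> \<longleftrightarrow> open \<Omega> \<and> connected \<Omega> \<and> bounded \<Omega> \<and> \<Omega> \<noteq> {}"

definition simplicial_partition :: "'a::euclidean_space set \<Rightarrow> 'a set set \<Rightarrow> bool" where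
  "simplicial_partition \<Omega> \<T> \<longleftrightarrow>
     triangulation \<T> \<and> (\<forall>T\<in>\<T>. int DIM('a) simplex T \<and> interior T \<subseteq> \<Omega>) \<and> \<Union>\<T> = closure \<Omega>"

definition vertices :: "'a::euclidean_space set \<Rightarrow> 'a set" where
  "vertices T = {P. P extreme_point_of T}"

definition P1_on :: "'a::euclidean_space set \<Rightarrow> ('a \<Rightarrow> 'b::euclidean_space) \<Rightarrow> bool" where
  "P1_on T f \<longleftrightarrow> (\<exists>A b. linear A \<and> (\<forall>x\<in>T. f x = A x + b))"

definition barycentric :: "'a::euclidean_space set \<Rightarrow> 'a \<Rightarrow> 'a \<Rightarrow> real" where
  "barycentric T x = (THE c. (\<forall>P. P \<notin> vertices T \<longrightarrow> c P = 0) \<and>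
     (\<Sum>P\<in>vertices T. c P) = 1 \<and> (\<Sum>P\<in>vertices T. c P *\<^sub>R P) = x)"

definition bubble :: "'a::euclidean_space set \<Rightarrow> 'a \<Rightarrow> real" where
  "bubble T x = (\<Prod>P\<in>vertices T. barycentric T x P)"

definition Q_space :: "'a::euclidean_space set \<Rightarrow> 'a set set \<Rightarrow> ('a \<Rightarrow> real) set" where
  "Q_space \<Omega> \<T> = {q \<in> H1_0 \<Omega>. \<forall>T\<in>\<T>. P1_on T q}"

definition V_lin :: "(real^'d) set \<Rightarrow> (real^'d) set set \<Rightarrow> (real^'d \<Rightarrow> real^'d) set" where
  "V_lin \<Omega> \<T> = {v \<in> H1_0_vec \<Omega>. continuous_on (closure \<Omega>) v \<and>
     (\<forall>T\<in>\<T>. P1_on T v) \<and> (\<forall>x\<in>frontier \<Omega>. v x = 0)}"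

definition V_bub :: "(real^'d) set \<Rightarrow> (real^'d) set set \<Rightarrow> (real^'d \<Rightarrow> real^'d) set" where
  "V_bub \<Omega> \<T> = {v \<in> H1_0_vec \<Omega>. \<forall>T\<in>\<T>. \<exists>c. \<forall>x\<in>T. v x = bubble T x *\<^sub>R c}"

definition V_mini :: "(real^'d) set \<Rightarrow> (real^'d) set set \<Rightarrow> (real^'d \<Rightarrow> real^'d) set" where
  "V_mini \<Omega> \<T> = {\<lambda>x. v x + w x | v w. v \<in> V_lin \<Omega> \<T> \<and> w \<in> V_bub \<Omega> \<T>}"


section \<open>Forms and norms\<close>

text \<open>The field \<open>inv_beta\<close> stands for the coefficient 1/beta, so that 1/beta = 0 is included.\<close>

record biot_params =
  lame_lambda :: real
  lame_mu :: real
  biot_alpha :: real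
  inv_beta :: real
  conductivity :: real

definition admissible_params :: "biot_params \<Rightarrow> bool" where
  "admissible_params P \<longleftrightarrow> lame_lambda P > 0 \<and> lame_mu P > 0 \<and> biot_alpha P > 0 \<and>
     inv_beta P \<ge> 0 \<and> conductivity P > 0"

definition a_form :: "(real^'d) set \<Rightarrow> biot_params \<Rightarrow> (real^'d \<Rightarrow> real^'d) \<Rightarrow> (real^'d \<Rightarrow> real^'d) \<Rightarrow> real" where
  "a_form \<Omega> P u v = 2 * lame_mu P * L2_inner \<Omega> (strain \<Omega> u) (strain \<Omega> v)
     + lame_lambda P * L2_inner \<Omega> (divergence \<Omega> u) (divergence \<Omega> v)"

definition A_norm :: "(real^'d) set \<Rightarrow> biot_params \<Rightarrow> (real^'d \<Rightarrow> real^'d) \<Rightarrow> real" where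
  "A_norm \<Omega> P v = sqrt (a_form \<Omega> P v v)"

definition ap_form :: "'a::euclidean_space set \<Rightarrow> biot_params \<Rightarrow> ('a \<Rightarrow> real) \<Rightarrow> ('a \<Rightarrow> real) \<Rightarrow> real" where
  "ap_form \<Omega> P p q = L2_inner \<Omega> (\<lambda>x. conductivity P *\<^sub>R grad \<Omega> p x) (grad \<Omega> q)"

definition lumped :: "'a::euclidean_space set set \<Rightarrow> ('a \<Rightarrow> real) \<Rightarrow> ('a \<Rightarrow> real) \<Rightarrow> real" where
  "lumped \<T> p q =
     (\<Sum>T\<in>\<T>. measure lebesgue T / (real DIM('a) + 1) * (\<Sum>P\<in>vertices T. p P * q P))"

definition Z_form :: "'a::euclidean_space set \<Rightarrow> 'a set set \<Rightarrow> ('a \<Rightarrow> real) \<Rightarrow> ('a \<Rightarrow> real) \<Rightarrow> real" where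
  "Z_form \<Omega> \<T> p q = lumped \<T> p q - L2_inner \<Omega> p q"

definition h_grad_norm :: "'a::euclidean_space set \<Rightarrow> 'a set set \<Rightarrow> ('a \<Rightarrow> real) \<Rightarrow> real" where
  "h_grad_norm \<Omega> \<T> q =
     sqrt (\<Sum>T\<in>\<T>. (diameter T)\<^sup>2 * (LINT x|lebesgue_on T. (norm (grad \<Omega> q x))\<^sup>2))"

text \<open>Functions are total, so a field is nonzero if it is nonzero somewhere in the domain. The
  supremum is taken in the extended reals, where that of the empty set is minus infinity.\<close>

definition weak_inf_sup ::
  "(real^'d) set \<Rightarrow> (real^'d) set set \<Rightarrow> (real^'d \<Rightarrow> real^'d) set \<Rightarrow> biot_params \<Rightarrow> real \<Rightarrow> real \<Rightarrow> bool" where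
  "weak_inf_sup \<Omega> \<T> V P \<eta> \<epsilon> \<longleftrightarrow>
     (\<forall>q\<in>Q_space \<Omega> \<T>.
        (SUP w\<in>{w\<in>V. \<exists>x\<in>\<Omega>. w x \<noteq> 0}. ereal (L2_inner \<Omega> q (divergence \<Omega> w) / A_norm \<Omega> P w))
        \<ge> ereal (\<eta> / sqrt (lame_lambda P + 2 * lame_mu P / real CARD('d)) * L2_norm \<Omega> q
               - \<epsilon> / sqrt (lame_lambda P + 2 * lame_mu P / real CARD('d)) * h_grad_norm \<Omega> \<T> q))"


section \<open>The stabilized scheme and the iterative method\<close>

text \<open>Elasticity equation, shared by the scheme, Step 2 of the method and its starting pair.\<close>

definition elasticity_eq ::
  "(real^'d) set \<Rightarrow> (real^'d \<Rightarrow> real^'d) set \<Rightarrow> biot_params \<Rightarrow> (real^'d \<Rightarrow> real^'d) \<Rightarrow>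
   (real^'d \<Rightarrow> real^'d) \<Rightarrow> (real^'d \<Rightarrow> real) \<Rightarrow> bool" where
  "elasticity_eq \<Omega> V P f u p \<longleftrightarrow>
     (\<forall>v\<in>V. a_form \<Omega> P u v - biot_alpha P * L2_inner \<Omega> p (divergence \<Omega> v) = L2_inner \<Omega> f v)"

definition stabilized_scheme ::
  "(real^'d) set \<Rightarrow> (real^'d) set set \<Rightarrow> (real^'d \<Rightarrow> real^'d) set \<Rightarrow> biot_params \<Rightarrow> real \<Rightarrow> real \<Rightarrow>
   (real^'d \<Rightarrow> real^'d) \<Rightarrow> (real^'d \<Rightarrow> real) \<Rightarrow>
   (real^'d \<Rightarrow> real^'d) \<Rightarrow> (real^'d \<Rightarrow> real) \<Rightarrow>
   (real^'d \<Rightarrow> real^'d) \<Rightarrow> (real^'d \<Rightarrow> real) \<Rightarrow> bool" where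
  "stabilized_scheme \<Omega> \<T> V P \<tau> L f g u_old p_old u p \<longleftrightarrow>
     u \<in> V \<and> p \<in> Q_space \<Omega> \<T> \<and> elasticity_eq \<Omega> V P f u p \<and>
     (\<forall>q\<in>Q_space \<Omega> \<T>.
        inv_beta P * L2_inner \<Omega> (\<lambda>x. (p x - p_old x) / \<tau>) q
        + biot_alpha P * L2_inner \<Omega> (divergence \<Omega> (\<lambda>x. (u x - u_old x) /\<^sub>R \<tau>)) q
        + ap_form \<Omega> P p q
        + L * lumped \<T> (\<lambda>x. (p x - p_old x) / \<tau>) q
        - L * L2_inner \<Omega> (\<lambda>x. (p x - p_old x) / \<tau>) q
        = L2_inner \<Omega> g q)"

definition iterative_method ::
  "(real^'d) set \<Rightarrow> (real^'d) set set \<Rightarrow> (real^'d \<Rightarrow> real^'d) set \<Rightarrow> biot_params \<Rightarrow> real \<Rightarrow> real \<Rightarrow> real \<Rightarrow>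
   (real^'d \<Rightarrow> real^'d) \<Rightarrow> (real^'d \<Rightarrow> real) \<Rightarrow>
   (real^'d \<Rightarrow> real^'d) \<Rightarrow> (real^'d \<Rightarrow> real) \<Rightarrow>
   (nat \<Rightarrow> real^'d \<Rightarrow> real^'d) \<Rightarrow> (nat \<Rightarrow> real^'d \<Rightarrow> real) \<Rightarrow> bool" where
  "iterative_method \<Omega> \<T> V P \<tau> L \<gamma> f g u_old p_old us ps \<longleftrightarrow>
     us 0 = u_old \<and> ps 0 = p_old \<and>
     (\<forall>i\<ge>1.
        ps i \<in> Q_space \<Omega> \<T> \<and>
        (\<forall>q\<in>Q_space \<Omega> \<T>.
           inv_beta P * L2_inner \<Omega> (\<lambda>x. (ps i x - p_old x) / \<tau>) q
           + \<gamma> * L * lumped \<T> (\<lambda>x. (ps i x - p_old x) / \<tau>) q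
           + ap_form \<Omega> P (ps i) q
           = - biot_alpha P * L2_inner \<Omega> (divergence \<Omega> (\<lambda>x. (us (i - 1) x - u_old x) /\<^sub>R \<tau>)) q
             + L * L2_inner \<Omega> (\<lambda>x. (ps (i - 1) x - p_old x) / \<tau>) q
             + (\<gamma> - 1) * L * lumped \<T> (\<lambda>x. (ps (i - 1) x - p_old x) / \<tau>) q
             + L2_inner \<Omega> g q) \<and>
        us i \<in> V \<and> elasticity_eq \<Omega> V P f (us i) (ps i))"

end

(* With errors e = p^i - p, w = u^i - u and the previous errors e', w', testing Step 1 with e and
   using a(w, v) = alpha (e, div v) in the polarized form of a(w, w') gives
     |e|^2 + (2 - delta) |e|_Z^2 + 2 tau/(gamma L) a_p(e, e) + a(w, w)/(gamma L)
       <= |e'|^2 + delta |e'|_Z^2,   delta = |1 - gamma|/gamma,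
   because a(w - w', w - w') <= alpha^2/(lambda + 2 mu/d) |e - e'|^2 <= gamma L |e - e'|^2.
   Telescoping forces a(w, w) and a_p(e, e) to zero, and the inf-sup condition then forces |e| to
   zero.  For the rate, the inf-sup condition bounds |e| by a(w, w) and |e|_Z; Young's inequality
   with the weight theta distributes this over the surplus terms of the energy estimate. *)
theory Submission
  imports Defs
begin

section \<open>The space L2\<close>

text \<open>The bound on a(w - w', w - w') uses the elasticity equation for both consecutive errors.
  The starting pair is not produced by Step 2, so the energy estimate begins at i = 2 unless that
  pair satisfies the equation; the limit is unaffected. For convergence h |grad e| is controlled by
  a_p(e, e), whereas the rate controls it by |e|_Z through C2 and drops a_p.

  The factor eta^2/(omega (1 + 2 theta)) arises from asking the surplus terms to dominate a multiple
  of the whole quantity |e|^2 + delta |e|_Z^2: matching the coefficients of |e|_Z^2 gives the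
  quadratic equation. At the stated lower bound its left side is nonpositive, so a root lies beyond.

  Much of the work lies below the scheme. Weak gradients are chosen representatives, so a and a_p
  are bilinear only through almost everywhere uniqueness, that is, the fundamental lemma of the
  calculus of variations. Nonnegativity of the lumping defect needs the mean of a barycentric
  coordinate over a simplex, found here from equality of distributions.\<close>

lemma in_L2_integrable_inner:
  assumes "in_L2 \<Omega> f" "in_L2 \<Omega> g"
  shows "integrable (lebesgue_on \<Omega>) (\<lambda>x. f x \<bullet> g x)"
proof -
  have m: "f \<in> borel_measurable (lebesgue_on \<Omega>)" "g \<in> borel_measurable (lebesgue_on \<Omega>)"
    using assms by (auto simp: in_L2_def)
  have "integrable (lebesgue_on \<Omega>) (\<lambda>x. (norm (f x))\<^sup>2 + (norm (g x))\<^sup>2)"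
    using assms by (auto simp: in_L2_def)
  then show ?thesis
  proof (rule Bochner_Integration.integrable_bound)
    show "(\<lambda>x. f x \<bullet> g x) \<in> borel_measurable (lebesgue_on \<Omega>)"
      using m by measurable
    have "norm (f x \<bullet> g x) \<le> norm ((norm (f x))\<^sup>2 + (norm (g x))\<^sup>2)" for x
    proof -
      have "\<bar>f x \<bullet> g x\<bar> \<le> norm (f x) * norm (g x)" by (rule Cauchy_Schwarz_ineq2)
      also have "\<dots> \<le> (norm (f x))\<^sup>2 + (norm (g x))\<^sup>2"
        using sum_squares_bound[of "norm (f x)" "norm (g x)"]
          mult_nonneg_nonneg[OF norm_ge_zero[of "f x"] norm_ge_zero[of "g x"]] by linarith
      finally show ?thesis by simp
    qed
    then show "AE x in lebesgue_on \<Omega>. norm (f x \<bullet> g x) \<le> norm ((norm (f x))\<^sup>2 + (norm (g x))\<^sup>2)"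
      by simp
  qed
qed

text \<open>Directional derivatives, traces and symmetric parts all inherit square integrability in
  this way.\<close>

lemma in_L2_bounded_linear:
  assumes T: "bounded_linear T" and f: "in_L2 \<Omega> f"
  shows "in_L2 \<Omega> (\<lambda>x. T (f x))"
proof -
  obtain K where K: "\<And>x. norm (T x) \<le> norm x * K"
    using bounded_linear.bounded[OF T] by blast
  have m: "f \<in> borel_measurable (lebesgue_on \<Omega>)" using f by (auto simp: in_L2_def)
  have "T \<in> borel_measurable borel"
    using T by (intro borel_measurable_continuous_onI linear_continuous_on)
  with m have m': "(\<lambda>x. T (f x)) \<in> borel_measurable (lebesgue_on \<Omega>)" by (rule measurable_compose)
  have "integrable (lebesgue_on \<Omega>) (\<lambda>x. (norm (f x))\<^sup>2 * K\<^sup>2)"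
    using f by (auto simp: in_L2_def)
  moreover have "norm ((norm (T (f x)))\<^sup>2) \<le> norm ((norm (f x))\<^sup>2 * K\<^sup>2)" for x
    using power_mono[OF K[of "f x"], of 2] by (simp add: power_mult_distrib)
  ultimately have "integrable (lebesgue_on \<Omega>) (\<lambda>x. (norm (T (f x)))\<^sup>2)"
    using m' by (elim Bochner_Integration.integrable_bound) auto
  with m' show ?thesis by (simp add: in_L2_def)
qed

lemma in_L2_add:
  assumes "in_L2 \<Omega> f" "in_L2 \<Omega> g"
  shows "in_L2 \<Omega> (\<lambda>x. f x + g x)"
proof -
  have "integrable (lebesgue_on \<Omega>) (\<lambda>x. (norm (f x))\<^sup>2 + 2 * (f x \<bullet> g x) + (norm (g x))\<^sup>2)"
    using assms in_L2_integrable_inner[OF assms] by (auto simp: in_L2_def)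
  moreover have "(norm (f x + g x))\<^sup>2 = (norm (f x))\<^sup>2 + 2 * (f x \<bullet> g x) + (norm (g x))\<^sup>2" for x
    by (simp add: power2_norm_eq_inner inner_add inner_commute)
  ultimately show ?thesis using assms by (auto simp: in_L2_def)
qed

lemma in_L2_scaleR: "in_L2 \<Omega> f \<Longrightarrow> in_L2 \<Omega> (\<lambda>x. c *\<^sub>R f x)"
  by (rule in_L2_bounded_linear[OF bounded_linear_scaleR_right])

lemma in_L2_diff:
  assumes "in_L2 \<Omega> f" "in_L2 \<Omega> g"
  shows "in_L2 \<Omega> (\<lambda>x. f x - g x)"
  using in_L2_add[OF assms(1) in_L2_scaleR[OF assms(2), of "-1"]] by simp

lemma in_L2_sum:
  assumes "finite I" "\<And>i. i \<in> I \<Longrightarrow> in_L2 \<Omega> (f i)"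
  shows "in_L2 \<Omega> (\<lambda>x. \<Sum>i\<in>I. f i x)"
  using assms
proof (induction I rule: finite_induct)
  case empty
  then show ?case by (simp add: in_L2_def)
next
  case (insert i I)
  then show ?case using in_L2_add[of \<Omega> "f i"] by simp
qed

section \<open>Algebra of the L2 inner product\<close>

lemma L2_inner_commute: "L2_inner \<Omega> f g = L2_inner \<Omega> g f"
  by (simp add: L2_inner_def inner_commute)

text \<open>Weak gradients are linear only almost everywhere; this is how such identities reach the
  forms.\<close>

lemma L2_inner_cong_AE:
  assumes "AE x in lebesgue_on \<Omega>. f x = f' x"
    and "in_L2 \<Omega> f" "in_L2 \<Omega> f'" "in_L2 \<Omega> g"
  shows "L2_inner \<Omega> f g = L2_inner \<Omega> f' g"
  unfolding L2_inner_def
proof (rule integral_cong_AE)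
  show "(\<lambda>x. f x \<bullet> g x) \<in> borel_measurable (lebesgue_on \<Omega>)"
    "(\<lambda>x. f' x \<bullet> g x) \<in> borel_measurable (lebesgue_on \<Omega>)"
    using in_L2_integrable_inner assms by blast+
  show "AE x in lebesgue_on \<Omega>. f x \<bullet> g x = f' x \<bullet> g x" using assms(1) by eventually_elim simp
qed

lemma L2_inner_lin:
  assumes "in_L2 \<Omega> f" "in_L2 \<Omega> f'" "in_L2 \<Omega> g"
  shows "L2_inner \<Omega> (\<lambda>x. c *\<^sub>R f x + f' x) g = c * L2_inner \<Omega> f g + L2_inner \<Omega> f' g"
  using in_L2_integrable_inner[OF assms(1,3)] in_L2_integrable_inner[OF assms(2,3)]
  by (simp add: L2_inner_def inner_add_left)

lemma L2_inner_lin_right: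
  assumes "in_L2 \<Omega> f" "in_L2 \<Omega> f'" "in_L2 \<Omega> g"
  shows "L2_inner \<Omega> g (\<lambda>x. c *\<^sub>R f x + f' x) = c * L2_inner \<Omega> g f + L2_inner \<Omega> g f'"
  using L2_inner_lin[OF assms] by (simp add: L2_inner_commute[of \<Omega> g])

lemma L2_inner_diff_left:
  assumes "in_L2 \<Omega> f" "in_L2 \<Omega> f'" "in_L2 \<Omega> g"
  shows "L2_inner \<Omega> (\<lambda>x. f x - f' x) g = L2_inner \<Omega> f g - L2_inner \<Omega> f' g"
  using in_L2_integrable_inner[OF assms(1,3)] in_L2_integrable_inner[OF assms(2,3)]
  by (simp add: L2_inner_def inner_diff_left)

lemma L2_inner_diff_right:
  assumes "in_L2 \<Omega> f" "in_L2 \<Omega> f'" "in_L2 \<Omega> g"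
  shows "L2_inner \<Omega> g (\<lambda>x. f x - f' x) = L2_inner \<Omega> g f - L2_inner \<Omega> g f'"
  using L2_inner_diff_left[OF assms] by (simp add: L2_inner_commute[of \<Omega> g])

lemma L2_inner_self_nonneg: "0 \<le> L2_inner \<Omega> f f"
  by (simp add: L2_inner_def)

lemma L2_norm_nonneg: "0 \<le> L2_norm \<Omega> f"
  by (simp add: L2_norm_def L2_inner_self_nonneg)

lemma L2_norm_squared: "(L2_norm \<Omega> f)\<^sup>2 = L2_inner \<Omega> f f"
  by (simp add: L2_norm_def L2_inner_self_nonneg)

text \<open>The positivity argument behind Cauchy-Schwarz, kept apart from any inner product so that
  it serves both the L2 product and the elastic energy. The sign of \<open>C\<close> is a
  consequence of the assumption, hence the cases.\<close>

lemma quadratic_nonneg_imp: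
  fixes A B C :: real
  assumes "\<And>t. 0 \<le> A + 2 * t * B + t\<^sup>2 * C"
  shows "\<bar>B\<bar> \<le> sqrt A * sqrt C"
proof -
  have A: "0 \<le> A" using assms[of 0] by simp
  have sq: "B\<^sup>2 \<le> A * C"
  proof (cases "C = 0")
    case True
    have "B = 0"
    proof (rule ccontr)
      assume "B \<noteq> 0"
      \<comment> \<open>For \<open>C = 0\<close> the expression is affine in \<open>t\<close>; this
        choice gives it the value -1.\<close>
      then have "2 * (- (A + 1) / (2 * B)) * B = - (A + 1)" by (simp add: field_simps)
      with assms[of "- (A + 1) / (2 * B)"] True show False by simp
    qed
    with True show ?thesis by simp
  next
    case False
    have "C > 0"
    proof (rule ccontr)
      assume "\<not> C > 0"
      with False have C: "C < 0" by simp
      \<comment> \<open>Since \<open>t \<ge> 1\<close> and \<open>t * C\<close> lies below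
        \<open>- (A + 1 + 2 * \<bar>B\<bar>)\<close>, the quadratic is at most \<open>C - 1\<close>
        here.\<close>
      define t where "t = (A + 1 + 2 * \<bar>B\<bar>) / (- C) + 1"
      have t1: "t \<ge> 1" using A C by (simp add: t_def divide_nonneg_neg zero_le_divide_iff)
      have "t * C = - (A + 1 + 2 * \<bar>B\<bar>) + C" using C by (simp add: t_def field_simps)
      moreover have "A + 2 * t * B + t\<^sup>2 * C = A + t * (2 * B + t * C)"
        by (simp add: power2_eq_square algebra_simps)
      ultimately have "A + 2 * t * B + t\<^sup>2 * C = A + t * (2 * B - (A + 1 + 2 * \<bar>B\<bar>) + C)"
        by simp
      also have "\<dots> \<le> A + 1 * (2 * B - (A + 1 + 2 * \<bar>B\<bar>) + C)"
        using t1 A C by (intro add_left_mono mult_right_mono_neg) auto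
      also have "\<dots> < 0" using A C by auto
      finally show False using assms[of t] by simp
    qed
    \<comment> \<open>The minimiser \<open>- B / C\<close> turns nonnegativity into the discriminant
      inequality.\<close>
    have "0 \<le> A + 2 * (- B / C) * B + (- B / C)\<^sup>2 * C" by (rule assms)
    also have "\<dots> = A - B\<^sup>2 / C" using \<open>C > 0\<close> by (simp add: field_simps power2_eq_square)
    finally show ?thesis using \<open>C > 0\<close> by (simp add: field_simps)
  qed
  have "\<bar>B\<bar> = sqrt (B\<^sup>2)" by simp
  also have "\<dots> \<le> sqrt (A * C)" using sq by (simp only: real_sqrt_le_iff)
  finally show ?thesis by (simp add: real_sqrt_mult)
qed

lemma L2_Cauchy_Schwarz:
  assumes "in_L2 \<Omega> f" "in_L2 \<Omega> g"
  shows "\<bar>L2_inner \<Omega> f g\<bar> \<le> L2_norm \<Omega> f * L2_norm \<Omega> g"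
  unfolding L2_norm_def
proof (rule quadratic_nonneg_imp)
  fix t
  have "L2_inner \<Omega> (\<lambda>x. t *\<^sub>R g x + f x) (\<lambda>x. t *\<^sub>R g x + f x)
    = t * L2_inner \<Omega> (\<lambda>x. t *\<^sub>R g x + f x) g + L2_inner \<Omega> (\<lambda>x. t *\<^sub>R g x + f x) f"
    by (simp add: L2_inner_lin_right assms in_L2_add in_L2_scaleR)
  also have "\<dots> = L2_inner \<Omega> f f + 2 * t * L2_inner \<Omega> f g + t\<^sup>2 * L2_inner \<Omega> g g"
    by (simp only: L2_inner_lin assms L2_inner_commute[of \<Omega> g f]) (simp add: algebra_simps power2_eq_square)
  finally show "0 \<le> L2_inner \<Omega> f f + 2 * t * L2_inner \<Omega> f g + t\<^sup>2 * L2_inner \<Omega> g g"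
    using L2_inner_self_nonneg[of \<Omega> "\<lambda>x. t *\<^sub>R g x + f x"] by simp
qed

lemma L2_norm_add_le:
  assumes "in_L2 \<Omega> f" "in_L2 \<Omega> g"
  shows "L2_norm \<Omega> (\<lambda>x. f x + g x) \<le> L2_norm \<Omega> f + L2_norm \<Omega> g"
proof (rule power2_le_imp_le)
  have i: "integrable (lebesgue_on \<Omega>) (\<lambda>x. f x \<bullet> f x)" "integrable (lebesgue_on \<Omega>) (\<lambda>x. g x \<bullet> g x)"
    "integrable (lebesgue_on \<Omega>) (\<lambda>x. f x \<bullet> g x)" "integrable (lebesgue_on \<Omega>) (\<lambda>x. g x \<bullet> f x)"
    using assms in_L2_integrable_inner by blast+
  have "L2_inner \<Omega> (\<lambda>x. f x + g x) (\<lambda>x. f x + g x)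
    = L2_inner \<Omega> f f + 2 * L2_inner \<Omega> f g + L2_inner \<Omega> g g"
    using i by (simp add: L2_inner_def inner_add inner_commute algebra_simps)
  then show "(L2_norm \<Omega> (\<lambda>x. f x + g x))\<^sup>2 \<le> (L2_norm \<Omega> f + L2_norm \<Omega> g)\<^sup>2"
    using L2_Cauchy_Schwarz[OF assms] by (simp add: L2_norm_squared power2_sum)
qed (simp add: L2_norm_nonneg)

lemma L2_norm_scaleR: "L2_norm \<Omega> (\<lambda>x. c *\<^sub>R f x) = \<bar>c\<bar> * L2_norm \<Omega> f"
proof -
  have "L2_inner \<Omega> (\<lambda>x. c *\<^sub>R f x) (\<lambda>x. c *\<^sub>R f x) = c\<^sup>2 * L2_inner \<Omega> f f"
    by (simp add: L2_inner_def power2_eq_square)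
  then show ?thesis by (simp add: L2_norm_def real_sqrt_mult)
qed

text \<open>Expanding around the limits leaves only products with at least one vanishing error, so
  the weak gradient identity can be passed to the limit along an approximating sequence.\<close>

lemma L2_inner_tendsto:
  assumes "\<And>k. in_L2 \<Omega> (f k)" "\<And>k. in_L2 \<Omega> (g k)" "in_L2 \<Omega> f'" "in_L2 \<Omega> g'"
    and f: "(\<lambda>k. L2_norm \<Omega> (\<lambda>x. f' x - f k x)) \<longlonglongrightarrow> 0"
    and g: "(\<lambda>k. L2_norm \<Omega> (\<lambda>x. g' x - g k x)) \<longlonglongrightarrow> 0"
  shows "(\<lambda>k. L2_inner \<Omega> (f k) (g k)) \<longlonglongrightarrow> L2_inner \<Omega> f' g'"
proof -
  let ?F = "\<lambda>k. L2_norm \<Omega> (\<lambda>x. f' x - f k x)" and ?G = "\<lambda>k. L2_norm \<Omega> (\<lambda>x. g' x - g k x)"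
  have bd: "norm (L2_inner \<Omega> (f k) (g k) - L2_inner \<Omega> f' g')
      \<le> ?F k * ?G k + ?F k * L2_norm \<Omega> g' + L2_norm \<Omega> f' * ?G k" for k
  proof -
    have d: "in_L2 \<Omega> (\<lambda>x. f' x - f k x)" "in_L2 \<Omega> (\<lambda>x. g' x - g k x)"
      using assms by (auto intro: in_L2_diff)
    have "L2_inner \<Omega> (f k) (g k) - L2_inner \<Omega> f' g'
      = L2_inner \<Omega> (\<lambda>x. f' x - f k x) (\<lambda>x. g' x - g k x)
        - L2_inner \<Omega> (\<lambda>x. f' x - f k x) g' - L2_inner \<Omega> f' (\<lambda>x. g' x - g k x)"
      using assms d by (simp add: L2_inner_diff_left L2_inner_diff_right)
    then show ?thesis
      using L2_Cauchy_Schwarz[OF d] L2_Cauchy_Schwarz[OF d(1) assms(4)]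
        L2_Cauchy_Schwarz[OF assms(3) d(2)] by (simp only: real_norm_def)
  qed
  have "(\<lambda>k. ?F k * ?G k + ?F k * L2_norm \<Omega> g' + L2_norm \<Omega> f' * ?G k) \<longlonglongrightarrow>
      0 * 0 + 0 * L2_norm \<Omega> g' + L2_norm \<Omega> f' * 0"
    by (intro tendsto_intros f g)
  then have "(\<lambda>k. L2_inner \<Omega> (f k) (g k) - L2_inner \<Omega> f' g') \<longlonglongrightarrow> 0"
    by (intro Lim_null_comparison[OF always_eventually[OF allI[OF bd]]]) simp
  then show ?thesis by (simp add: LIM_zero_iff)
qed

section \<open>Test functions and the fundamental lemma of the calculus of variations\<close>

lemma test_functionD:
  assumes "test_function \<Omega> \<phi> d\<phi>"
  shows "GDERIV \<phi> x :> d\<phi> x" "continuous_on UNIV d\<phi>" "continuous_on UNIV \<phi>"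
    "compact (closure {x. \<phi> x \<noteq> 0})" "closure {x. \<phi> x \<noteq> 0} \<subseteq> \<Omega>"
proof -
  show "continuous_on UNIV \<phi>"
    using assms unfolding test_function_def gderiv_def
    by (meson continuous_at_imp_continuous_on has_derivative_continuous)
qed (use assms in \<open>auto simp: test_function_def\<close>)

text \<open>Any compact set outside which the function vanishes will do: the closed support, lying
  inside it, is then compact too.\<close>

lemma test_functionI:
  assumes "\<And>x. GDERIV \<phi> x :> d\<phi> x" "continuous_on UNIV d\<phi>"
    and K: "compact K" "K \<subseteq> \<Omega>" "\<And>x. x \<notin> K \<Longrightarrow> \<phi> x = 0"
  shows "test_function \<Omega> \<phi> d\<phi>"
proof -
  have "closure {x. \<phi> x \<noteq> 0} \<subseteq> K"
    using K by (intro closure_minimal) (auto simp: compact_imp_closed)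
  moreover from this have "compact (closure {x. \<phi> x \<noteq> 0})"
    using K(1) compact_closure bounded_subset[OF compact_imp_bounded] closure_subset by (metis (no_types) subset_trans)
  ultimately show ?thesis using assms by (auto simp: test_function_def)
qed

lemma zero_outside_support: "x \<notin> closure {x. \<phi> x \<noteq> 0} \<Longrightarrow> \<phi> x = 0"
  using closure_subset[of "{x. \<phi> x \<noteq> 0}"] by blast

lemma test_function_zero: "test_function \<Omega> (\<lambda>x. 0) (\<lambda>x. 0)"
  by (rule test_functionI[where K="{}"]) (auto intro: GDERIV_const)

lemma test_function_lin:
  assumes "test_function \<Omega> \<phi> d\<phi>" "test_function \<Omega> \<psi> d\<psi>"
  shows "test_function \<Omega> (\<lambda>x. c * \<phi> x + \<psi> x) (\<lambda>x. c *\<^sub>R d\<phi> x + d\<psi> x)"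
proof (rule test_functionI[where K="closure {x. \<phi> x \<noteq> 0} \<union> closure {x. \<psi> x \<noteq> 0}"])
  note D = test_functionD[OF assms(1)] test_functionD[OF assms(2)]
  show "GDERIV (\<lambda>x. c * \<phi> x + \<psi> x) x :> c *\<^sub>R d\<phi> x + d\<psi> x" for x
    by (rule GDERIV_subst[OF GDERIV_add[OF GDERIV_mult[OF GDERIV_const D(1)] D(6)]]) simp
  show "continuous_on UNIV (\<lambda>x. c *\<^sub>R d\<phi> x + d\<psi> x)"
    by (intro continuous_intros D)
  show "compact (closure {x. \<phi> x \<noteq> 0} \<union> closure {x. \<psi> x \<noteq> 0})"
    using D(4) D(9) by (rule compact_Un)
  show "closure {x. \<phi> x \<noteq> 0} \<union> closure {x. \<psi> x \<noteq> 0} \<subseteq> \<Omega>"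
    using D(5) D(10) by (rule Un_least)
  show "c * \<phi> x + \<psi> x = 0" if "x \<notin> closure {x. \<phi> x \<noteq> 0} \<union> closure {x. \<psi> x \<noteq> 0}" for x
    using that zero_outside_support[of x \<phi>] zero_outside_support[of x \<psi>] by simp
qed

lemma test_function_mult:
  assumes "test_function \<Omega> \<phi> d\<phi>" "\<And>x. GDERIV f x :> df x" "continuous_on UNIV df"
  shows "test_function \<Omega> (\<lambda>x. f x * \<phi> x) (\<lambda>x. f x *\<^sub>R d\<phi> x + \<phi> x *\<^sub>R df x)"
proof (rule test_functionI[where K="closure {x. \<phi> x \<noteq> 0}"])
  note D = test_functionD[OF assms(1)]
  show "GDERIV (\<lambda>x. f x * \<phi> x) x :> f x *\<^sub>R d\<phi> x + \<phi> x *\<^sub>R df x" for x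
    by (rule GDERIV_mult[OF assms(2) D(1)])
  have "continuous_on UNIV f"
    using assms(2) unfolding gderiv_def
    by (meson continuous_at_imp_continuous_on has_derivative_continuous)
  then show "continuous_on UNIV (\<lambda>x. f x *\<^sub>R d\<phi> x + \<phi> x *\<^sub>R df x)"
    by (intro continuous_intros D assms)
  show "compact (closure {x. \<phi> x \<noteq> 0})" "closure {x. \<phi> x \<noteq> 0} \<subseteq> \<Omega>"
    using D by auto
  show "f x * \<phi> x = 0" if "x \<notin> closure {x. \<phi> x \<noteq> 0}" for x
    using that zero_outside_support[of x \<phi>] by simp
qed

text \<open>The value 0 at 0 preserves the support. Regularity of \<open>f\<close> is asked for on
  the range of \<open>\<phi>\<close> only, because the saturating function used later has a pole at
  a negative argument.\<close>

lemma test_function_compose: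
  assumes "test_function \<Omega> \<phi> d\<phi>" "f 0 = 0" "\<And>x. DERIV f (\<phi> x) :> f' (\<phi> x)"
    and "continuous_on (range \<phi>) f'"
  shows "test_function \<Omega> (\<lambda>x. f (\<phi> x)) (\<lambda>x. f' (\<phi> x) *\<^sub>R d\<phi> x)"
proof (rule test_functionI[where K="closure {x. \<phi> x \<noteq> 0}"])
  note D = test_functionD[OF assms(1)]
  show "GDERIV (\<lambda>x. f (\<phi> x)) x :> f' (\<phi> x) *\<^sub>R d\<phi> x" for x
    by (rule GDERIV_DERIV_compose[OF D(1) assms(3)])
  show "continuous_on UNIV (\<lambda>x. f' (\<phi> x) *\<^sub>R d\<phi> x)"
    by (intro continuous_intros D continuous_on_compose2[OF assms(4) D(3)]) auto
  show "compact (closure {x. \<phi> x \<noteq> 0})" "closure {x. \<phi> x \<noteq> 0} \<subseteq> \<Omega>"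
    using D by auto
  show "f (\<phi> x) = 0" if "x \<notin> closure {x. \<phi> x \<noteq> 0}" for x
    using that assms(2) zero_outside_support[of x \<phi>] by simp
qed

section \<open>C1 bumps and approximation of open sets\<close>

lemma DERIV_max_zero_power2: "DERIV (\<lambda>t::real. (max 0 t)\<^sup>2) t :> 2 * max 0 t"
proof -
  consider "t < 0" | "t = 0" | "t > 0" by linarith
  then show ?thesis
  proof cases
    case 1
    have "DERIV (\<lambda>t::real. 0) t :> 2 * max 0 t" using 1 by simp
    moreover have "eventually (\<lambda>s. s < 0) (nhds t)" using 1 eventually_nhds_in_open[of "{..<0}" t] by simp
    then have "eventually (\<lambda>s. (max 0 s)\<^sup>2 = 0) (nhds t)" by eventually_elim simp
    ultimately show ?thesis by (subst DERIV_cong_ev[OF refl _ refl]) auto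
  next
    case 3
    have "DERIV (\<lambda>t::real. t\<^sup>2) t :> 2 * max 0 t" using 3 by (auto intro!: derivative_eq_intros)
    moreover have "eventually (\<lambda>s. s > 0) (nhds t)" using 3 eventually_nhds_in_open[of "{0<..}" t] by simp
    then have "eventually (\<lambda>s. (max 0 s)\<^sup>2 = s\<^sup>2) (nhds t)" by eventually_elim simp
    ultimately show ?thesis by (subst DERIV_cong_ev[OF refl _ refl]) auto
  next
    case 2
    \<comment> \<open>At the kink the difference quotient is \<open>h\<close> or 0 and so tends to
      0; squaring is what makes the positive part C1.\<close>
    have "norm ((max 0 h)\<^sup>2 / h) \<le> norm h" for h :: real
    proof (cases "h > 0")
      case True
      then have "max 0 h = h" by simp
      then show ?thesis using True by (simp add: power2_eq_square)
    next
      case False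
      then have "max 0 h = 0" by simp
      then show ?thesis by simp
    qed
    then have "(\<lambda>h::real. (max 0 h)\<^sup>2 / h) \<midarrow>0\<rightarrow> 0"
      by (rule Lim_null_comparison[OF always_eventually[OF allI] tendsto_norm_zero[OF tendsto_ident_at]])
    then show ?thesis using 2 by (simp add: DERIV_def)
  qed
qed

text \<open>The squared positive part of r^2 - |x - c|^2 works. Knowing the positivity set exactly,
  and not just the support, lets countably many such bumps recover an arbitrary open set.\<close>

lemma ex_test_function_ball:
  assumes "cball c r \<subseteq> \<Omega>"
  shows "\<exists>\<psi> d\<psi>. test_function \<Omega> \<psi> d\<psi> \<and> (\<forall>x. 0 \<le> \<psi> x) \<and> {x. \<psi> x > 0} = ball c r"
proof (cases "r > 0")
  case False
  then have "ball c r = {}" by simp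
  then show ?thesis using test_function_zero by fastforce
next
  case r: True
  let ?s = "\<lambda>x. r\<^sup>2 - (x - c) \<bullet> (x - c)"
  have iff: "?s x > 0 \<longleftrightarrow> x \<in> ball c r" for x
  proof -
    have "(x - c) \<bullet> (x - c) = (dist c x)\<^sup>2"
      by (metis dist_norm norm_minus_commute power2_norm_eq_inner)
    then show ?thesis using r power_strict_mono[of "dist c x" r 2] power2_less_imp_less[of "dist c x" r]
      by auto
  qed
  have der: "GDERIV ?s x :> - 2 *\<^sub>R (x - c)" for x
    unfolding gderiv_def by (auto intro!: derivative_eq_intros simp: inner_commute algebra_simps)
  have "test_function \<Omega> (\<lambda>x. (max 0 (?s x))\<^sup>2) (\<lambda>x. (2 * max 0 (?s x)) *\<^sub>R (- 2 *\<^sub>R (x - c)))"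
  proof (rule test_functionI[where K="cball c r"])
    show "GDERIV (\<lambda>x. (max 0 (?s x))\<^sup>2) x :> (2 * max 0 (?s x)) *\<^sub>R (- 2 *\<^sub>R (x - c))" for x
      by (rule GDERIV_DERIV_compose[OF der DERIV_max_zero_power2])
    show "continuous_on UNIV (\<lambda>x. (2 * max 0 (?s x)) *\<^sub>R (- 2 *\<^sub>R (x - c)))"
      by (intro continuous_intros)
    show "(max 0 (?s x))\<^sup>2 = 0" if "x \<notin> cball c r" for x
      using that iff[of x] ball_subset_cball[of c r] by (auto simp: max_def)
  qed (use assms in auto)
  moreover have "{x. (max 0 (?s x))\<^sup>2 > 0} = ball c r"
  proof -
    have "(max 0 t)\<^sup>2 > 0 \<longleftrightarrow> t > 0" for t :: real by (auto simp: max_def)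
    then show ?thesis using iff by blast
  qed
  ultimately show ?thesis
    by (intro exI[of _ "\<lambda>x. (max 0 (?s x))\<^sup>2"] exI conjI) auto
qed

text \<open>Countably many balls with closures in \<open>U\<close> cover it. Finite sums s of their
  bumps are test functions, and n s / (1 + n s) pushes them to 1 wherever some bump is positive
  while keeping 0 at 0. The bound 1 prepares dominated convergence.\<close>

lemma open_indicator_limit_test_functions:
  fixes U :: "'a::euclidean_space set"
  assumes U: "open U" "U \<subseteq> \<Omega>"
  shows "\<exists>\<phi> d\<phi>. (\<forall>n::nat. test_function \<Omega> (\<phi> n) (d\<phi> n) \<and> (\<forall>x. \<bar>\<phi> n x\<bar> \<le> 1)) \<and>
    (\<forall>x. (\<lambda>n. \<phi> n x) \<longlonglongrightarrow> indicator U x)"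
proof -
  let ?F = "insert {} {ball c r | c r. cball c r \<subseteq> U}"
  obtain F' where F': "F' \<subseteq> ?F" "countable F'" "\<Union>F' = \<Union>?F"
    using Lindelof[of ?F] by (auto simp: open_ball)
  have UF: "\<Union>?F = U"
  proof (intro equalityI subsetI)
    fix x assume "x \<in> U"
    then obtain r where "r > 0" "cball x r \<subseteq> U" using U open_contains_cball by blast
    then show "x \<in> \<Union>?F" using centre_in_ball by blast
  qed (use ball_subset_cball in fastforce)
  \<comment> \<open>With the empty set added the family can be enumerated even if \<open>U\<close>
    is empty; empty members receive the zero bump.\<close>
  let ?G = "insert {} F'"
  have G: "countable ?G" "?G \<noteq> {}" using F'(2) by auto
  define B where "B = from_nat_into ?G"
  have B: "range B = ?G" unfolding B_def by (rule range_from_nat_into[OF G(2,1)])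
  have "\<exists>\<psi> d\<psi>. test_function \<Omega> \<psi> d\<psi> \<and> (\<forall>x. 0 \<le> \<psi> x) \<and> {x. \<psi> x > 0} = B j" for j
  proof -
    have "B j \<in> ?G" using rangeI[of B j] unfolding B .
    then have "B j \<in> ?F" using F'(1) by blast
    then consider "B j = {}" | c r where "B j = ball c r" "cball c r \<subseteq> U" by auto
    then show ?thesis
    proof cases
      case 1
      then show ?thesis using test_function_zero by (intro exI[of _ "\<lambda>x. 0"]) auto
    next
      case 2
      then show ?thesis using ex_test_function_ball[of c r \<Omega>] U by auto
    qed
  qed
  then obtain \<psi> d\<psi> where \<psi>: "\<And>j. test_function \<Omega> (\<psi> j) (d\<psi> j)" "\<And>j x. 0 \<le> \<psi> j x"
    "\<And>j. {x. \<psi> j x > 0} = B j" by metis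
  have UB: "(\<Union>j. B j) = U"
    using F'(3) unfolding UF B by simp
  define S where "S n x = (\<Sum>j<n. \<psi> j x)" for n x
  define dS where "dS n x = (\<Sum>j<n. d\<psi> j x)" for n x
  have S: "test_function \<Omega> (S n) (dS n)" for n
  proof (induction n)
    case 0
    have "S 0 = (\<lambda>x. 0)" "dS 0 = (\<lambda>x. 0)" by (auto simp: S_def dS_def)
    then show ?case using test_function_zero by simp
  next
    case (Suc n)
    have "S (Suc n) = (\<lambda>x. 1 * S n x + \<psi> n x)" "dS (Suc n) = (\<lambda>x. 1 *\<^sub>R dS n x + d\<psi> n x)"
      by (auto simp: S_def dS_def)
    then show ?case using test_function_lin[OF Suc \<psi>(1), of 1] by metis
  qed
  have S0: "0 \<le> S n x" for n x unfolding S_def by (intro sum_nonneg) (simp add: \<psi>)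
  define f where "f n t = real n * t / (1 + real n * t)" for n t
  define f' where "f' n t = real n / (1 + real n * t)\<^sup>2" for n t
  have pos: "1 + real n * t > 0" if "t \<ge> 0" for n t
    using that by (simp add: add_pos_nonneg)
  have "test_function \<Omega> (\<lambda>x. f n (S n x)) (\<lambda>x. f' n (S n x) *\<^sub>R dS n x)" for n
  proof (rule test_function_compose[OF S])
    show "DERIV (f n) (S n x) :> f' n (S n x)" for x
      using pos[OF S0, of n n x] unfolding f_def f'_def
      by (auto intro!: derivative_eq_intros simp: power2_eq_square field_simps)
    show "continuous_on (range (S n)) (f' n)"
    proof -
      have "(1 + real n * t)\<^sup>2 \<noteq> 0" if t: "t \<in> range (S n)" for t
      proof -
        obtain x where "t = S n x" using t by blast
        then show ?thesis using pos[OF S0, of n n x] by simp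
      qed
      then show ?thesis unfolding f'_def by (intro continuous_intros) auto
    qed
  qed (simp add: f_def)
  moreover have "\<bar>f n (S n x)\<bar> \<le> 1" for n x
    using pos[OF S0, of n n x] S0[of n x] by (simp add: f_def)
  moreover have "(\<lambda>n. f n (S n x)) \<longlonglongrightarrow> indicator U x" for x
  proof (cases "x \<in> U")
    case True
    then obtain j where "x \<in> B j" using UB by blast
    then have j: "\<psi> j x > 0" using \<psi>(3) by blast
    \<comment> \<open>From index \<open>j\<close> on the sums stay above one fixed positive value,
      so the distance to 1 is of order 1/n.\<close>
    have lower: "S n x \<ge> \<psi> j x" if "n > j" for n
      unfolding S_def using that \<psi>(2) by (intro member_le_sum) auto
    have "filterlim (\<lambda>n. 1 + real n * \<psi> j x) at_top sequentially"
      using j by (intro filterlim_tendsto_add_at_top[OF tendsto_const]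
         filterlim_at_top_mult_tendsto_pos[OF tendsto_const _ filterlim_real_sequentially])
    then have *: "(\<lambda>n. 1 / (1 + real n * \<psi> j x)) \<longlonglongrightarrow> 0"
      by (intro tendsto_divide_0[OF tendsto_const] filterlim_at_top_imp_at_infinity)
    have "eventually (\<lambda>n. norm (f n (S n x) - 1) \<le> 1 / (1 + real n * \<psi> j x)) sequentially"
      using eventually_gt_at_top[of j]
    proof eventually_elim
      case (elim n)
      have "f n (S n x) - 1 = - (1 / (1 + real n * S n x))"
        using pos[OF S0, of n n x] by (simp add: f_def field_simps)
      moreover have "1 / (1 + real n * S n x) \<le> 1 / (1 + real n * \<psi> j x)"
        using lower[OF elim] j pos[of "\<psi> j x" n]
        by (intro divide_left_mono add_left_mono mult_left_mono mult_pos_pos) (auto intro: pos S0)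
      ultimately show ?case using pos[OF S0, of n n x] by simp
    qed
    then have "(\<lambda>n. f n (S n x) - 1) \<longlonglongrightarrow> 0" by (rule Lim_null_comparison[OF _ *])
    then show ?thesis using True by (simp add: LIM_zero_iff)
  next
    case False
    have "\<psi> j x = 0" for j
    proof -
      have "x \<notin> B j" using False UB by blast
      then show ?thesis using \<psi>(2)[of j x] \<psi>(3)[of j] by force
    qed
    then have "S n x = 0" for n by (simp add: S_def)
    then show ?thesis using False by (simp add: f_def)
  qed
  ultimately show ?thesis by (intro exI[of _ "\<lambda>n x. f n (S n x)"] exI[of _ "\<lambda>n x. f' n (S n x) *\<^sub>R dS n x"]) blast
qed

section \<open>Integrability on bounded sets and the fundamental lemma\<close>

lemma in_L2_continuous:
  assumes \<Omega>: "\<Omega> \<in> sets lebesgue" "bounded \<Omega>" and f: "continuous_on UNIV f"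
  shows "in_L2 \<Omega> f"
proof -
  have "compact (f ` closure \<Omega>)"
    using \<Omega> by (intro compact_continuous_image continuous_on_subset[OF f]) auto
  then have "bounded (f ` closure \<Omega>)" by (rule compact_imp_bounded)
  then obtain K where K': "\<forall>y\<in>f ` closure \<Omega>. norm y \<le> K" unfolding bounded_iff by blast
  have K: "norm (f x) \<le> K" if "x \<in> \<Omega>" for x
    using that closure_subset[of \<Omega>] K' by blast
  have m: "f \<in> borel_measurable (lebesgue_on \<Omega>)"
    using continuous_imp_measurable_on_sets_lebesgue[OF continuous_on_subset[OF f subset_UNIV] \<Omega>(1)] .
  have fin: "finite_measure (lebesgue_on \<Omega>)"
    using \<Omega> bounded_set_imp_lmeasurable by (intro finite_measure_lebesgue_on) blast
  have "integrable (lebesgue_on \<Omega>) (\<lambda>x. (norm (f x))\<^sup>2)"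
    using m K \<Omega> by (intro finite_measure.integrable_const_bound[OF fin, of _ "K\<^sup>2"])
      (auto intro!: AE_I2 power_mono)
  with m show ?thesis by (simp add: in_L2_def)
qed

lemma test_function_in_L2:
  assumes "\<Omega> \<in> sets lebesgue" "bounded \<Omega>" and "test_function \<Omega> \<phi> d\<phi>"
  shows "in_L2 \<Omega> \<phi>" "in_L2 \<Omega> d\<phi>"
  using assms by (auto intro!: in_L2_continuous dest: test_functionD)

lemma in_L2_imp_integrable:
  assumes \<Omega>: "\<Omega> \<in> sets lebesgue" "bounded \<Omega>" and f: "in_L2 \<Omega> f"
  shows "integrable (lebesgue_on \<Omega>) f"
proof -
  have fin: "finite_measure (lebesgue_on \<Omega>)"
    using \<Omega> bounded_set_imp_lmeasurable by (intro finite_measure_lebesgue_on) blast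
  have "integrable (lebesgue_on \<Omega>) (\<lambda>x. 1 + (norm (f x))\<^sup>2)"
    using f finite_measure.integrable_const[OF fin, of "1::real"] by (auto simp: in_L2_def)
  moreover have "norm (f x) \<le> norm (1 + (norm (f x))\<^sup>2)" for x
  proof -
    have "2 * norm (f x) \<le> 1 + (norm (f x))\<^sup>2"
      using sum_squares_bound[of 1 "norm (f x)"] by simp
    then have "norm (f x) \<le> 1 + (norm (f x))\<^sup>2" using norm_ge_zero[of "f x"] by linarith
    then show ?thesis by simp
  qed
  ultimately show ?thesis
    using f by (elim Bochner_Integration.integrable_bound) (auto simp: in_L2_def)
qed

text \<open>Test functions bounded by 1 converge pointwise to the indicator of \<open>U\<close>, so
  dominated convergence applies with majorant |h|.\<close>

lemma fundamental_lemma_open: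
  fixes h :: "'a::euclidean_space \<Rightarrow> 'b::euclidean_space"
  assumes h: "integrable (lebesgue_on \<Omega>) h"
    and zero: "\<And>\<phi> d\<phi>. test_function \<Omega> \<phi> d\<phi> \<Longrightarrow> (LINT x|lebesgue_on \<Omega>. \<phi> x *\<^sub>R h x) = 0"
    and \<Omega>: "\<Omega> \<in> sets lebesgue" and U: "open U" "U \<subseteq> \<Omega>"
  shows "(LINT x|lebesgue_on \<Omega>. indicator U x *\<^sub>R h x) = 0"
proof -
  obtain \<phi> d\<phi> where \<phi>: "\<And>n::nat. test_function \<Omega> (\<phi> n) (d\<phi> n)" "\<And>n x. \<bar>\<phi> n x\<bar> \<le> 1"
    and lim: "\<And>x. (\<lambda>n. \<phi> n x) \<longlonglongrightarrow> indicator U x"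
    using open_indicator_limit_test_functions[OF U] by metis
  have [measurable]: "h \<in> borel_measurable (lebesgue_on \<Omega>)" using h by auto
  have m: "\<phi> n \<in> borel_measurable (lebesgue_on \<Omega>)" for n
    by (meson continuous_imp_measurable_on_sets_lebesgue \<Omega> \<phi>(1) continuous_on_subset subset_UNIV test_functionD(3))
  have "U \<in> sets (lebesgue_on \<Omega>)"
    using U \<Omega> by (simp add: sets_restrict_space_iff lborelD)
  then have mU: "(indicator U :: 'a \<Rightarrow> real) \<in> borel_measurable (lebesgue_on \<Omega>)" by measurable
  have "(\<lambda>n. LINT x|lebesgue_on \<Omega>. \<phi> n x *\<^sub>R h x) \<longlonglongrightarrow> (LINT x|lebesgue_on \<Omega>. indicator U x *\<^sub>R h x)"
  proof (rule integral_dominated_convergence[where w="\<lambda>x. norm (h x)"])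
    show "AE x in lebesgue_on \<Omega>. norm (\<phi> n x *\<^sub>R h x) \<le> norm (h x)" for n
      using \<phi>(2) by (auto intro!: AE_I2 mult_left_le_one_le)
    show "AE x in lebesgue_on \<Omega>. (\<lambda>n. \<phi> n x *\<^sub>R h x) \<longlonglongrightarrow> indicator U x *\<^sub>R h x"
      by (intro AE_I2 tendsto_scaleR lim tendsto_const)
  qed (use h m mU in auto)
  moreover have "(LINT x|lebesgue_on \<Omega>. \<phi> n x *\<^sub>R h x) = 0" for n using zero \<phi>(1) by blast
  ultimately show ?thesis by (simp add: LIMSEQ_const_iff)
qed

lemma Int_stable_open: "Int_stable {S::'a::topological_space set. open S}"
  by (auto simp: Int_stable_def)

text \<open>The integral vanishes over open sets, a class stable under intersection, and this passes
  to complements and countable disjoint unions; Dynkin's theorem gives all Borel sets. A function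
  with zero integral over every measurable set vanishes almost everywhere.\<close>

lemma fundamental_lemma:
  fixes h :: "'a::euclidean_space \<Rightarrow> 'b::euclidean_space"
  assumes h: "integrable (lebesgue_on \<Omega>) h"
    and zero: "\<And>\<phi> d\<phi>. test_function \<Omega> \<phi> d\<phi> \<Longrightarrow> (LINT x|lebesgue_on \<Omega>. \<phi> x *\<^sub>R h x) = 0"
    and \<Omega>: "open \<Omega>" "bounded \<Omega>"
  shows "AE x in lebesgue_on \<Omega>. h x = 0"
proof -
  let ?M = "lebesgue_on \<Omega>"
  have \<Omega>s: "\<Omega> \<in> sets lebesgue" using \<Omega> by (simp add: lborelD)
  have fin: "finite_measure ?M"
    using \<Omega> \<Omega>s bounded_set_imp_lmeasurable by (intro finite_measure_lebesgue_on) blast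
  have [measurable]: "h \<in> borel_measurable ?M" using h by auto
  have sb: "A \<inter> \<Omega> \<in> sets ?M" if "A \<in> sets borel" for A
    using that \<Omega>s by (auto simp: sets_restrict_space_iff)
  have ind: "integrable ?M (\<lambda>x. indicator A x *\<^sub>R h x)" if "A \<in> sets borel" for A
  proof -
    have "integrable ?M (\<lambda>x. indicator (A \<inter> \<Omega>) x *\<^sub>R h x)"
      using h sb[OF that] by (rule integrable_mult_indicator[rotated])
    then show ?thesis by (rule Bochner_Integration.integrable_cong[THEN iffD1, rotated -1]) (auto simp: indicator_def)
  qed
  have borel: "(LINT x|?M. indicator A x *\<^sub>R h x) = 0" if A: "A \<in> sets borel" for A
  proof -
    have "Int_stable {S::'a set. open S}" by (rule Int_stable_open)
    moreover have "{S::'a set. open S} \<subseteq> Pow UNIV" by simp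
    moreover have "A \<in> sigma_sets UNIV {S. open S}" using A by (simp add: borel_def)
    ultimately show ?thesis
    proof (induction rule: sigma_sets_induct_disjoint)
      case (basic A)
      then have "(LINT x|?M. indicator (A \<inter> \<Omega>) x *\<^sub>R h x) = 0"
        using \<Omega> by (intro fundamental_lemma_open[OF h zero \<Omega>s]) auto
      also have "(LINT x|?M. indicator (A \<inter> \<Omega>) x *\<^sub>R h x) = (LINT x|?M. indicator A x *\<^sub>R h x)"
        by (rule Bochner_Integration.integral_cong) (auto simp: indicator_def)
      finally show ?case .
    next
      case (compl A)
      have A: "A \<in> sets borel" using compl by (simp add: borel_def)
      have "(LINT x|?M. indicator (UNIV - A) x *\<^sub>R h x) = (LINT x|?M. h x - indicator A x *\<^sub>R h x)"
        by (rule Bochner_Integration.integral_cong) (auto simp: indicator_def)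
      also have "\<dots> = (LINT x|?M. h x) - (LINT x|?M. indicator A x *\<^sub>R h x)"
        by (rule Bochner_Integration.integral_diff[OF h ind[OF A]])
      \<comment> \<open>The integral over the whole domain is itself a basic case, because the
        domain is open.\<close>
      also have "(LINT x|?M. h x) = (LINT x|?M. indicator \<Omega> x *\<^sub>R h x)"
        by (rule Bochner_Integration.integral_cong) (auto simp: indicator_def)
      also have "\<dots> = 0"
        using \<Omega> by (intro fundamental_lemma_open[OF h zero \<Omega>s]) auto
      finally show ?case using compl by simp
    next
      case (union A)
      have A: "A i \<in> sets borel" for i using union by (auto simp: borel_def)
      have "(LINT x:(\<Union>i. A i \<inter> \<Omega>)|?M. h x) = (\<Sum>i. (LINT x:(A i \<inter> \<Omega>)|?M. h x))"
      proof (rule lebesgue_integral_countable_add)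
        show "A i \<inter> \<Omega> \<in> sets ?M" for i using sb[OF A] .
        show "(A i \<inter> \<Omega>) \<inter> (A j \<inter> \<Omega>) = {}" if "i \<noteq> j" for i j
          using that union(1) by (auto simp: disjoint_family_on_def)
        have "(\<Union>i. A i \<inter> \<Omega>) \<in> sets ?M" using sb[OF A] by (intro sets.countable_UN) auto
        then show "set_integrable ?M (\<Union>i. A i \<inter> \<Omega>) h"
          using h unfolding set_integrable_def by (rule integrable_mult_indicator)
      qed
      moreover have "(LINT x:(A i \<inter> \<Omega>)|?M. h x) = 0" for i
      proof -
        have "(LINT x:(A i \<inter> \<Omega>)|?M. h x) = (LINT x|?M. indicator (A i) x *\<^sub>R h x)"
          unfolding set_lebesgue_integral_def
          by (rule Bochner_Integration.integral_cong) (auto simp: indicator_def)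
        then show ?thesis using union by simp
      qed
      moreover have "(LINT x:(\<Union>i. A i \<inter> \<Omega>)|?M. h x) = (LINT x|?M. indicator (\<Union>i. A i) x *\<^sub>R h x)"
        unfolding set_lebesgue_integral_def
        by (rule Bochner_Integration.integral_cong) (auto simp: indicator_def)
      ultimately show ?case by simp
    qed auto
  qed
  show ?thesis
  proof (rule sigma_finite_measure.density_zero[OF finite_measure.axioms(1)[OF fin] h])
    fix A assume A: "A \<in> sets ?M"
    then have "A \<in> sets lebesgue" "A \<subseteq> \<Omega>" using \<Omega>s by (auto simp: sets_restrict_space_iff)
    \<comment> \<open>A Lebesgue set is a Borel set plus part of a Borel null set, and that part
      does not change the integral.\<close>
    then obtain S N N' where S: "A = S \<union> N" "N \<subseteq> N'" "N' \<in> null_sets lborel" "S \<in> sets lborel"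
      by (auto elim: sets_completionE)
    have "AE x in lebesgue. x \<notin> N'" using S(3) by (intro AE_not_in null_sets_completionI)
    then have "AE x in ?M. x \<notin> N'" using \<Omega>s by (simp add: AE_restrict_space_iff) (metis (mono_tags, lifting) eventually_mono)
    then have "AE x in ?M. indicator A x *\<^sub>R h x = indicator S x *\<^sub>R h x"
      by eventually_elim (use S in \<open>auto simp: indicator_def\<close>)
    then have "(LINT x|?M. indicator A x *\<^sub>R h x) = (LINT x|?M. indicator S x *\<^sub>R h x)"
      using A h ind[of S] S(4)
      by (intro integral_cong_AE) (auto intro: borel_measurable_integrable)
    then show "(LINT x:A|?M. h x) = 0"
      using borel[of S] S(4) by (simp add: set_lebesgue_integral_def)
  qed
qed

section \<open>Functions with zero trace\<close>

lemma L2_norm_mono: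
  assumes f: "in_L2 \<Omega> f" "in_L2 \<Omega> g" and K: "0 \<le> K"
    and le: "\<And>x. x \<in> \<Omega> \<Longrightarrow> norm (f x) \<le> K * norm (g x)"
  shows "L2_norm \<Omega> f \<le> K * L2_norm \<Omega> g"
proof (rule power2_le_imp_le)
  have "(L2_norm \<Omega> f)\<^sup>2 = (LINT x|lebesgue_on \<Omega>. (norm (f x))\<^sup>2)"
    by (simp add: L2_norm_squared L2_inner_def power2_norm_eq_inner)
  also have "\<dots> \<le> (LINT x|lebesgue_on \<Omega>. K\<^sup>2 * (norm (g x))\<^sup>2)"
  proof (rule integral_mono)
    fix x assume "x \<in> space (lebesgue_on \<Omega>)"
    then have "x \<in> \<Omega>" by simp
    then show "(norm (f x))\<^sup>2 \<le> K\<^sup>2 * (norm (g x))\<^sup>2"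
      using power_mono[OF le[of x], of 2] by (simp add: power_mult_distrib)
  qed (use f in \<open>auto simp: in_L2_def\<close>)
  also have "\<dots> = (K * L2_norm \<Omega> g)\<^sup>2"
    by (simp add: power_mult_distrib L2_norm_squared L2_inner_def power2_norm_eq_inner)
  finally show "(L2_norm \<Omega> f)\<^sup>2 \<le> (K * L2_norm \<Omega> g)\<^sup>2" .
qed (use K L2_norm_nonneg[of \<Omega> g] in simp)

lemma L2_norm_cong_AE:
  assumes "AE x in lebesgue_on \<Omega>. f x = f' x" and f: "in_L2 \<Omega> f" "in_L2 \<Omega> f'"
  shows "L2_norm \<Omega> f = L2_norm \<Omega> f'"
proof -
  have "L2_inner \<Omega> f f = L2_inner \<Omega> f' f" by (rule L2_inner_cong_AE[OF assms(1) f f(1)])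
  also have "\<dots> = L2_inner \<Omega> f f'" by (rule L2_inner_commute)
  also have "\<dots> = L2_inner \<Omega> f' f'" by (rule L2_inner_cong_AE[OF assms(1) f f(2)])
  finally show ?thesis by (simp add: L2_norm_def)
qed

section \<open>Weak gradients on a bounded open set\<close>

locale bounded_open_set =
  fixes \<Omega> :: "'a::euclidean_space set"
  assumes open_domain: "open \<Omega>" and bounded_domain: "bounded \<Omega>"
begin

lemma sets_domain: "\<Omega> \<in> sets lebesgue"
  using open_domain by (simp add: lborelD)

lemma in_L2_test_function:
  "test_function \<Omega> \<phi> d\<phi> \<Longrightarrow> in_L2 \<Omega> \<phi>" "test_function \<Omega> \<phi> d\<phi> \<Longrightarrow> in_L2 \<Omega> d\<phi>"
  by (simp_all add: test_function_in_L2[OF sets_domain bounded_domain])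

lemma in_L2_scaleR_continuous:
  fixes X :: "'a \<Rightarrow> real"
  assumes X: "continuous_on UNIV X" and f: "in_L2 \<Omega> f" and K: "\<And>x. x \<in> \<Omega> \<Longrightarrow> \<bar>X x\<bar> \<le> K"
  shows "in_L2 \<Omega> (\<lambda>x. X x *\<^sub>R f x)"
proof -
  have [measurable]: "f \<in> borel_measurable (lebesgue_on \<Omega>)" using f by (auto simp: in_L2_def)
  have [measurable]: "X \<in> borel_measurable (lebesgue_on \<Omega>)"
    by (rule continuous_imp_measurable_on_sets_lebesgue[OF continuous_on_subset[OF X subset_UNIV] sets_domain])
  have "integrable (lebesgue_on \<Omega>) (\<lambda>x. K\<^sup>2 * (norm (f x))\<^sup>2)"
    using f by (auto simp: in_L2_def)
  moreover have "(\<lambda>x. (norm (X x *\<^sub>R f x))\<^sup>2) \<in> borel_measurable (lebesgue_on \<Omega>)"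
    by measurable
  moreover have "norm ((norm (X x *\<^sub>R f x))\<^sup>2) \<le> norm (K\<^sup>2 * (norm (f x))\<^sup>2)" if "x \<in> \<Omega>" for x
    using power_mono[OF K[OF that], of 2] by (simp add: power_mult_distrib mult_right_mono)
  then have "AE x in lebesgue_on \<Omega>. norm ((norm (X x *\<^sub>R f x))\<^sup>2) \<le> norm (K\<^sup>2 * (norm (f x))\<^sup>2)"
    by (intro AE_I2) simp
  ultimately have "integrable (lebesgue_on \<Omega>) (\<lambda>x. (norm (X x *\<^sub>R f x))\<^sup>2)"
    by (rule Bochner_Integration.integrable_bound)
  moreover have "(\<lambda>x. X x *\<^sub>R f x) \<in> borel_measurable (lebesgue_on \<Omega>)"
    by measurable
  ultimately show ?thesis by (simp add: in_L2_def)
qed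

lemma integrable_test_scaleR:
  assumes \<phi>: "test_function \<Omega> \<phi> d\<phi>" and g: "in_L2 \<Omega> g"
  shows "integrable (lebesgue_on \<Omega>) (\<lambda>x. \<phi> x *\<^sub>R g x)"
proof -
  note D = test_functionD[OF \<phi>]
  have "compact (\<phi> ` closure \<Omega>)"
    using bounded_domain by (intro compact_continuous_image continuous_on_subset[OF D(3)]) auto
  then have "bounded (\<phi> ` closure \<Omega>)" by (rule compact_imp_bounded)
  then obtain K where K': "\<forall>y\<in>\<phi> ` closure \<Omega>. norm y \<le> K" unfolding bounded_iff by blast
  have K: "\<bar>\<phi> x\<bar> \<le> K" if "x \<in> \<Omega>" for x
    using that closure_subset[of \<Omega>] K' by force
  show ?thesis
    by (rule in_L2_imp_integrable[OF sets_domain bounded_domain in_L2_scaleR_continuous[OF D(3) g K]])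
qed

lemma integrable_scaleR_test:
  assumes \<phi>: "test_function \<Omega> \<phi> d\<phi>" and q: "in_L2 \<Omega> q"
  shows "integrable (lebesgue_on \<Omega>) (\<lambda>x. q x *\<^sub>R d\<phi> x)"
proof -
  note D = test_functionD[OF \<phi>]
  have [measurable]: "q \<in> borel_measurable (lebesgue_on \<Omega>)" using q by (auto simp: in_L2_def)
  have [measurable]: "d\<phi> \<in> borel_measurable (lebesgue_on \<Omega>)"
    using in_L2_test_function(2)[OF \<phi>] by (auto simp: in_L2_def)
  have "in_L2 \<Omega> (\<lambda>x. norm (d\<phi> x))" using in_L2_test_function(2)[OF \<phi>] by (auto simp: in_L2_def)
  from in_L2_integrable_inner[OF q this]
  have "integrable (lebesgue_on \<Omega>) (\<lambda>x. q x * norm (d\<phi> x))" by simp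
  then show ?thesis by (rule Bochner_Integration.integrable_bound) (auto intro: AE_I2)
qed

text \<open>The difference of two weak gradients integrates to zero against every test function.
  This is what makes the representative chosen by \<open>grad\<close> usable.\<close>

lemma weak_gradient_unique:
  assumes "has_weak_gradient \<Omega> q g" "has_weak_gradient \<Omega> q g'"
  shows "AE x in lebesgue_on \<Omega>. g x = g' x"
proof -
  have g: "in_L2 \<Omega> g" "in_L2 \<Omega> g'" using assms by (auto simp: has_weak_gradient_def)
  have "AE x in lebesgue_on \<Omega>. g x - g' x = 0"
  proof (rule fundamental_lemma[OF _ _ open_domain bounded_domain])
    show "integrable (lebesgue_on \<Omega>) (\<lambda>x. g x - g' x)"
      by (rule in_L2_imp_integrable[OF sets_domain bounded_domain in_L2_diff[OF g]])
    fix \<phi> d\<phi> assume \<phi>: "test_function \<Omega> \<phi> d\<phi>"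
    have "(LINT x|lebesgue_on \<Omega>. q x *\<^sub>R d\<phi> x) = - (LINT x|lebesgue_on \<Omega>. \<phi> x *\<^sub>R g x)"
      "(LINT x|lebesgue_on \<Omega>. q x *\<^sub>R d\<phi> x) = - (LINT x|lebesgue_on \<Omega>. \<phi> x *\<^sub>R g' x)"
      using assms \<phi> unfolding has_weak_gradient_def by blast+
    then have "(LINT x|lebesgue_on \<Omega>. \<phi> x *\<^sub>R g x) = (LINT x|lebesgue_on \<Omega>. \<phi> x *\<^sub>R g' x)"
      by simp
    then show "(LINT x|lebesgue_on \<Omega>. \<phi> x *\<^sub>R (g x - g' x)) = 0"
      using integrable_test_scaleR[OF \<phi> g(1)] integrable_test_scaleR[OF \<phi> g(2)]
      by (simp add: scaleR_diff_right)
  qed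
  then show ?thesis by simp
qed

lemma weak_gradient_lin:
  assumes "has_weak_gradient \<Omega> q g" "has_weak_gradient \<Omega> q' g'"
  shows "has_weak_gradient \<Omega> (\<lambda>x. c * q x + q' x) (\<lambda>x. c *\<^sub>R g x + g' x)"
proof -
  have L: "in_L2 \<Omega> q" "in_L2 \<Omega> q'" "in_L2 \<Omega> g" "in_L2 \<Omega> g'"
    using assms by (auto simp: has_weak_gradient_def)
  have "(LINT x|lebesgue_on \<Omega>. (c * q x + q' x) *\<^sub>R d\<phi> x) = - (LINT x|lebesgue_on \<Omega>. \<phi> x *\<^sub>R (c *\<^sub>R g x + g' x))"
    if \<phi>: "test_function \<Omega> \<phi> d\<phi>" for \<phi> d\<phi>
  proof -
    note i = integrable_test_scaleR[OF \<phi> L(3)] integrable_test_scaleR[OF \<phi> L(4)]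
      integrable_scaleR_test[OF \<phi> L(1)] integrable_scaleR_test[OF \<phi> L(2)]
    have eq: "(LINT x|lebesgue_on \<Omega>. q x *\<^sub>R d\<phi> x) = - (LINT x|lebesgue_on \<Omega>. \<phi> x *\<^sub>R g x)"
      "(LINT x|lebesgue_on \<Omega>. q' x *\<^sub>R d\<phi> x) = - (LINT x|lebesgue_on \<Omega>. \<phi> x *\<^sub>R g' x)"
      using assms \<phi> by (auto simp: has_weak_gradient_def)
    have "(LINT x|lebesgue_on \<Omega>. (c * q x + q' x) *\<^sub>R d\<phi> x) =
      (LINT x|lebesgue_on \<Omega>. c *\<^sub>R (q x *\<^sub>R d\<phi> x) + q' x *\<^sub>R d\<phi> x)"
      by (simp add: scaleR_add_left)
    also have "\<dots> = c *\<^sub>R (LINT x|lebesgue_on \<Omega>. q x *\<^sub>R d\<phi> x) + (LINT x|lebesgue_on \<Omega>. q' x *\<^sub>R d\<phi> x)"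
      using i by (simp del: scaleR_scaleR)
    also have "\<dots> = - (c *\<^sub>R (LINT x|lebesgue_on \<Omega>. \<phi> x *\<^sub>R g x) + (LINT x|lebesgue_on \<Omega>. \<phi> x *\<^sub>R g' x))"
      by (simp add: eq)
    also have "\<dots> = - (LINT x|lebesgue_on \<Omega>. c *\<^sub>R (\<phi> x *\<^sub>R g x) + \<phi> x *\<^sub>R g' x)"
      using i by (simp del: scaleR_scaleR)
    also have "\<dots> = - (LINT x|lebesgue_on \<Omega>. \<phi> x *\<^sub>R (c *\<^sub>R g x + g' x))"
      by (simp add: scaleR_add_right mult.commute)
    finally show ?thesis .
  qed
  moreover have "in_L2 \<Omega> (\<lambda>x. c * q x + q' x)"
    using in_L2_add[OF in_L2_scaleR[OF L(1), of c] L(2)] by simp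
  moreover have "in_L2 \<Omega> (\<lambda>x. c *\<^sub>R g x + g' x)"
    by (rule in_L2_add[OF in_L2_scaleR[OF L(3)] L(4)])
  ultimately show ?thesis by (auto simp: has_weak_gradient_def)
qed

lemma has_weak_gradient_grad:
  assumes "q \<in> H1_0 \<Omega>"
  shows "has_weak_gradient \<Omega> q (grad \<Omega> q)"
proof -
  obtain g where "has_weak_gradient \<Omega> q g" using assms by (auto simp: H1_0_def)
  then show ?thesis unfolding grad_def by (rule someI[where P="has_weak_gradient \<Omega> q"])
qed

lemma in_L2_H1_0: "q \<in> H1_0 \<Omega> \<Longrightarrow> in_L2 \<Omega> q"
  and in_L2_grad: "q \<in> H1_0 \<Omega> \<Longrightarrow> in_L2 \<Omega> (grad \<Omega> q)"
  using has_weak_gradient_grad by (auto simp: has_weak_gradient_def)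

text \<open>The gradient that witnesses membership in \<open>H1_0\<close> need not be
  \<open>grad\<close>; the two agree almost everywhere, so one approximating sequence serves
  both.\<close>

lemma H1_0_approx:
  assumes q: "q \<in> H1_0 \<Omega>"
  obtains \<phi> d\<phi> where "\<And>k::nat. test_function \<Omega> (\<phi> k) (d\<phi> k)"
    "(\<lambda>k. L2_norm \<Omega> (\<lambda>x. q x - \<phi> k x)) \<longlonglongrightarrow> 0"
    "(\<lambda>k. L2_norm \<Omega> (\<lambda>x. grad \<Omega> q x - d\<phi> k x)) \<longlonglongrightarrow> 0"
proof -
  obtain g \<phi> d\<phi> where g: "has_weak_gradient \<Omega> q g" and t: "\<And>k::nat. test_function \<Omega> (\<phi> k) (d\<phi> k)"
    and l: "(\<lambda>k. L2_norm \<Omega> (\<lambda>x. q x - \<phi> k x)) \<longlonglongrightarrow> 0"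
    "(\<lambda>k. L2_norm \<Omega> (\<lambda>x. g x - d\<phi> k x)) \<longlonglongrightarrow> 0"
    using q by (auto simp: H1_0_def)
  have "L2_norm \<Omega> (\<lambda>x. grad \<Omega> q x - d\<phi> k x) = L2_norm \<Omega> (\<lambda>x. g x - d\<phi> k x)" for k
  proof (rule L2_norm_cong_AE)
    show "AE x in lebesgue_on \<Omega>. grad \<Omega> q x - d\<phi> k x = g x - d\<phi> k x"
      using weak_gradient_unique[OF has_weak_gradient_grad[OF q] g] by eventually_elim simp
    show "in_L2 \<Omega> (\<lambda>x. grad \<Omega> q x - d\<phi> k x)" "in_L2 \<Omega> (\<lambda>x. g x - d\<phi> k x)"
      using in_L2_diff[OF _ in_L2_test_function(2)[OF t]] in_L2_grad[OF q] g
      by (auto simp: has_weak_gradient_def)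
  qed
  with l have "(\<lambda>k. L2_norm \<Omega> (\<lambda>x. grad \<Omega> q x - d\<phi> k x)) \<longlonglongrightarrow> 0" by simp
  with t l(1) show ?thesis by (rule that)
qed

lemma L2_norm_lin_tendsto_zero:
  assumes f: "\<And>k. in_L2 \<Omega> (f k)" "\<And>k. in_L2 \<Omega> (g k)" 
    and l: "(\<lambda>k. L2_norm \<Omega> (f k)) \<longlonglongrightarrow> 0" "(\<lambda>k. L2_norm \<Omega> (g k)) \<longlonglongrightarrow> 0"
  shows "(\<lambda>k. L2_norm \<Omega> (\<lambda>x. c *\<^sub>R f k x + g k x)) \<longlonglongrightarrow> 0"
proof (rule Lim_null_comparison)
  show "(\<lambda>k. \<bar>c\<bar> * L2_norm \<Omega> (f k) + L2_norm \<Omega> (g k)) \<longlonglongrightarrow> 0"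
    using tendsto_add[OF tendsto_mult[OF tendsto_const[of "\<bar>c\<bar>"] l(1)] l(2)] by simp
  show "\<forall>\<^sub>F k in sequentially. norm (L2_norm \<Omega> (\<lambda>x. c *\<^sub>R f k x + g k x))
      \<le> \<bar>c\<bar> * L2_norm \<Omega> (f k) + L2_norm \<Omega> (g k)"
  proof (intro always_eventually allI)
    fix k
    show "norm (L2_norm \<Omega> (\<lambda>x. c *\<^sub>R f k x + g k x)) \<le> \<bar>c\<bar> * L2_norm \<Omega> (f k) + L2_norm \<Omega> (g k)"
      using L2_norm_add_le[OF in_L2_scaleR[OF f(1), of c] f(2), of k k]
      by (simp add: L2_norm_scaleR L2_norm_nonneg)
  qed
qed

lemma H1_0_lin:
  assumes q: "q \<in> H1_0 \<Omega>" and q': "q' \<in> H1_0 \<Omega>"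
  shows "(\<lambda>x. c * q x + q' x) \<in> H1_0 \<Omega>"
proof -
  obtain \<phi> d\<phi> where t: "\<And>k::nat. test_function \<Omega> (\<phi> k) (d\<phi> k)"
    and l: "(\<lambda>k. L2_norm \<Omega> (\<lambda>x. q x - \<phi> k x)) \<longlonglongrightarrow> 0"
    "(\<lambda>k. L2_norm \<Omega> (\<lambda>x. grad \<Omega> q x - d\<phi> k x)) \<longlonglongrightarrow> 0" using H1_0_approx[OF q] by blast
  obtain \<phi>' d\<phi>' where t': "\<And>k::nat. test_function \<Omega> (\<phi>' k) (d\<phi>' k)"
    and l': "(\<lambda>k. L2_norm \<Omega> (\<lambda>x. q' x - \<phi>' k x)) \<longlonglongrightarrow> 0"
    "(\<lambda>k. L2_norm \<Omega> (\<lambda>x. grad \<Omega> q' x - d\<phi>' k x)) \<longlonglongrightarrow> 0" using H1_0_approx[OF q'] by blast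
  note d = in_L2_diff[OF in_L2_H1_0[OF q] in_L2_test_function(1)[OF t]]
    in_L2_diff[OF in_L2_H1_0[OF q'] in_L2_test_function(1)[OF t']]
    in_L2_diff[OF in_L2_grad[OF q] in_L2_test_function(2)[OF t]]
    in_L2_diff[OF in_L2_grad[OF q'] in_L2_test_function(2)[OF t']]
  have "(\<lambda>k. L2_norm \<Omega> (\<lambda>x. c *\<^sub>R (q x - \<phi> k x) + (q' x - \<phi>' k x))) \<longlonglongrightarrow> 0"
    by (rule L2_norm_lin_tendsto_zero[OF d(1,2) l(1) l'(1)])
  then have "(\<lambda>k. L2_norm \<Omega> (\<lambda>x. (c * q x + q' x) - (c * \<phi> k x + \<phi>' k x))) \<longlonglongrightarrow> 0"
    by (simp add: algebra_simps)
  moreover have "(\<lambda>k. L2_norm \<Omega> (\<lambda>x. c *\<^sub>R (grad \<Omega> q x - d\<phi> k x) + (grad \<Omega> q' x - d\<phi>' k x))) \<longlonglongrightarrow> 0"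
    by (rule L2_norm_lin_tendsto_zero[OF d(3,4) l(2) l'(2)])
  then have "(\<lambda>k. L2_norm \<Omega> (\<lambda>x. (c *\<^sub>R grad \<Omega> q x + grad \<Omega> q' x) - (c *\<^sub>R d\<phi> k x + d\<phi>' k x))) \<longlonglongrightarrow> 0"
    by (simp add: algebra_simps)
  moreover have "test_function \<Omega> (\<lambda>x. c * \<phi> k x + \<phi>' k x) (\<lambda>x. c *\<^sub>R d\<phi> k x + d\<phi>' k x)" for k
    by (rule test_function_lin[OF t t'])
  moreover note weak_gradient_lin[OF has_weak_gradient_grad[OF q] has_weak_gradient_grad[OF q'], of c]
  ultimately show ?thesis unfolding H1_0_def
    by (intro CollectI exI[of _ "\<lambda>x. c *\<^sub>R grad \<Omega> q x + grad \<Omega> q' x"] conjI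
        exI[of _ "\<lambda>k x. c * \<phi> k x + \<phi>' k x"] exI[of _ "\<lambda>k x. c *\<^sub>R d\<phi> k x + d\<phi>' k x"] allI)
qed

lemma grad_lin:
  assumes q: "q \<in> H1_0 \<Omega>" and q': "q' \<in> H1_0 \<Omega>"
  shows "AE x in lebesgue_on \<Omega>. grad \<Omega> (\<lambda>x. c * q x + q' x) x = c *\<^sub>R grad \<Omega> q x + grad \<Omega> q' x"
  by (rule weak_gradient_unique[OF has_weak_gradient_grad[OF H1_0_lin[OF q q']]
        weak_gradient_lin[OF has_weak_gradient_grad[OF q] has_weak_gradient_grad[OF q']]])

text \<open>Testing the weak gradient with \<open>(x \<bullet> b) \<phi>\<^sub>k\<close>, where \<open>\<phi>\<^sub>k\<close> approximates \<open>q\<close>, gives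
  \<open>\<parallel>q\<parallel>\<^sup>2 = - 2 \<integral> (x \<bullet> b) q \<partial>\<^sub>b q\<close> in the limit.\<close>

lemma directional_Poincare:
  assumes q: "q \<in> H1_0 \<Omega>" and b: "b \<bullet> b = 1" and R: "\<And>x. x \<in> \<Omega> \<Longrightarrow> \<bar>x \<bullet> b\<bar> \<le> R" "0 \<le> R"
  shows "L2_norm \<Omega> q \<le> 2 * R * L2_norm \<Omega> (\<lambda>x. grad \<Omega> q x \<bullet> b)"
proof -
  let ?g = "grad \<Omega> q"
  have qL: "in_L2 \<Omega> q" and gL: "in_L2 \<Omega> ?g" using in_L2_H1_0[OF q] in_L2_grad[OF q] .
  have bl: "bounded_linear (\<lambda>y::'a. y \<bullet> b)" by (rule bounded_linear_inner_left)
  have gb: "in_L2 \<Omega> (\<lambda>x. ?g x \<bullet> b)" by (rule in_L2_bounded_linear[OF bl gL])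
  have cX: "continuous_on UNIV (\<lambda>x::'a. x \<bullet> b)" by (intro continuous_intros)
  have Xq: "in_L2 \<Omega> (\<lambda>x. (x \<bullet> b) * q x)"
    using in_L2_scaleR_continuous[OF cX qL R(1)] by simp
  have Xg: "in_L2 \<Omega> (\<lambda>x. (x \<bullet> b) * (?g x \<bullet> b))"
    using in_L2_scaleR_continuous[OF cX gb R(1)] by simp
  obtain \<phi> d\<phi> where t: "\<And>k::nat. test_function \<Omega> (\<phi> k) (d\<phi> k)"
    and l: "(\<lambda>k. L2_norm \<Omega> (\<lambda>x. q x - \<phi> k x)) \<longlonglongrightarrow> 0"
    "(\<lambda>k. L2_norm \<Omega> (\<lambda>x. ?g x - d\<phi> k x)) \<longlonglongrightarrow> 0" using H1_0_approx[OF q] by blast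
  have \<phi>L: "in_L2 \<Omega> (\<phi> k)" and d\<phi>L: "in_L2 \<Omega> (d\<phi> k)" for k
    using in_L2_test_function[OF t] by blast+
  have d\<phi>b: "in_L2 \<Omega> (\<lambda>x. d\<phi> k x \<bullet> b)" for k by (rule in_L2_bounded_linear[OF bl d\<phi>L])
  have nb: "norm b = 1" using b by (simp add: norm_eq_sqrt_inner)
  have lb: "(\<lambda>k. L2_norm \<Omega> (\<lambda>x. ?g x \<bullet> b - d\<phi> k x \<bullet> b)) \<longlonglongrightarrow> 0"
  proof (rule Lim_null_comparison[OF _ l(2)], intro always_eventually allI)
    fix k
    have d: "in_L2 \<Omega> (\<lambda>x. ?g x - d\<phi> k x)" by (rule in_L2_diff[OF gL d\<phi>L])
    have "L2_norm \<Omega> (\<lambda>x. (?g x - d\<phi> k x) \<bullet> b) \<le> 1 * L2_norm \<Omega> (\<lambda>x. ?g x - d\<phi> k x)"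
    proof (rule L2_norm_mono[OF in_L2_bounded_linear[OF bl d] d])
      fix x show "norm ((?g x - d\<phi> k x) \<bullet> b) \<le> 1 * norm (?g x - d\<phi> k x)"
        using Cauchy_Schwarz_ineq2[of "?g x - d\<phi> k x" b] nb by simp
    qed simp
    then show "norm (L2_norm \<Omega> (\<lambda>x. ?g x \<bullet> b - d\<phi> k x \<bullet> b)) \<le> L2_norm \<Omega> (\<lambda>x. ?g x - d\<phi> k x)"
      by (simp add: inner_diff_left L2_norm_nonneg)
  qed
  \<comment> \<open>The derivative of (x . b) phi_k along b is (x . b) (d phi_k . b) + phi_k; the
    last term is the source of the norm of \<open>q\<close>.\<close>
  have eq: "L2_inner \<Omega> (\<lambda>x. (x \<bullet> b) * q x) (\<lambda>x. d\<phi> k x \<bullet> b) + L2_inner \<Omega> q (\<phi> k)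
    = - L2_inner \<Omega> (\<phi> k) (\<lambda>x. (x \<bullet> b) * (?g x \<bullet> b))" for k
  proof -
    have gd: "GDERIV (\<lambda>x. x \<bullet> b) x :> b" for x
      unfolding gderiv_def by (auto intro!: derivative_eq_intros)
    have \<psi>: "test_function \<Omega> (\<lambda>x. (x \<bullet> b) * \<phi> k x) (\<lambda>x. (x \<bullet> b) *\<^sub>R d\<phi> k x + \<phi> k x *\<^sub>R b)"
      by (rule test_function_mult[OF t gd]) (intro continuous_intros)
    have "(LINT x|lebesgue_on \<Omega>. q x *\<^sub>R ((x \<bullet> b) *\<^sub>R d\<phi> k x + \<phi> k x *\<^sub>R b))
      = - (LINT x|lebesgue_on \<Omega>. ((x \<bullet> b) * \<phi> k x) *\<^sub>R ?g x)"
      using has_weak_gradient_grad[OF q] \<psi> unfolding has_weak_gradient_def by blast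
    then have "(LINT x|lebesgue_on \<Omega>. q x *\<^sub>R ((x \<bullet> b) *\<^sub>R d\<phi> k x + \<phi> k x *\<^sub>R b)) \<bullet> b
      = - ((LINT x|lebesgue_on \<Omega>. ((x \<bullet> b) * \<phi> k x) *\<^sub>R ?g x) \<bullet> b)"
      by (simp only: inner_minus_left)
    then have "(LINT x|lebesgue_on \<Omega>. (q x *\<^sub>R ((x \<bullet> b) *\<^sub>R d\<phi> k x + \<phi> k x *\<^sub>R b)) \<bullet> b)
      = - (LINT x|lebesgue_on \<Omega>. (((x \<bullet> b) * \<phi> k x) *\<^sub>R ?g x) \<bullet> b)"
      using integrable_scaleR_test[OF \<psi> qL] integrable_test_scaleR[OF \<psi> gL]
      by (simp only: integral_inner_left)
    moreover have "(LINT x|lebesgue_on \<Omega>. (q x *\<^sub>R ((x \<bullet> b) *\<^sub>R d\<phi> k x + \<phi> k x *\<^sub>R b)) \<bullet> b)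
      = (LINT x|lebesgue_on \<Omega>. ((x \<bullet> b) * q x) \<bullet> (d\<phi> k x \<bullet> b) + q x \<bullet> \<phi> k x)"
      by (simp add: inner_add_left b algebra_simps)
    moreover have "\<dots> = L2_inner \<Omega> (\<lambda>x. (x \<bullet> b) * q x) (\<lambda>x. d\<phi> k x \<bullet> b) + L2_inner \<Omega> q (\<phi> k)"
      unfolding L2_inner_def
      by (rule Bochner_Integration.integral_add[OF in_L2_integrable_inner[OF Xq d\<phi>b] in_L2_integrable_inner[OF qL \<phi>L]])
    moreover have "(LINT x|lebesgue_on \<Omega>. (((x \<bullet> b) * \<phi> k x) *\<^sub>R ?g x) \<bullet> b)
      = L2_inner \<Omega> (\<phi> k) (\<lambda>x. (x \<bullet> b) * (?g x \<bullet> b))"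
      unfolding L2_inner_def by (simp add: algebra_simps)
    ultimately show ?thesis by simp
  qed
  let ?J = "L2_inner \<Omega> q (\<lambda>x. (x \<bullet> b) * (?g x \<bullet> b))"
  have z: "(\<lambda>k::nat. L2_norm \<Omega> (\<lambda>x. F x - F x)) \<longlonglongrightarrow> 0" for F :: "'a \<Rightarrow> real"
    by (simp add: L2_norm_def L2_inner_def)
  have "(\<lambda>k. L2_inner \<Omega> (\<lambda>x. (x \<bullet> b) * q x) (\<lambda>x. d\<phi> k x \<bullet> b) + L2_inner \<Omega> q (\<phi> k))
    \<longlonglongrightarrow> L2_inner \<Omega> (\<lambda>x. (x \<bullet> b) * q x) (\<lambda>x. ?g x \<bullet> b) + L2_inner \<Omega> q q"
    by (intro tendsto_add L2_inner_tendsto[OF Xq d\<phi>b Xq gb z lb] L2_inner_tendsto[OF qL \<phi>L qL qL z l(1)])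
  moreover have "(\<lambda>k. - L2_inner \<Omega> (\<phi> k) (\<lambda>x. (x \<bullet> b) * (?g x \<bullet> b))) \<longlonglongrightarrow> - ?J"
    by (intro tendsto_minus L2_inner_tendsto[OF \<phi>L Xg qL Xg l(1) z])
  ultimately have "L2_inner \<Omega> (\<lambda>x. (x \<bullet> b) * q x) (\<lambda>x. ?g x \<bullet> b) + L2_inner \<Omega> q q = - ?J"
    unfolding eq by (rule LIMSEQ_unique)
  \<comment> \<open>The factor x . b moves from one argument to the other, so both limits are the
    same integral; hence the factor 2.\<close>
  moreover have "L2_inner \<Omega> (\<lambda>x. (x \<bullet> b) * q x) (\<lambda>x. ?g x \<bullet> b) = ?J"
    by (simp add: L2_inner_def algebra_simps)
  ultimately have "(L2_norm \<Omega> q)\<^sup>2 = - 2 * ?J" by (simp add: L2_norm_squared)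
  also have "\<dots> \<le> 2 * (L2_norm \<Omega> q * L2_norm \<Omega> (\<lambda>x. (x \<bullet> b) * (?g x \<bullet> b)))"
    using L2_Cauchy_Schwarz[OF qL Xg] by linarith
  also have "\<dots> \<le> 2 * (L2_norm \<Omega> q * (R * L2_norm \<Omega> (\<lambda>x. ?g x \<bullet> b)))"
  proof (intro mult_left_mono L2_norm_mono[OF Xg gb R(2)])
    fix x assume "x \<in> \<Omega>"
    then show "norm ((x \<bullet> b) * (?g x \<bullet> b)) \<le> R * norm (?g x \<bullet> b)"
      using R(1) by (simp add: abs_mult mult_right_mono)
  qed (simp_all add: L2_norm_nonneg)
  finally have "L2_norm \<Omega> q * L2_norm \<Omega> q \<le> L2_norm \<Omega> q * (2 * R * L2_norm \<Omega> (\<lambda>x. ?g x \<bullet> b))"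
    by (simp add: power2_eq_square algebra_simps)
  then show ?thesis
    using L2_norm_nonneg[of \<Omega> q] R(2) L2_norm_nonneg[of \<Omega> "\<lambda>x. ?g x \<bullet> b"]
    by (cases "L2_norm \<Omega> q = 0") (auto simp: mult_le_cancel_left)
qed

end

section \<open>Barycentric coordinates and the lumped inner product\<close>

text \<open>The differences Q - P are independent, so some linear functional equals -1 on all of
  them; shifted to equal 1 at P, it vanishes at the other vertices.\<close>

lemma barycentric_coordinate_affine:
  fixes C :: "'a::euclidean_space set"
  assumes C: "\<not> affine_dependent C" and P: "P \<in> C"
  shows "\<exists>a b. \<forall>Q\<in>C. a \<bullet> Q + b = (if Q = P then 1 else 0)"
proof -
  have "independent ((\<lambda>x. - P + x) ` (C - {P}))"
    using C affine_dependent_iff_dependent2[OF P] by blast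
  then obtain g :: "'a \<Rightarrow> real" where g: "linear g" "\<forall>x\<in>(\<lambda>x. - P + x) ` (C - {P}). g x = - 1"
    using linear_independent_extend[of _ "\<lambda>_. - 1 :: real"] by blast
  define w where "w = adjoint g 1"
  have adj: "g x = w \<bullet> x" for x
    using adjoint_works[OF g(1), of x 1] by (simp add: w_def inner_commute)
  have "w \<bullet> Q + (1 - w \<bullet> P) = (if Q = P then 1 else 0)" if "Q \<in> C" for Q
  proof (cases "Q = P")
    case False
    with that have "g (- P + Q) = - 1" using g(2) by blast
    then show ?thesis using False unfolding adj by (simp add: inner_add_right inner_diff_right)
  qed simp
  then show ?thesis by blast
qed

lemma affine_combination:
  fixes C :: "'a::euclidean_space set"
  assumes "sum u C = 1"
  shows "a \<bullet> (\<Sum>Q\<in>C. u Q *\<^sub>R Q) + b = (\<Sum>Q\<in>C. u Q * (a \<bullet> Q + b))"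
proof -
  have "(\<Sum>Q\<in>C. u Q * (a \<bullet> Q + b)) = (\<Sum>Q\<in>C. u Q * (a \<bullet> Q)) + sum u C * b"
    by (simp add: distrib_left sum.distrib sum_distrib_right)
  then show ?thesis using assms by (simp add: inner_sum_right)
qed

text \<open>Coordinates enter as affine functions on the whole space, which makes them continuous
  and measurable at once. With two vertices no coordinate is constant, so its zero set is a genuine
  hyperplane.\<close>

locale barycentric_simplex =
  fixes C :: "'a::euclidean_space set" and a :: "'a \<Rightarrow> 'a" and b :: "'a \<Rightarrow> real"
  assumes fin: "finite C" and two: "2 \<le> card C"
    and coord: "\<And>P Q. P \<in> C \<Longrightarrow> Q \<in> C \<Longrightarrow> a P \<bullet> Q + b P = (if Q = P then 1 else 0)"
begin

definition coordinate :: "'a \<Rightarrow> 'a \<Rightarrow> real" where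
  "coordinate P x = a P \<bullet> x + b P"

lemma coordinate_combination:
  assumes "sum u C = 1" "P \<in> C"
  shows "coordinate P (\<Sum>Q\<in>C. u Q *\<^sub>R Q) = u P"
proof -
  have "coordinate P (\<Sum>Q\<in>C. u Q *\<^sub>R Q) = (\<Sum>Q\<in>C. u Q * (a P \<bullet> Q + b P))"
    unfolding coordinate_def by (rule affine_combination[OF assms(1)])
  also have "\<dots> = (\<Sum>Q\<in>C. u Q * (if Q = P then 1 else 0))"
    using coord[OF assms(2)] by (intro sum.cong) auto
  also have "\<dots> = u P" using fin assms(2) by (simp add: if_distrib sum.delta cong: if_cong)
  finally show ?thesis .
qed

lemma coordinates:
  assumes "x \<in> convex hull C"
  shows "\<And>P. P \<in> C \<Longrightarrow> 0 \<le> coordinate P x" "(\<Sum>P\<in>C. coordinate P x) = 1"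
    "(\<Sum>P\<in>C. coordinate P x *\<^sub>R P) = x"
proof -
  obtain u where u: "\<forall>P\<in>C. 0 \<le> u P" "sum u C = 1" "(\<Sum>P\<in>C. u P *\<^sub>R P) = x"
    using assms unfolding convex_hull_finite[OF fin] by blast
  have c: "coordinate P x = u P" if "P \<in> C" for P
    using coordinate_combination[OF u(2) that] unfolding u(3) .
  show "0 \<le> coordinate P x" if "P \<in> C" for P using c[OF that] u(1) that by simp
  have "(\<Sum>P\<in>C. coordinate P x) = sum u C" by (rule sum.cong[OF refl c])
  then show "(\<Sum>P\<in>C. coordinate P x) = 1" using u(2) by simp
  have "(\<Sum>P\<in>C. coordinate P x *\<^sub>R P) = (\<Sum>P\<in>C. u P *\<^sub>R P)"
    by (rule sum.cong[OF refl]) (simp add: c)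
  then show "(\<Sum>P\<in>C. coordinate P x *\<^sub>R P) = x" using u(3) by simp
qed

lemma convex_hullI:
  assumes "\<And>P. P \<in> C \<Longrightarrow> 0 \<le> u P" "sum u C = 1"
  shows "(\<Sum>P\<in>C. u P *\<^sub>R P) \<in> convex hull C"
  unfolding convex_hull_finite[OF fin] using assms by blast

text \<open>The superlevel sets of a barycentric coordinate are homothetic to the whole simplex, so that
  all barycentric coordinates have the same distribution function.\<close>

lemma superlevel_set_eq:
  assumes P: "P \<in> C" and t: "0 \<le> t" "t < 1"
  shows "{x \<in> convex hull C. t < coordinate P x}
    = (\<lambda>x. (1 - t) *\<^sub>R x + t *\<^sub>R P) ` {x \<in> convex hull C. 0 < coordinate P x}"
proof (intro equalityI subsetI)
  fix x assume "x \<in> {x \<in> convex hull C. t < coordinate P x}"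
  then have x: "x \<in> convex hull C" "t < coordinate P x" by auto
  \<comment> \<open>The weights of (x - t P) / (1 - t), the preimage of \<open>x\<close> under the
    homothety with centre \<open>P\<close>.\<close>
  define u where "u Q = (coordinate Q x - (if Q = P then t else 0)) / (1 - t)" for Q
  have u0: "0 \<le> u Q" if "Q \<in> C" for Q
    using coordinates(1)[OF x(1) that] x(2) t by (auto simp: u_def)
  have "sum u C = ((\<Sum>Q\<in>C. coordinate Q x) - (\<Sum>Q\<in>C. if Q = P then t else 0)) / (1 - t)"
    unfolding u_def by (simp only: sum_subtractf sum_divide_distrib[symmetric])
  also have "\<dots> = 1" using P fin t coordinates(2)[OF x(1)] by simp
  finally have u1: "sum u C = 1" .
  define y where "y = (\<Sum>Q\<in>C. u Q *\<^sub>R Q)"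
  have y: "y \<in> convex hull C" unfolding y_def by (rule convex_hullI[OF u0 u1])
  have "coordinate P y = u P" unfolding y_def by (rule coordinate_combination[OF u1 P])
  then have y0: "0 < coordinate P y" using x(2) t by (simp add: u_def)
  have "(1 - t) *\<^sub>R y = (\<Sum>Q\<in>C. (coordinate Q x - (if Q = P then t else 0)) *\<^sub>R Q)"
    unfolding y_def u_def scaleR_sum_right using t by (intro sum.cong) auto
  also have "\<dots> = (\<Sum>Q\<in>C. coordinate Q x *\<^sub>R Q) - (\<Sum>Q\<in>C. (if Q = P then t else 0) *\<^sub>R Q)"
    by (simp add: scaleR_diff_left sum_subtractf)
  also have "(\<Sum>Q\<in>C. (if Q = P then t else 0) *\<^sub>R Q) = (\<Sum>Q\<in>C. if Q = P then t *\<^sub>R P else 0)"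
    by (intro sum.cong) auto
  also have "\<dots> = t *\<^sub>R P" using P fin by simp
  finally have "x = (1 - t) *\<^sub>R y + t *\<^sub>R P" using coordinates(3)[OF x(1)] by simp
  with y y0 show "x \<in> (\<lambda>x. (1 - t) *\<^sub>R x + t *\<^sub>R P) ` {x \<in> convex hull C. 0 < coordinate P x}"
    by blast
next
  fix x assume "x \<in> (\<lambda>x. (1 - t) *\<^sub>R x + t *\<^sub>R P) ` {x \<in> convex hull C. 0 < coordinate P x}"
  then obtain y where y: "y \<in> convex hull C" "0 < coordinate P y" "x = (1 - t) *\<^sub>R y + t *\<^sub>R P"
    by blast
  have PC: "P \<in> convex hull C" using P hull_inc by fast
  have "x \<in> convex hull C"
    unfolding y(3) using convexD[OF convex_convex_hull y(1) PC, of "1 - t" t] t by simp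
  moreover have "coordinate P x = (1 - t) * coordinate P y + t * coordinate P P"
    unfolding y(3) coordinate_def by (simp add: inner_add_right algebra_simps)
  then have "coordinate P x = (1 - t) * coordinate P y + t"
    using coord[OF P P] by (simp add: coordinate_def)
  moreover have "(1 - t) * coordinate P y > 0" using y(2) t by simp
  ultimately show "x \<in> {x \<in> convex hull C. t < coordinate P x}" by simp
qed

section \<open>Distribution and mean of a barycentric coordinate\<close>

lemma compact_hull: "compact (convex hull C)"
  using fin by (simp add: finite_imp_compact_convex_hull)

lemma sets_hull: "convex hull C \<in> sets lebesgue"
  using compact_hull by (simp add: lborelD compact_imp_closed)

lemma continuous_coordinate: "continuous_on S (coordinate P)"
  unfolding coordinate_def by (intro continuous_intros)

text \<open>The removed points lie on a hyperplane. This relates the level 0, the base of the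
  homothety, to the full simplex.\<close>

lemma emeasure_positive:
  assumes P: "P \<in> C"
  shows "emeasure lebesgue {x \<in> convex hull C. 0 < coordinate P x} = emeasure lebesgue (convex hull C)"
proof -
  have "C \<noteq> {P}" using two by auto
  then obtain Q where Q: "Q \<in> C" "Q \<noteq> P" using P by blast
  have "a P \<noteq> 0"
  proof
    assume "a P = 0"
    then show False using coord[OF P P] coord[OF P Q(1)] Q(2) by simp
  qed
  then have "negligible {x. a P \<bullet> x = - b P}" by (intro negligible_hyperplane) simp
  then have N: "{x. a P \<bullet> x = - b P} \<in> null_sets lebesgue" by (simp add: negligible_iff_null_sets)
  have "convex hull C - {x. a P \<bullet> x = - b P} = {x \<in> convex hull C. 0 < coordinate P x}"
    using coordinates(1)[OF _ P] by (fastforce simp: coordinate_def)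
  then show ?thesis using emeasure_Diff_null_set[OF N sets_hull] by simp
qed

text \<open>A homothety of ratio 1 - t scales volume by the d-th power. What matters is that
  \<open>P\<close> has disappeared from the right-hand side.\<close>

lemma emeasure_superlevel:
  assumes P: "P \<in> C"
  shows "emeasure lebesgue {x \<in> convex hull C. t < coordinate P x}
    = (if t < 0 then emeasure lebesgue (convex hull C)
       else if t < 1 then ennreal ((1 - t) ^ DIM('a)) * emeasure lebesgue (convex hull C) else 0)"
proof -
  consider "t < 0" | "0 \<le> t" "t < 1" | "1 \<le> t" by linarith
  then show ?thesis
  proof cases
    case 1
    have "{x \<in> convex hull C. t < coordinate P x} = convex hull C"
      using 1 coordinates(1)[OF _ P] by fastforce
    then show ?thesis using 1 by simp
  next
    case 2
    have "emeasure lebesgue {x \<in> convex hull C. t < coordinate P x}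
      = ennreal (\<bar>1 - t\<bar> ^ DIM('a)) * emeasure lebesgue {x \<in> convex hull C. 0 < coordinate P x}"
      unfolding superlevel_set_eq[OF P 2] by (simp add: emeasure_lebesgue_affine ennreal_power)
    then show ?thesis using 2 emeasure_positive[OF P] by simp
  next
    case 3
    have "coordinate P x \<le> 1" if x: "x \<in> convex hull C" for x
    proof -
      have "coordinate P x \<le> (\<Sum>Q\<in>C. coordinate Q x)"
        using P fin coordinates(1)[OF x] by (intro member_le_sum) auto
      then show ?thesis using coordinates(2)[OF x] by simp
    qed
    then have empty: "{x \<in> convex hull C. t < coordinate P x} = {}" using 3 by fastforce
    show ?thesis unfolding empty using 3 by simp
  qed
qed

lemma measurable_coordinate: "coordinate P \<in> borel_measurable (lebesgue_on (convex hull C))"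
  by (rule continuous_imp_measurable_on_sets_lebesgue[OF continuous_coordinate sets_hull])

text \<open>The upper tails agree at every level, and they determine a finite measure on the
  line.\<close>

lemma distr_coordinate_eq:
  assumes "P \<in> C" "Q \<in> C"
  shows "distr (lebesgue_on (convex hull C)) borel (coordinate P)
    = distr (lebesgue_on (convex hull C)) borel (coordinate Q)"
proof -
  let ?T = "convex hull C"
  have e: "emeasure (distr (lebesgue_on ?T) borel (coordinate R)) {t<..}
    = emeasure lebesgue {x \<in> ?T. t < coordinate R x}" if "R \<in> C" for R t
  proof -
    have "emeasure (distr (lebesgue_on ?T) borel (coordinate R)) {t<..}
      = emeasure (lebesgue_on ?T) (coordinate R -` {t<..} \<inter> space (lebesgue_on ?T))"
      by (rule emeasure_distr[OF measurable_coordinate]) simp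
    also have "coordinate R -` {t<..} \<inter> space (lebesgue_on ?T) = {x \<in> ?T. t < coordinate R x}"
      by auto
    also have "emeasure (lebesgue_on ?T) \<dots> = emeasure lebesgue \<dots>"
      using sets_hull by (intro emeasure_restrict_space) auto
    finally show ?thesis .
  qed
  have lt: "emeasure lebesgue ?T < \<infinity>"
    using fmeasurableD2[OF lmeasurable_compact[OF compact_hull]] by (simp only: infinity_ennreal_def less_top)
  show ?thesis
  proof (rule measure_eqI_lessThan)
    fix t
    have "emeasure lebesgue {x \<in> ?T. t < coordinate P x} \<le> emeasure lebesgue ?T"
      by (intro emeasure_mono sets_hull) auto
    then show "emeasure (distr (lebesgue_on ?T) borel (coordinate P)) {t<..} < \<infinity>"
      unfolding e[OF assms(1)] using lt by (rule le_less_trans)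
    show "emeasure (distr (lebesgue_on ?T) borel (coordinate P)) {t<..}
      = emeasure (distr (lebesgue_on ?T) borel (coordinate Q)) {t<..}"
      unfolding e[OF assms(1)] e[OF assms(2)] emeasure_superlevel[OF assms(1)]
        emeasure_superlevel[OF assms(2)] ..
  qed simp_all
qed

lemma integrable_continuous_hull:
  fixes f :: "'a \<Rightarrow> real"
  assumes "continuous_on UNIV f"
  shows "integrable (lebesgue_on (convex hull C)) f"
proof -
  have b: "bounded (convex hull C)" using compact_hull by (rule compact_imp_bounded)
  show ?thesis by (rule in_L2_imp_integrable[OF sets_hull b in_L2_continuous[OF sets_hull b assms]])
qed

text \<open>Equal distributions have equal means, and the coordinates sum to 1, so each takes an
  equal share of the volume.\<close>

lemma integral_coordinate:
  assumes P: "P \<in> C"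
  shows "(LINT x|lebesgue_on (convex hull C). coordinate P x)
    = measure lebesgue (convex hull C) / card C"
proof -
  let ?M = "lebesgue_on (convex hull C)"
  have eq: "(LINT x|?M. coordinate Q x) = (LINT x|?M. coordinate P x)" if Q: "Q \<in> C" for Q
  proof -
    have d: "(LINT x|?M. coordinate R x) = (LINT y|distr ?M borel (coordinate R). y)" for R
      by (rule integral_distr[OF measurable_coordinate, symmetric]) simp
    show ?thesis unfolding d[of Q] d[of P] distr_coordinate_eq[OF Q P] ..
  qed
  have "card C * (LINT x|?M. coordinate P x) = (\<Sum>Q\<in>C. (LINT x|?M. coordinate Q x))"
    using eq by simp
  also have "\<dots> = (LINT x|?M. (\<Sum>Q\<in>C. coordinate Q x))"
    by (rule Bochner_Integration.integral_sum[symmetric])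
      (rule integrable_continuous_hull[OF continuous_coordinate])
  also have "\<dots> = (LINT x|?M. 1)"
    by (rule Bochner_Integration.integral_cong) (use coordinates(2) in auto)
  also have "\<dots> = measure lebesgue (convex hull C)"
    using sets_hull by (simp add: measure_restrict_space)
  finally show ?thesis using two by (simp add: field_simps)
qed

text \<open>Jensen's inequality: on the simplex an affine function averages its vertex values with
  the coordinates as weights, so its square is below the same average of squares, whose integral is
  the vertex quadrature.\<close>

lemma integral_affine_power2_le:
  assumes A: "linear A" and q: "\<And>x. x \<in> convex hull C \<Longrightarrow> q x = A x + c"
  shows "(LINT x|lebesgue_on (convex hull C). (q x)\<^sup>2)
    \<le> measure lebesgue (convex hull C) / card C * (\<Sum>P\<in>C. (q P)\<^sup>2)"
proof -
  let ?M = "lebesgue_on (convex hull C)"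
  have cA: "continuous_on UNIV (\<lambda>x. (A x + c)\<^sup>2)"
    using A linear_continuous_on[of A] by (intro continuous_intros) (simp add: linear_conv_bounded_linear)
  have ne: "C \<noteq> {}" using two by auto
  have le: "(A x + c)\<^sup>2 \<le> (\<Sum>P\<in>C. coordinate P x * (q P)\<^sup>2)" if x: "x \<in> convex hull C" for x
  proof -
    have qP: "q P = A P + c" if "P \<in> C" for P using that q hull_inc by fast
    have "A x = (\<Sum>P\<in>C. coordinate P x * A P)"
      using linear_sum[OF A, of "\<lambda>P. coordinate P x *\<^sub>R P" C] coordinates(3)[OF x]
      by (simp add: linear_cmul[OF A])
    then have "A x + c = (\<Sum>P\<in>C. coordinate P x * A P) + (\<Sum>P\<in>C. coordinate P x) * c"
      using coordinates(2)[OF x] by simp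
    also have "\<dots> = (\<Sum>P\<in>C. coordinate P x * (A P + c))"
      by (simp add: distrib_left sum.distrib sum_distrib_right)
    also have "\<dots> = (\<Sum>P\<in>C. coordinate P x *\<^sub>R q P)" by (intro sum.cong) (auto simp: qP)
    finally have "(A x + c)\<^sup>2 = (\<Sum>P\<in>C. coordinate P x *\<^sub>R q P)\<^sup>2" by simp
    also have "\<dots> \<le> (\<Sum>P\<in>C. coordinate P x * (q P)\<^sup>2)"
      by (rule convex_on_sum[OF fin ne convex_power2 coordinates(2)[OF x] coordinates(1)[OF x]]) auto
    finally show ?thesis .
  qed
  have "(LINT x|?M. (q x)\<^sup>2) = (LINT x|?M. (A x + c)\<^sup>2)"
    by (rule Bochner_Integration.integral_cong) (simp_all add: q)
  also have "\<dots> \<le> (LINT x|?M. (\<Sum>P\<in>C. coordinate P x * (q P)\<^sup>2))"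
  proof (rule integral_mono)
    show "integrable ?M (\<lambda>x. (A x + c)\<^sup>2)" by (rule integrable_continuous_hull[OF cA])
    show "integrable ?M (\<lambda>x. \<Sum>P\<in>C. coordinate P x * (q P)\<^sup>2)"
      by (intro integrable_continuous_hull continuous_intros continuous_coordinate)
  qed (use le in auto)
  also have "\<dots> = (\<Sum>P\<in>C. (LINT x|?M. coordinate P x * (q P)\<^sup>2))"
    by (rule Bochner_Integration.integral_sum)
      (intro integrable_continuous_hull continuous_intros continuous_coordinate)
  also have "\<dots> = (\<Sum>P\<in>C. measure lebesgue (convex hull C) / card C * (q P)\<^sup>2)"
    by (rule sum.cong) (simp_all add: integral_coordinate)
  finally show ?thesis by (simp add: sum_distrib_left)
qed

end

section \<open>Positivity of the lumping defect\<close>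

lemma simplex_integral_P1_power2_le:
  fixes T :: "'a::euclidean_space set"
  assumes T: "int DIM('a) simplex T" and q: "P1_on T q"
  shows "(LINT x|lebesgue_on T. (q x)\<^sup>2)
    \<le> measure lebesgue T / (real DIM('a) + 1) * (\<Sum>P\<in>vertices T. q P * q P)"
    "integrable (lebesgue_on T) (\<lambda>x. (q x)\<^sup>2)"
proof -
  obtain C where C: "\<not> affine_dependent C" "int (card C) = int DIM('a) + 1" "T = convex hull C"
    using T unfolding simplex_def by blast
  have fin: "finite C" using C(1) by (rule aff_independent_finite)
  have "\<forall>P\<in>C. \<exists>a b. \<forall>Q\<in>C. a \<bullet> Q + b = (if Q = P then 1 else 0)"
    using barycentric_coordinate_affine[OF C(1)] by blast
  then obtain a b where ab: "\<forall>P\<in>C. \<forall>Q\<in>C. a P \<bullet> Q + b P = (if Q = P then 1 else 0)"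
    by metis
  have "DIM('a) > 0" by simp
  then have two: "2 \<le> card C" using C(2) by linarith
  interpret barycentric_simplex C a b
    by unfold_locales (use fin two ab in blast)+
  obtain A c where A: "linear A" "\<forall>x\<in>T. q x = A x + c" using q by (auto simp: P1_on_def)
  \<comment> \<open>For affinely independent points the extreme points of the hull are the points
    themselves, so the quadrature nodes are the points carrying the coordinates.\<close>
  have v: "vertices T = C"
    unfolding vertices_def C(3) using extreme_point_of_convex_hull_affine_independent[OF C(1)] by blast
  have c: "real (card C) = real DIM('a) + 1" using C(2) by linarith
  show "(LINT x|lebesgue_on T. (q x)\<^sup>2)
    \<le> measure lebesgue T / (real DIM('a) + 1) * (\<Sum>P\<in>vertices T. q P * q P)"
    using integral_affine_power2_le[OF A(1), of q c] A(2) unfolding v unfolding c[symmetric] unfolding C(3)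
    by (simp add: power2_eq_square)
  have cA: "continuous_on UNIV (\<lambda>x. (A x + c)\<^sup>2)"
    using A(1) linear_continuous_on[of A] by (intro continuous_intros) (simp add: linear_conv_bounded_linear)
  have "integrable (lebesgue_on T) (\<lambda>x. (A x + c)\<^sup>2)"
    unfolding C(3) by (rule integrable_continuous_hull[OF cA])
  then show "integrable (lebesgue_on T) (\<lambda>x. (q x)\<^sup>2)"
    by (rule Bochner_Integration.integrable_cong[THEN iffD1, rotated -1]) (auto simp: A(2))
qed

text \<open>The cells cover the domain and the integrand is nonnegative, so the integral over the
  domain is at most the sum over cells; overlaps along faces can only enlarge that sum. Each cell is
  then bounded by its vertex quadrature.\<close>

lemma Z_form_nonneg:
  fixes \<Omega> :: "'a::euclidean_space set"
  assumes \<T>: "simplicial_partition \<Omega> \<T>" and \<Omega>: "\<Omega> \<in> sets lebesgue"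
    and L2: "in_L2 \<Omega> q" and q: "\<And>T. T \<in> \<T> \<Longrightarrow> P1_on T q"
  shows "0 \<le> Z_form \<Omega> \<T> q q"
proof -
  have fin: "finite \<T>" and simp: "\<And>T. T \<in> \<T> \<Longrightarrow> int DIM('a) simplex T" and cov: "\<Omega> \<subseteq> \<Union>\<T>"
    using \<T> closure_subset[of \<Omega>] by (auto simp: simplicial_partition_def triangulation_def)
  have sT: "T \<in> sets lebesgue" if "T \<in> \<T>" for T
    using closed_simplex[OF simp[OF that]] by (simp add: lborelD)
  have i\<Omega>: "integrable lebesgue (\<lambda>x. indicator \<Omega> x *\<^sub>R (q x)\<^sup>2)"
    using L2 \<Omega> integrable_restrict_space[of \<Omega> lebesgue "\<lambda>x. (q x)\<^sup>2"] by (simp add: in_L2_def)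
  have iT: "integrable lebesgue (\<lambda>x. indicator T x *\<^sub>R (q x)\<^sup>2)" if "T \<in> \<T>" for T
    using simplex_integral_P1_power2_le(2)[OF simp[OF that] q[OF that]] sT[OF that]
      integrable_restrict_space[of T lebesgue "\<lambda>x. (q x)\<^sup>2"] by simp
  have "L2_inner \<Omega> q q = (LINT x|lebesgue. indicator \<Omega> x *\<^sub>R (q x)\<^sup>2)"
    unfolding L2_inner_def using \<Omega> integral_restrict_space[of \<Omega> lebesgue "\<lambda>x. (q x)\<^sup>2"]
    by (simp add: power2_eq_square)
  also have "\<dots> \<le> (LINT x|lebesgue. (\<Sum>T\<in>\<T>. indicator T x *\<^sub>R (q x)\<^sup>2))"
  proof (rule integral_mono[OF i\<Omega>])
    show "integrable lebesgue (\<lambda>x. \<Sum>T\<in>\<T>. indicator T x *\<^sub>R (q x)\<^sup>2)" using iT by simp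
    fix x
    show "indicator \<Omega> x *\<^sub>R (q x)\<^sup>2 \<le> (\<Sum>T\<in>\<T>. indicator T x *\<^sub>R (q x)\<^sup>2)"
    proof (cases "x \<in> \<Omega>")
      case True
      then obtain T where T: "T \<in> \<T>" "x \<in> T" using cov by blast
      have "indicator T x *\<^sub>R (q x)\<^sup>2 \<le> (\<Sum>T\<in>\<T>. indicator T x *\<^sub>R (q x)\<^sup>2)"
        using fin T by (intro member_le_sum) auto
      then show ?thesis using True T by simp
    qed (simp add: sum_nonneg)
  qed
  also have "\<dots> = (\<Sum>T\<in>\<T>. (LINT x|lebesgue. indicator T x *\<^sub>R (q x)\<^sup>2))"
    by (rule Bochner_Integration.integral_sum[OF iT])
  also have "\<dots> = (\<Sum>T\<in>\<T>. (LINT x|lebesgue_on T. (q x)\<^sup>2))"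
    using integral_restrict_space[of _ lebesgue "\<lambda>x. (q x)\<^sup>2"] sT by (intro sum.cong) auto
  also have "\<dots> \<le> lumped \<T> q q"
    unfolding lumped_def by (intro sum_mono simplex_integral_P1_power2_le(1) simp q)
  finally show ?thesis by (simp add: Z_form_def)
qed

section \<open>The forms of the scheme\<close>

lemma P1_on_lin:
  assumes "P1_on T f" "P1_on T g"
  shows "P1_on T (\<lambda>x. c *\<^sub>R f x + g x)"
proof -
  obtain A b where A: "linear A" "\<forall>x\<in>T. f x = A x + b" using assms(1) by (auto simp: P1_on_def)
  obtain B d where B: "linear B" "\<forall>x\<in>T. g x = B x + d" using assms(2) by (auto simp: P1_on_def)
  have "linear (\<lambda>x. c *\<^sub>R A x + B x)"
    by (intro linear_compose_add linear_compose_scale_right A B)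
  moreover have "\<forall>x\<in>T. c *\<^sub>R f x + g x = (c *\<^sub>R A x + B x) + (c *\<^sub>R b + d)"
    using A B by (simp add: scaleR_add_right)
  ultimately show ?thesis unfolding P1_on_def by blast
qed

text \<open>The trace sees only the diagonal of the symmetric part; Cauchy-Schwarz over its d
  entries gives the factor d, the source of 2 mu/d in the parameter condition.\<close>

lemma trace_power2_le:
  fixes J :: "real^'d^'d"
  defines "S \<equiv> (1/2) *\<^sub>R (J + transpose J)"
  shows "(trace J)\<^sup>2 \<le> real CARD('d) * (S \<bullet> S)"
proof -
  have "trace J = (\<Sum>i\<in>UNIV. S $ i $ i)" by (simp add: trace_def S_def transpose_def)
  then have "(trace J)\<^sup>2 \<le> (\<Sum>i\<in>UNIV. (S $ i $ i)\<^sup>2) * real CARD('d)"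
    using sum_squared_le_sum_of_squares[of "\<lambda>i. S $ i $ i" UNIV] by simp
  also have "(\<Sum>i\<in>UNIV. (S $ i $ i)\<^sup>2) \<le> (\<Sum>i\<in>UNIV. S $ i \<bullet> S $ i)"
  proof (rule sum_mono)
    fix i
    have "(S $ i $ i)\<^sup>2 \<le> (norm (S $ i))\<^sup>2"
      using power_mono[OF component_le_norm_cart[of "S $ i" i], of 2] by simp
    then show "(S $ i $ i)\<^sup>2 \<le> S $ i \<bullet> S $ i" by (simp add: power2_norm_eq_inner)
  qed
  also have "\<dots> = S \<bullet> S" by (simp add: inner_vec_def)
  finally show ?thesis by (simp add: mult.commute)
qed

lemma linear_matrix_trace: "linear (trace :: real^'d^'d \<Rightarrow> real)"
  by (rule linearI) (simp_all add: trace_def sum.distrib sum_distrib_left)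

lemma linear_symmetric_part: "linear (\<lambda>J :: real^'d^'d. (1/2) *\<^sub>R (J + transpose J))"
  by (rule linearI) (simp_all add: transpose_def vec_eq_iff algebra_simps)

section \<open>Vector fields, strain and divergence\<close>

locale bounded_open_vec = bounded_open_set \<Omega> for \<Omega> :: "(real^'d) set"
begin

lemma H1_0_vec_lin:
  assumes "v \<in> H1_0_vec \<Omega>" "w \<in> H1_0_vec \<Omega>"
  shows "(\<lambda>x. c *\<^sub>R v x + w x) \<in> H1_0_vec \<Omega>"
  using assms by (auto simp: H1_0_vec_def intro!: H1_0_lin)

text \<open>Embedding the rows by \<open>axis i\<close> writes the matrix field as a finite sum of
  bounded linear images of component gradients.\<close>

lemma in_L2_jacobian:
  assumes v: "v \<in> H1_0_vec \<Omega>"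
  shows "in_L2 \<Omega> (jacobian \<Omega> v)"
proof -
  have vi: "(\<lambda>y. v y $ i) \<in> H1_0 \<Omega>" for i using v by (simp add: H1_0_vec_def)
  have "linear (\<lambda>y :: real^'d. axis i y :: real^'d^'d)" for i :: 'd
    by (rule linearI) (auto simp: axis_def vec_eq_iff)
  then have bl: "bounded_linear (\<lambda>y :: real^'d. axis i y :: real^'d^'d)" for i :: 'd
    unfolding linear_conv_bounded_linear .
  have "in_L2 \<Omega> (\<lambda>x. \<Sum>i\<in>UNIV. axis i (grad \<Omega> (\<lambda>y. v y $ i) x) :: real^'d^'d)"
    by (rule in_L2_sum[OF finite_class.finite_UNIV in_L2_bounded_linear[OF bl in_L2_grad[OF vi]]])
  moreover have "jacobian \<Omega> v = (\<lambda>x. \<Sum>i\<in>UNIV. axis i (grad \<Omega> (\<lambda>y. v y $ i) x))"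
  proof (rule ext)
    fix x
    have "(\<Sum>i\<in>UNIV. axis i (grad \<Omega> (\<lambda>y. v y $ i) x) :: real^'d^'d) $ j = jacobian \<Omega> v x $ j" for j
      by (simp add: jacobian_def axis_def if_distrib cong: if_cong)
    then show "jacobian \<Omega> v x = (\<Sum>i\<in>UNIV. axis i (grad \<Omega> (\<lambda>y. v y $ i) x))"
      by (simp add: vec_eq_iff)
  qed
  ultimately show ?thesis by simp
qed

lemma jacobian_lin:
  assumes "v \<in> H1_0_vec \<Omega>" "w \<in> H1_0_vec \<Omega>"
  shows "AE x in lebesgue_on \<Omega>.
    jacobian \<Omega> (\<lambda>x. c *\<^sub>R v x + w x) x = c *\<^sub>R jacobian \<Omega> v x + jacobian \<Omega> w x"
proof -
  have "AE x in lebesgue_on \<Omega>. \<forall>i. grad \<Omega> (\<lambda>x. c * v x $ i + w x $ i) x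
      = c *\<^sub>R grad \<Omega> (\<lambda>x. v x $ i) x + grad \<Omega> (\<lambda>x. w x $ i) x"
    using assms by (intro eventually_all_finite grad_lin) (auto simp: H1_0_vec_def)
  then show ?thesis
  proof eventually_elim
    case (elim x)
    have "jacobian \<Omega> (\<lambda>x. c *\<^sub>R v x + w x) x $ i = (c *\<^sub>R jacobian \<Omega> v x + jacobian \<Omega> w x) $ i" for i
      using elim by (simp add: jacobian_def)
    then show ?case by (rule iffD2[OF vec_eq_iff, OF allI])
  qed
qed

text \<open>Divergence and strain are treated together, \<open>T\<close> being the trace or the
  symmetric part; linearity that holds almost everywhere becomes exact after integration.\<close>

lemma L2_inner_jacobian_lin:
  assumes T: "linear T" and v: "v \<in> H1_0_vec \<Omega>" "w \<in> H1_0_vec \<Omega>" and g: "in_L2 \<Omega> g"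
  shows "in_L2 \<Omega> (\<lambda>x. T (jacobian \<Omega> v x))"
    "L2_inner \<Omega> (\<lambda>x. T (jacobian \<Omega> (\<lambda>x. c *\<^sub>R v x + w x) x)) g
      = c * L2_inner \<Omega> (\<lambda>x. T (jacobian \<Omega> v x)) g + L2_inner \<Omega> (\<lambda>x. T (jacobian \<Omega> w x)) g"
proof -
  have L: "in_L2 \<Omega> (\<lambda>x. T (jacobian \<Omega> z x))" if "z \<in> H1_0_vec \<Omega>" for z
    using T in_L2_bounded_linear in_L2_jacobian[OF that] by (simp add: linear_conv_bounded_linear)
  then show "in_L2 \<Omega> (\<lambda>x. T (jacobian \<Omega> v x))" using v by blast
  have "AE x in lebesgue_on \<Omega>. T (jacobian \<Omega> (\<lambda>x. c *\<^sub>R v x + w x) x)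
      = c *\<^sub>R T (jacobian \<Omega> v x) + T (jacobian \<Omega> w x)"
    using jacobian_lin[OF v, of c] by eventually_elim (simp add: linear_add[OF T] linear_cmul[OF T])
  then have "L2_inner \<Omega> (\<lambda>x. T (jacobian \<Omega> (\<lambda>x. c *\<^sub>R v x + w x) x)) g
      = L2_inner \<Omega> (\<lambda>x. c *\<^sub>R T (jacobian \<Omega> v x) + T (jacobian \<Omega> w x)) g"
    by (rule L2_inner_cong_AE[OF _ L[OF H1_0_vec_lin[OF v]] in_L2_add[OF in_L2_scaleR[OF L[OF v(1)]] L[OF v(2)]] g])
  then show "L2_inner \<Omega> (\<lambda>x. T (jacobian \<Omega> (\<lambda>x. c *\<^sub>R v x + w x) x)) g
      = c * L2_inner \<Omega> (\<lambda>x. T (jacobian \<Omega> v x)) g + L2_inner \<Omega> (\<lambda>x. T (jacobian \<Omega> w x)) g"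
    by (simp only: L2_inner_lin[OF L[OF v(1)] L[OF v(2)] g])
qed

lemma divergence_eq: "divergence \<Omega> v = (\<lambda>x. trace (jacobian \<Omega> v x))"
  by (simp add: divergence_def fun_eq_iff)

lemma strain_eq: "strain \<Omega> v = (\<lambda>x. (1/2) *\<^sub>R (jacobian \<Omega> v x + transpose (jacobian \<Omega> v x)))"
  by (simp add: strain_def fun_eq_iff)

lemma in_L2_divergence:
  assumes "v \<in> H1_0_vec \<Omega>"
  shows "in_L2 \<Omega> (divergence \<Omega> v)"
  unfolding divergence_eq
  by (rule in_L2_bounded_linear[OF linear_matrix_trace[unfolded linear_conv_bounded_linear] in_L2_jacobian[OF assms]])

lemma in_L2_strain:
  assumes "v \<in> H1_0_vec \<Omega>"
  shows "in_L2 \<Omega> (strain \<Omega> v)"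
  unfolding strain_eq
  by (rule in_L2_bounded_linear[OF linear_symmetric_part[unfolded linear_conv_bounded_linear] in_L2_jacobian[OF assms]])

lemma L2_inner_divergence_lin:
  assumes v: "v \<in> H1_0_vec \<Omega>" "w \<in> H1_0_vec \<Omega>" and g: "in_L2 \<Omega> g"
  shows "L2_inner \<Omega> (divergence \<Omega> (\<lambda>x. c *\<^sub>R v x + w x)) g
    = c * L2_inner \<Omega> (divergence \<Omega> v) g + L2_inner \<Omega> (divergence \<Omega> w) g"
  unfolding divergence_eq by (rule L2_inner_jacobian_lin(2)[OF linear_matrix_trace v g])

lemma L2_inner_strain_lin:
  assumes v: "v \<in> H1_0_vec \<Omega>" "w \<in> H1_0_vec \<Omega>" and g: "in_L2 \<Omega> g"
  shows "L2_inner \<Omega> (strain \<Omega> (\<lambda>x. c *\<^sub>R v x + w x)) g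
    = c * L2_inner \<Omega> (strain \<Omega> v) g + L2_inner \<Omega> (strain \<Omega> w) g"
  unfolding strain_eq by (rule L2_inner_jacobian_lin(2)[OF linear_symmetric_part v g])

lemma H1_0_vec_diff:
  assumes "v \<in> H1_0_vec \<Omega>" "w \<in> H1_0_vec \<Omega>"
  shows "(\<lambda>x. v x - w x) \<in> H1_0_vec \<Omega>"
  using H1_0_vec_lin[OF assms(2,1), of "-1"] by simp

lemma L2_inner_divergence_diff:
  assumes "v \<in> H1_0_vec \<Omega>" "w \<in> H1_0_vec \<Omega>" "in_L2 \<Omega> g"
  shows "L2_inner \<Omega> (divergence \<Omega> (\<lambda>x. v x - w x)) g
    = L2_inner \<Omega> (divergence \<Omega> v) g - L2_inner \<Omega> (divergence \<Omega> w) g"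
  using L2_inner_divergence_lin[OF assms(2,1,3), of "-1"] by simp

lemma L2_inner_divergence_quotient:
  assumes "v \<in> H1_0_vec \<Omega>" "w \<in> H1_0_vec \<Omega>" "in_L2 \<Omega> g"
  shows "L2_inner \<Omega> (divergence \<Omega> (\<lambda>x. (v x - w x) /\<^sub>R \<tau>)) g
    = (L2_inner \<Omega> (divergence \<Omega> v) g - L2_inner \<Omega> (divergence \<Omega> w) g) / \<tau>"
proof -
  note d = H1_0_vec_diff[OF assms(1,2)]
  \<comment> \<open>Linearity is available in the form c v + w, so division by tau is written with
    the same field in both places.\<close>
  have eq: "(\<lambda>x. (v x - w x) /\<^sub>R \<tau>) = (\<lambda>x. (inverse \<tau> - 1) *\<^sub>R (v x - w x) + (v x - w x))"
    by (simp add: scaleR_diff_left)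
  show ?thesis
    unfolding eq L2_inner_divergence_lin[OF d d assms(3)] L2_inner_divergence_diff[OF assms]
    by (simp add: algebra_simps divide_inverse)
qed

section \<open>The elastic energy form\<close>

lemma a_form_lin:
  assumes "v \<in> H1_0_vec \<Omega>" "w \<in> H1_0_vec \<Omega>" "z \<in> H1_0_vec \<Omega>"
  shows "a_form \<Omega> P (\<lambda>x. c *\<^sub>R v x + w x) z = c * a_form \<Omega> P v z + a_form \<Omega> P w z"
  unfolding a_form_def L2_inner_divergence_lin[OF assms(1,2) in_L2_divergence[OF assms(3)]]
    L2_inner_strain_lin[OF assms(1,2) in_L2_strain[OF assms(3)]]
  by (simp add: algebra_simps)

lemma a_form_commute: "a_form \<Omega> P v w = a_form \<Omega> P w v"
  by (simp add: a_form_def L2_inner_commute[of \<Omega> "strain \<Omega> v"] L2_inner_commute[of \<Omega> "divergence \<Omega> v"])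

lemma a_form_lin_right:
  assumes "v \<in> H1_0_vec \<Omega>" "w \<in> H1_0_vec \<Omega>" "z \<in> H1_0_vec \<Omega>"
  shows "a_form \<Omega> P z (\<lambda>x. c *\<^sub>R v x + w x) = c * a_form \<Omega> P z v + a_form \<Omega> P z w"
  using a_form_lin[OF assms] by (simp only: a_form_commute[of P z])

lemma a_form_diff:
  assumes "v \<in> H1_0_vec \<Omega>" "w \<in> H1_0_vec \<Omega>" "z \<in> H1_0_vec \<Omega>"
  shows "a_form \<Omega> P (\<lambda>x. v x - w x) z = a_form \<Omega> P v z - a_form \<Omega> P w z"
  using a_form_lin[OF assms(2,1,3), of _ "-1"] by simp

lemma a_form_nonneg:
  assumes "admissible_params P"
  shows "0 \<le> a_form \<Omega> P v v"
  using assms by (simp add: a_form_def admissible_params_def L2_inner_self_nonneg)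

lemma a_form_Cauchy_Schwarz:
  assumes P: "admissible_params P" and v: "v \<in> H1_0_vec \<Omega>" "w \<in> H1_0_vec \<Omega>"
  shows "\<bar>a_form \<Omega> P v w\<bar> \<le> A_norm \<Omega> P v * A_norm \<Omega> P w"
  unfolding A_norm_def
proof (rule quadratic_nonneg_imp)
  fix t
  have l: "(\<lambda>x. t *\<^sub>R w x + v x) \<in> H1_0_vec \<Omega>" by (rule H1_0_vec_lin[OF v(2,1)])
  have "a_form \<Omega> P (\<lambda>x. t *\<^sub>R w x + v x) (\<lambda>x. t *\<^sub>R w x + v x)
    = a_form \<Omega> P v v + 2 * t * a_form \<Omega> P v w + t\<^sup>2 * a_form \<Omega> P w w"
    unfolding a_form_lin[OF v(2,1) l] a_form_lin_right[OF v(2,1) v(1)] a_form_lin_right[OF v(2,1) v(2)]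
      a_form_commute[of P w v]
    by (simp add: algebra_simps power2_eq_square)
  then show "0 \<le> a_form \<Omega> P v v + 2 * t * a_form \<Omega> P v w + t\<^sup>2 * a_form \<Omega> P w w"
    using a_form_nonneg[OF P, of "\<lambda>x. t *\<^sub>R w x + v x"] by simp
qed

text \<open>Trading 2 mu |eps(v)|^2 for (2 mu/d) |div v|^2 explains why lambda + 2 mu/d is the
  natural modulus of the method.\<close>

lemma divergence_le_a_form:
  assumes P: "admissible_params P" and v: "v \<in> H1_0_vec \<Omega>"
  shows "(lame_lambda P + 2 * lame_mu P / real CARD('d)) * L2_inner \<Omega> (divergence \<Omega> v) (divergence \<Omega> v)
    \<le> a_form \<Omega> P v v"
proof -
  have "L2_inner \<Omega> (divergence \<Omega> v) (divergence \<Omega> v)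
    \<le> (LINT x|lebesgue_on \<Omega>. real CARD('d) * (strain \<Omega> v x \<bullet> strain \<Omega> v x))"
    unfolding L2_inner_def
  proof (rule integral_mono)
    show "integrable (lebesgue_on \<Omega>) (\<lambda>x. divergence \<Omega> v x \<bullet> divergence \<Omega> v x)"
      "integrable (lebesgue_on \<Omega>) (\<lambda>x. real CARD('d) * (strain \<Omega> v x \<bullet> strain \<Omega> v x))"
      using in_L2_integrable_inner[OF in_L2_divergence[OF v] in_L2_divergence[OF v]]
        in_L2_integrable_inner[OF in_L2_strain[OF v] in_L2_strain[OF v]] by auto
    fix x
    show "divergence \<Omega> v x \<bullet> divergence \<Omega> v x \<le> real CARD('d) * (strain \<Omega> v x \<bullet> strain \<Omega> v x)"
      using trace_power2_le[of "jacobian \<Omega> v x"]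
      by (simp add: divergence_def strain_def power2_eq_square)
  qed
  also have "\<dots> = real CARD('d) * L2_inner \<Omega> (strain \<Omega> v) (strain \<Omega> v)"
    by (simp add: L2_inner_def)
  finally have "L2_inner \<Omega> (divergence \<Omega> v) (divergence \<Omega> v) / real CARD('d) \<le> L2_inner \<Omega> (strain \<Omega> v) (strain \<Omega> v)"
    by (simp add: field_simps)
  then have "2 * lame_mu P * (L2_inner \<Omega> (divergence \<Omega> v) (divergence \<Omega> v) / real CARD('d))
    \<le> 2 * lame_mu P * L2_inner \<Omega> (strain \<Omega> v) (strain \<Omega> v)"
    using P by (intro mult_left_mono) (auto simp: admissible_params_def)
  then show ?thesis by (simp add: a_form_def distrib_right)
qed

text \<open>Each component is controlled by its derivative in its own direction, a diagonal entry of the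
  strain; so Poincare's inequality replaces Korn's.\<close>

lemma L2_norm_le_A_norm:
  assumes P: "admissible_params P"
  shows "\<exists>C. \<forall>v\<in>H1_0_vec \<Omega>. L2_norm \<Omega> v \<le> C * A_norm \<Omega> P v"
proof -
  obtain R where R: "0 < R" "\<forall>x\<in>\<Omega>. norm x \<le> R" using bounded_domain bounded_pos by blast
  \<comment> \<open>Each of the d components brings the square of its Poincare constant 2 R, and the
    energy contains the strain with weight 2 mu.\<close>
  define C where "C = sqrt (CARD('d) * (2 * R)\<^sup>2 / (2 * lame_mu P))"
  have "L2_norm \<Omega> v \<le> C * A_norm \<Omega> P v" if v: "v \<in> H1_0_vec \<Omega>" for v
  proof -
    have vi: "(\<lambda>x. v x $ i) \<in> H1_0 \<Omega>" for i using v by (simp add: H1_0_vec_def)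
    have comp: "L2_inner \<Omega> (\<lambda>x. v x $ i) (\<lambda>x. v x $ i) \<le> (2 * R)\<^sup>2 * L2_inner \<Omega> (strain \<Omega> v) (strain \<Omega> v)" for i
    proof -
      have Rx: "\<bar>x \<bullet> axis i 1\<bar> \<le> R" if "x \<in> \<Omega>" for x
        using R(2) that Cauchy_Schwarz_ineq2[of x "axis i 1"] by (fastforce simp: norm_axis_1)
      have "L2_norm \<Omega> (\<lambda>x. v x $ i) \<le> 2 * R * L2_norm \<Omega> (\<lambda>x. grad \<Omega> (\<lambda>x. v x $ i) x \<bullet> axis i 1)"
        using R(1) by (intro directional_Poincare[OF vi]) (auto simp: Rx inner_axis_axis)
      also have "L2_norm \<Omega> (\<lambda>x. grad \<Omega> (\<lambda>x. v x $ i) x \<bullet> axis i 1) \<le> 1 * L2_norm \<Omega> (strain \<Omega> v)"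
      proof (rule L2_norm_mono[OF _ in_L2_strain[OF v]])
        show "in_L2 \<Omega> (\<lambda>x. grad \<Omega> (\<lambda>x. v x $ i) x \<bullet> axis i 1)"
          by (rule in_L2_bounded_linear[OF bounded_linear_inner_left in_L2_grad[OF vi]])
        fix x
        have "grad \<Omega> (\<lambda>x. v x $ i) x \<bullet> axis i 1 = strain \<Omega> v x $ i $ i"
          by (simp add: strain_def jacobian_def transpose_def inner_axis)
        also have "\<bar>\<dots>\<bar> \<le> norm (strain \<Omega> v x $ i)" by (rule component_le_norm_cart)
        also have "\<dots> \<le> norm (strain \<Omega> v x)" by (rule Finite_Cartesian_Product.norm_nth_le)
        finally show "norm (grad \<Omega> (\<lambda>x. v x $ i) x \<bullet> axis i 1) \<le> 1 * norm (strain \<Omega> v x)" by simp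
      qed simp
      finally have "L2_norm \<Omega> (\<lambda>x. v x $ i) \<le> 2 * R * L2_norm \<Omega> (strain \<Omega> v)" using R(1) by simp
      then have "(L2_norm \<Omega> (\<lambda>x. v x $ i))\<^sup>2 \<le> (2 * R * L2_norm \<Omega> (strain \<Omega> v))\<^sup>2"
        by (intro power_mono L2_norm_nonneg)
      then show ?thesis by (simp only: power_mult_distrib L2_norm_squared)
    qed
    have "L2_inner \<Omega> v v = (\<Sum>i\<in>UNIV. L2_inner \<Omega> (\<lambda>x. v x $ i) (\<lambda>x. v x $ i))"
      unfolding L2_inner_def inner_vec_def
      by (rule Bochner_Integration.integral_sum) (rule in_L2_integrable_inner[OF in_L2_H1_0[OF vi] in_L2_H1_0[OF vi]])
    also have "\<dots> \<le> (\<Sum>i\<in>(UNIV::'d set). (2 * R)\<^sup>2 * L2_inner \<Omega> (strain \<Omega> v) (strain \<Omega> v))"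
      by (rule sum_mono[OF comp])
    also have "\<dots> = CARD('d) * (2 * R)\<^sup>2 / (2 * lame_mu P) * (2 * lame_mu P * L2_inner \<Omega> (strain \<Omega> v) (strain \<Omega> v))"
      using P by (simp add: admissible_params_def)
    also have "\<dots> \<le> CARD('d) * (2 * R)\<^sup>2 / (2 * lame_mu P) * a_form \<Omega> P v v"
      using P by (intro mult_left_mono) (auto simp: admissible_params_def a_form_def L2_inner_self_nonneg)
    finally have "L2_norm \<Omega> v \<le> sqrt (CARD('d) * (2 * R)\<^sup>2 / (2 * lame_mu P) * a_form \<Omega> P v v)"
      unfolding L2_norm_def by (simp only: real_sqrt_le_iff)
    then show ?thesis by (simp only: C_def A_norm_def real_sqrt_mult)
  qed
  then show ?thesis by blast
qed

section \<open>The Darcy form and the mesh-weighted gradient\<close>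

lemma ap_form_eq: "ap_form \<Omega> P p q = conductivity P * L2_inner \<Omega> (grad \<Omega> p) (grad \<Omega> q)"
  by (simp add: ap_form_def L2_inner_def)

lemma ap_form_diff:
  assumes p: "p \<in> H1_0 \<Omega>" "p' \<in> H1_0 \<Omega>" and q: "q \<in> H1_0 \<Omega>"
  shows "ap_form \<Omega> P (\<lambda>x. p x - p' x) q = ap_form \<Omega> P p q - ap_form \<Omega> P p' q"
proof -
  have d: "(\<lambda>x. p x - p' x) \<in> H1_0 \<Omega>" using H1_0_lin[OF p(2,1), of "-1"] by simp
  have "L2_inner \<Omega> (grad \<Omega> (\<lambda>x. p x - p' x)) (grad \<Omega> q) = L2_inner \<Omega> (\<lambda>x. grad \<Omega> p x - grad \<Omega> p' x) (grad \<Omega> q)"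
  proof (rule L2_inner_cong_AE)
    show "AE x in lebesgue_on \<Omega>. grad \<Omega> (\<lambda>x. p x - p' x) x = grad \<Omega> p x - grad \<Omega> p' x"
      using grad_lin[OF p(2,1), of "-1"] by simp
  qed (use d p q in \<open>auto intro: in_L2_grad in_L2_diff\<close>)
  also have "\<dots> = L2_inner \<Omega> (grad \<Omega> p) (grad \<Omega> q) - L2_inner \<Omega> (grad \<Omega> p') (grad \<Omega> q)"
    using p q by (intro L2_inner_diff_left in_L2_grad)
  finally show ?thesis by (simp add: ap_form_eq right_diff_distrib)
qed

text \<open>Replacing each local integral by the global one is crude, but the mesh is fixed during
  the iteration, so any finite factor lets the decay of a_p force that of the weighted
  gradient.\<close>

lemma h_grad_norm_le:
  assumes \<T>: "simplicial_partition \<Omega> \<T>" and q: "q \<in> H1_0 \<Omega>"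
  shows "(h_grad_norm \<Omega> \<T> q)\<^sup>2 \<le> (\<Sum>T\<in>\<T>. (diameter T)\<^sup>2) * L2_inner \<Omega> (grad \<Omega> q) (grad \<Omega> q)"
proof -
  let ?f = "\<lambda>x. (norm (grad \<Omega> q x))\<^sup>2"
  have le: "(LINT x|lebesgue_on T. ?f x) \<le> L2_inner \<Omega> (grad \<Omega> q) (grad \<Omega> q)" if T: "T \<in> \<T>" for T
  proof -
    have s: "int DIM(real^'d) simplex T" "interior T \<subseteq> \<Omega>"
      using \<T> T by (auto simp: simplicial_partition_def)
    have sT: "T \<in> sets lebesgue" using closed_simplex[OF s(1)] by (simp add: lborelD)
    have eqT: "(LINT x|lebesgue_on T. ?f x) = (LINT x|lebesgue. indicator T x *\<^sub>R ?f x)"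
      using sT by (intro integral_restrict_space) simp
    have eq: "L2_inner \<Omega> (grad \<Omega> q) (grad \<Omega> q) = (LINT x|lebesgue. indicator \<Omega> x *\<^sub>R ?f x)"
      unfolding L2_inner_def power2_norm_eq_inner using sets_domain by (intro integral_restrict_space) simp
    have i\<Omega>: "integrable lebesgue (\<lambda>x. indicator \<Omega> x *\<^sub>R ?f x)"
      using in_L2_grad[OF q] sets_domain integrable_restrict_space[of \<Omega> lebesgue ?f] by (simp add: in_L2_def)
    show ?thesis
    proof (cases "integrable lebesgue (\<lambda>x. indicator T x *\<^sub>R ?f x)")
      case True
      \<comment> \<open>Only boundary points of a cell can lie outside the domain, and they form a
        null set.\<close>
      have "negligible (frontier T)" by (rule negligible_convex_frontier[OF convex_simplex[OF s(1)]])
      then have "AE x in lebesgue. x \<notin> frontier T"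
        by (intro AE_not_in) (simp add: negligible_iff_null_sets)
      then have "AE x in lebesgue. indicator T x *\<^sub>R ?f x \<le> indicator \<Omega> x *\<^sub>R ?f x"
      proof eventually_elim
        case (elim x)
        then have "x \<in> T \<Longrightarrow> x \<in> \<Omega>"
          using s(2) closed_simplex[OF s(1)] by (auto simp: frontier_def)
        then show ?case by (cases "x \<in> T") auto
      qed
      then show ?thesis unfolding eqT eq by (rule integral_mono_AE[OF True i\<Omega>])
    next
      case False
      \<comment> \<open>A non-integrable integrand has integral 0 by convention.\<close>
      then show ?thesis unfolding eqT by (simp add: not_integrable_integral_eq L2_inner_self_nonneg)
    qed
  qed
  have "0 \<le> (\<Sum>T\<in>\<T>. (diameter T)\<^sup>2 * (LINT x|lebesgue_on T. ?f x))"
    by (intro sum_nonneg mult_nonneg_nonneg Bochner_Integration.integral_nonneg) auto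
  then have "(h_grad_norm \<Omega> \<T> q)\<^sup>2 = (\<Sum>T\<in>\<T>. (diameter T)\<^sup>2 * (LINT x|lebesgue_on T. ?f x))"
    by (simp add: h_grad_norm_def)
  also have "\<dots> \<le> (\<Sum>T\<in>\<T>. (diameter T)\<^sup>2 * L2_inner \<Omega> (grad \<Omega> q) (grad \<Omega> q))"
    by (intro sum_mono mult_left_mono le) auto
  finally show ?thesis by (simp add: sum_distrib_right)
qed

lemma h_grad_norm_nonneg: "0 \<le> h_grad_norm \<Omega> \<T> q"
  unfolding h_grad_norm_def
  by (intro real_sqrt_ge_zero sum_nonneg mult_nonneg_nonneg Bochner_Integration.integral_nonneg) auto

section \<open>Linear structure of the discrete spaces\<close>

lemma V_lin_lin:
  assumes "v \<in> V_lin \<Omega> \<T>" "w \<in> V_lin \<Omega> \<T>"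
  shows "(\<lambda>x. c *\<^sub>R v x + w x) \<in> V_lin \<Omega> \<T>"
  using assms by (auto simp: V_lin_def intro!: H1_0_vec_lin P1_on_lin continuous_intros)

lemma V_bub_lin:
  assumes "v \<in> V_bub \<Omega> \<T>" "w \<in> V_bub \<Omega> \<T>"
  shows "(\<lambda>x. c *\<^sub>R v x + w x) \<in> V_bub \<Omega> \<T>"
proof -
  have "\<exists>a. \<forall>x\<in>T. c *\<^sub>R v x + w x = bubble T x *\<^sub>R a" if "T \<in> \<T>" for T
  proof -
    obtain a b where "\<forall>x\<in>T. v x = bubble T x *\<^sub>R a" "\<forall>x\<in>T. w x = bubble T x *\<^sub>R b"
      using assms \<open>T \<in> \<T>\<close> unfolding V_bub_def by blast
    then have "\<forall>x\<in>T. c *\<^sub>R v x + w x = bubble T x *\<^sub>R (c *\<^sub>R a + b)"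
      by (simp add: scaleR_add_right mult.commute)
    then show ?thesis by blast
  qed
  then show ?thesis using assms by (simp add: V_bub_def H1_0_vec_lin)
qed

lemma V_mini_lin:
  assumes "v \<in> V_mini \<Omega> \<T>" "w \<in> V_mini \<Omega> \<T>"
  shows "(\<lambda>x. c *\<^sub>R v x + w x) \<in> V_mini \<Omega> \<T>"
proof -
  obtain v1 v2 where v: "v = (\<lambda>x. v1 x + v2 x)" "v1 \<in> V_lin \<Omega> \<T>" "v2 \<in> V_bub \<Omega> \<T>"
    using assms(1) by (auto simp: V_mini_def)
  obtain w1 w2 where w: "w = (\<lambda>x. w1 x + w2 x)" "w1 \<in> V_lin \<Omega> \<T>" "w2 \<in> V_bub \<Omega> \<T>"
    using assms(2) by (auto simp: V_mini_def)
  have eq: "(\<lambda>x. c *\<^sub>R v x + w x) = (\<lambda>x. (c *\<^sub>R v1 x + w1 x) + (c *\<^sub>R v2 x + w2 x))"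
    by (simp add: v w scaleR_add_right add_ac)
  show ?thesis
    unfolding V_mini_def
    by (rule CollectI, rule exI, rule exI, intro conjI,
        rule eq, rule V_lin_lin[OF v(2) w(2)], rule V_bub_lin[OF v(3) w(3)])
qed

lemma V_mini_subset: "V_mini \<Omega> \<T> \<subseteq> H1_0_vec \<Omega>"
proof
  fix z assume "z \<in> V_mini \<Omega> \<T>"
  then obtain v w where z: "z = (\<lambda>x. v x + w x)" "v \<in> V_lin \<Omega> \<T>" "w \<in> V_bub \<Omega> \<T>"
    by (auto simp: V_mini_def)
  then show "z \<in> H1_0_vec \<Omega>"
    using H1_0_vec_lin[of v w 1] by (simp add: V_lin_def V_bub_def)
qed

lemma Q_space_lin:
  assumes "p \<in> Q_space \<Omega> \<T>" "q \<in> Q_space \<Omega> \<T>"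
  shows "(\<lambda>x. c * p x + q x) \<in> Q_space \<Omega> \<T>"
  using assms H1_0_lin[of p q c] P1_on_lin[of _ p q c] by (simp add: Q_space_def)

lemma Q_space_diff:
  assumes "p \<in> Q_space \<Omega> \<T>" "q \<in> Q_space \<Omega> \<T>"
  shows "(\<lambda>x. p x - q x) \<in> Q_space \<Omega> \<T>"
  using Q_space_lin[OF assms(2,1), of "-1"] by simp

lemma L2_inner_quotient:
  fixes p q r :: "real^'d \<Rightarrow> real"
  assumes "in_L2 \<Omega> p" "in_L2 \<Omega> q" "in_L2 \<Omega> r"
  shows "L2_inner \<Omega> (\<lambda>x. (p x - q x) / \<tau>) r = (L2_inner \<Omega> p r - L2_inner \<Omega> q r) / \<tau>"
proof -
  have "L2_inner \<Omega> (\<lambda>x. (p x - q x) / \<tau>) r = L2_inner \<Omega> (\<lambda>x. p x - q x) r / \<tau>"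
    by (simp add: L2_inner_def)
  then show ?thesis by (simp only: L2_inner_diff_left[OF assms])
qed

end

lemma lumped_diff_left: "lumped \<T> (\<lambda>x. p x - q x) r = lumped \<T> p r - lumped \<T> q r"
  by (simp add: lumped_def left_diff_distrib sum_subtractf right_diff_distrib)

lemma lumped_quotient: "lumped \<T> (\<lambda>x. (p x - q x) / \<tau>) r = (lumped \<T> p r - lumped \<T> q r) / \<tau>"
proof -
  have "lumped \<T> (\<lambda>x. (p x - q x) / \<tau>) r = lumped \<T> (\<lambda>x. p x - q x) r / \<tau>"
    by (simp add: lumped_def sum_divide_distrib[symmetric])
  then show ?thesis by (simp only: lumped_diff_left)
qed

lemma lumped_commute: "lumped \<T> p q = lumped \<T> q p"
  by (simp add: lumped_def mult.commute)

section \<open>Energy estimate and inf-sup bound\<close>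

text \<open>Of the displacement space only zero trace and closure under linear combinations are
  kept, so the piecewise linear and the MINI element are covered at once.\<close>

locale biot_discretization = bounded_open_vec \<Omega> for \<Omega> :: "(real^'d) set" +
  fixes \<T> :: "(real^'d) set set" and V :: "(real^'d \<Rightarrow> real^'d) set" and P :: biot_params and \<kappa> :: real
  assumes partition: "simplicial_partition \<Omega> \<T>"
    and params: "admissible_params P"
    and V_subset: "V \<subseteq> H1_0_vec \<Omega>"
    and V_lin_closed: "\<And>v w c. v \<in> V \<Longrightarrow> w \<in> V \<Longrightarrow> (\<lambda>x. c *\<^sub>R v x + w x) \<in> V"
    and kappa: "\<kappa> = lame_lambda P + 2 * lame_mu P / real CARD('d)"
begin

lemma kappa_pos: "0 < \<kappa>"
  using params by (simp add: kappa admissible_params_def add_pos_nonneg)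

lemma V_H1_0_vec: "v \<in> V \<Longrightarrow> v \<in> H1_0_vec \<Omega>"
  using V_subset by blast

lemma V_diff:
  assumes "v \<in> V" "w \<in> V"
  shows "(\<lambda>x. v x - w x) \<in> V"
  using V_lin_closed[OF assms(2,1), of "-1"] by simp

lemma Q_H1_0: "q \<in> Q_space \<Omega> \<T> \<Longrightarrow> q \<in> H1_0 \<Omega>"
  by (simp add: Q_space_def)

lemma in_L2_Q: "q \<in> Q_space \<Omega> \<T> \<Longrightarrow> in_L2 \<Omega> q"
  by (rule in_L2_H1_0[OF Q_H1_0])

lemma Z_nonneg: "q \<in> Q_space \<Omega> \<T> \<Longrightarrow> 0 \<le> Z_form \<Omega> \<T> q q"
  by (rule Z_form_nonneg[OF partition sets_domain in_L2_Q]) (auto simp: Q_space_def)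

lemma Z_form_lin:
  assumes "p \<in> Q_space \<Omega> \<T>" "q \<in> Q_space \<Omega> \<T>" "r \<in> Q_space \<Omega> \<T>"
  shows "Z_form \<Omega> \<T> (\<lambda>x. c * p x + q x) r = c * Z_form \<Omega> \<T> p r + Z_form \<Omega> \<T> q r"
proof -
  have "L2_inner \<Omega> (\<lambda>x. c * p x + q x) r = c * L2_inner \<Omega> p r + L2_inner \<Omega> q r"
    using L2_inner_lin[OF assms[THEN in_L2_Q], of c] by simp
  moreover have "lumped \<T> (\<lambda>x. c * p x + q x) r = c * lumped \<T> p r + lumped \<T> q r"
  proof -
    define S where "S T = (\<Sum>P\<in>vertices T. p P * r P)" for T
    define S' where "S' T = (\<Sum>P\<in>vertices T. q P * r P)" for T
    have "(\<Sum>P\<in>vertices T. (c * p P + q P) * r P) = c * S T + S' T" for T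
      by (simp add: S_def S'_def distrib_right sum.distrib sum_distrib_left mult.assoc)
    then show ?thesis
      unfolding lumped_def S_def[symmetric] S'_def[symmetric]
      by (simp add: distrib_left sum.distrib sum_distrib_left mult.left_commute)
  qed
  ultimately show ?thesis by (simp add: Z_form_def right_diff_distrib)
qed

lemma Z_form_commute: "Z_form \<Omega> \<T> p q = Z_form \<Omega> \<T> q p"
  unfolding Z_form_def by (simp only: lumped_commute[of _ p] L2_inner_commute[of _ p])

text \<open>Positivity at q + p and q - p bounds the cross term from both sides. In this additive
  form the contributions of two successive iterates separate, as the delta-weighted estimate
  requires.\<close>

lemma Z_form_le:
  assumes p: "p \<in> Q_space \<Omega> \<T>" and q: "q \<in> Q_space \<Omega> \<T>"
  shows "2 * \<bar>Z_form \<Omega> \<T> p q\<bar> \<le> Z_form \<Omega> \<T> p p + Z_form \<Omega> \<T> q q"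
proof -
  have *: "0 \<le> c * (c * Z_form \<Omega> \<T> p p + Z_form \<Omega> \<T> p q) + (c * Z_form \<Omega> \<T> p q + Z_form \<Omega> \<T> q q)" for c
  proof -
    let ?r = "\<lambda>x. c * p x + q x"
    have r: "?r \<in> Q_space \<Omega> \<T>" by (rule Q_space_lin[OF p q])
    have "Z_form \<Omega> \<T> ?r ?r = c * Z_form \<Omega> \<T> ?r p + Z_form \<Omega> \<T> ?r q"
      unfolding Z_form_lin[OF p q r] by (simp only: Z_form_commute)
    also have "\<dots> = c * (c * Z_form \<Omega> \<T> p p + Z_form \<Omega> \<T> p q) + (c * Z_form \<Omega> \<T> p q + Z_form \<Omega> \<T> q q)"
      unfolding Z_form_lin[OF p q p] Z_form_lin[OF p q q] Z_form_commute[of q p] ..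
    finally show ?thesis using Z_nonneg[OF r] by simp
  qed
  show ?thesis using *[of 1] *[of "-1"] by (simp add: abs_le_iff)
qed

lemma ap_form_nonneg: "0 \<le> ap_form \<Omega> P q q"
  using params by (simp add: ap_form_eq admissible_params_def L2_inner_self_nonneg)

text \<open>The choice of \<open>\<gamma> L\<close> serves to absorb the change of the displacement error into that of the
  pressure error.\<close>

lemma a_form_increment_le:
  assumes x: "d \<in> Q_space \<Omega> \<T>" and D: "D \<in> V"
    and eq: "a_form \<Omega> P D D = biot_alpha P * L2_inner \<Omega> d (divergence \<Omega> D)"
  shows "a_form \<Omega> P D D \<le> (biot_alpha P)\<^sup>2 / \<kappa> * L2_inner \<Omega> d d"
proof -
  let ?a = "a_form \<Omega> P D D" and ?\<delta> = "L2_norm \<Omega> (divergence \<Omega> D)"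
  have \<alpha>: "0 < biot_alpha P" using params by (simp add: admissible_params_def)
  have "\<bar>L2_inner \<Omega> d (divergence \<Omega> D)\<bar> \<le> L2_norm \<Omega> d * ?\<delta>"
    by (rule L2_Cauchy_Schwarz[OF in_L2_Q[OF x] in_L2_divergence[OF V_H1_0_vec[OF D]]])
  then have "?a \<le> biot_alpha P * (L2_norm \<Omega> d * ?\<delta>)"
    unfolding eq using \<alpha> by (intro mult_left_mono) auto
  \<comment> \<open>Young's inequality is weighted so that its divergence term is at most one copy
    of \<open>?a\<close>; subtracting it from \<open>2 * ?a\<close> leaves exactly the constant
    alpha^2/kappa.\<close>
  moreover have "2 * (biot_alpha P * (L2_norm \<Omega> d * ?\<delta>)) \<le> (biot_alpha P)\<^sup>2 / \<kappa> * (L2_norm \<Omega> d)\<^sup>2 + \<kappa> * ?\<delta>\<^sup>2"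
  proof -
    have "0 \<le> (biot_alpha P * L2_norm \<Omega> d - \<kappa> * ?\<delta>)\<^sup>2 / \<kappa>" using kappa_pos by simp
    also have "\<dots> = ((biot_alpha P * L2_norm \<Omega> d)\<^sup>2 + (\<kappa> * ?\<delta>)\<^sup>2 - 2 * (biot_alpha P * L2_norm \<Omega> d) * (\<kappa> * ?\<delta>)) / \<kappa>"
      by (simp only: power2_diff)
    also have "\<dots> = (biot_alpha P)\<^sup>2 / \<kappa> * (L2_norm \<Omega> d)\<^sup>2 + \<kappa> * ?\<delta>\<^sup>2 - 2 * (biot_alpha P * (L2_norm \<Omega> d * ?\<delta>))"
    proof -
      have alg: "((A * N)\<^sup>2 + (k * e)\<^sup>2 - 2 * (A * N) * (k * e)) / k = A\<^sup>2 / k * N\<^sup>2 + k * e\<^sup>2 - 2 * (A * (N * e))"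
        if "k \<noteq> 0" for A N k e :: real
        using that by (simp add: field_simps power2_eq_square)
      show ?thesis by (rule alg) (use kappa_pos in simp)
    qed
    finally show ?thesis by simp
  qed
  moreover have "\<kappa> * ?\<delta>\<^sup>2 \<le> ?a"
    unfolding L2_norm_squared kappa by (rule divergence_le_a_form[OF params V_H1_0_vec[OF D]])
  ultimately show ?thesis by (simp only: L2_norm_squared)
qed

text \<open>\<open>x\<close>, \<open>U\<close> are the errors before an iteration and
  \<open>y\<close>, \<open>W\<close> those after it; \<open>eq\<close> is already multiplied by tau.
  The previous displacement enters \<open>eq\<close> only as -a(W, U); completing the square exposes
  the increment W - U, and a(U, U) is dropped.\<close>

lemma energy_step:
  assumes x: "x \<in> Q_space \<Omega> \<T>" and y: "y \<in> Q_space \<Omega> \<T>" and U: "U \<in> V" and W: "W \<in> V"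
    and eqU: "\<And>v. v \<in> V \<Longrightarrow> a_form \<Omega> P U v = biot_alpha P * L2_inner \<Omega> x (divergence \<Omega> v)"
    and eqW: "\<And>v. v \<in> V \<Longrightarrow> a_form \<Omega> P W v = biot_alpha P * L2_inner \<Omega> y (divergence \<Omega> v)"
    and \<gamma>: "0 < \<gamma>" and \<omega>: "1 \<le> \<omega>" and L: "\<gamma> * L = \<omega> * ((biot_alpha P)\<^sup>2 / \<kappa>)"
    and eq: "inv_beta P * L2_inner \<Omega> y y + \<gamma> * L * lumped \<T> y y + \<tau> * ap_form \<Omega> P y y
      = - biot_alpha P * L2_inner \<Omega> (divergence \<Omega> U) y + L * L2_inner \<Omega> x y + (\<gamma> - 1) * L * lumped \<T> x y"
  shows "L2_inner \<Omega> y y + (2 - \<bar>1 - \<gamma>\<bar> / \<gamma>) * Z_form \<Omega> \<T> y y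
      + 2 * \<tau> / (\<gamma> * L) * ap_form \<Omega> P y y + a_form \<Omega> P W W / (\<gamma> * L)
    \<le> L2_inner \<Omega> x x + \<bar>1 - \<gamma>\<bar> / \<gamma> * Z_form \<Omega> \<T> x x"
proof -
  have \<alpha>: "0 < biot_alpha P" and \<beta>: "0 \<le> inv_beta P" using params by (auto simp: admissible_params_def)
  have "0 < (biot_alpha P)\<^sup>2 / \<kappa>" using \<alpha> kappa_pos by simp
  moreover have "1 * ((biot_alpha P)\<^sup>2 / \<kappa>) \<le> \<gamma> * L"
    unfolding L using \<omega> calculation by (intro mult_right_mono) auto
  ultimately have \<gamma>L: "0 < \<gamma> * L" "(biot_alpha P)\<^sup>2 / \<kappa> \<le> \<gamma> * L"
    by linarith+
  then have L0: "0 < L" using \<gamma> by (simp add: zero_less_mult_iff)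
  let ?d = "\<lambda>t. y t - x t" and ?D = "\<lambda>t. W t - U t"
  have d: "?d \<in> Q_space \<Omega> \<T>" by (rule Q_space_diff[OF y x])
  have D: "?D \<in> V" by (rule V_diff[OF W U])
  note VH = V_H1_0_vec
  have "a_form \<Omega> P ?D ?D = a_form \<Omega> P W ?D - a_form \<Omega> P U ?D"
    by (rule a_form_diff[OF VH[OF W] VH[OF U] VH[OF D]])
  also have "\<dots> = biot_alpha P * (L2_inner \<Omega> y (divergence \<Omega> ?D) - L2_inner \<Omega> x (divergence \<Omega> ?D))"
    unfolding eqW[OF D] eqU[OF D] by (simp add: right_diff_distrib)
  also have "\<dots> = biot_alpha P * L2_inner \<Omega> ?d (divergence \<Omega> ?D)"
    using L2_inner_diff_left[OF in_L2_Q[OF y] in_L2_Q[OF x] in_L2_divergence[OF VH[OF D]]] by simp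
  finally have "a_form \<Omega> P ?D ?D \<le> (biot_alpha P)\<^sup>2 / \<kappa> * L2_inner \<Omega> ?d ?d"
    by (rule a_form_increment_le[OF d D])
  also have "\<dots> \<le> \<gamma> * L * L2_inner \<Omega> ?d ?d"
    using \<gamma>L(2) by (intro mult_right_mono L2_inner_self_nonneg)
  finally have aD: "a_form \<Omega> P ?D ?D \<le> \<gamma> * L * L2_inner \<Omega> ?d ?d" .
  have dd: "L2_inner \<Omega> ?d ?d = L2_inner \<Omega> y y - 2 * L2_inner \<Omega> x y + L2_inner \<Omega> x x"
    using in_L2_Q[OF x] in_L2_Q[OF y] in_L2_Q[OF d]
    by (simp add: L2_inner_diff_left L2_inner_diff_right L2_inner_commute[of \<Omega> y x])
  have DD: "a_form \<Omega> P ?D ?D = a_form \<Omega> P W W - 2 * a_form \<Omega> P W U + a_form \<Omega> P U U"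
  proof -
    have "a_form \<Omega> P ?D ?D = a_form \<Omega> P W ?D - a_form \<Omega> P U ?D"
      by (rule a_form_diff[OF VH[OF W] VH[OF U] VH[OF D]])
    also have "a_form \<Omega> P W ?D = a_form \<Omega> P W W - a_form \<Omega> P U W"
      unfolding a_form_commute[of P W ?D] by (rule a_form_diff[OF VH[OF W] VH[OF U] VH[OF W]])
    also have "a_form \<Omega> P U ?D = a_form \<Omega> P W U - a_form \<Omega> P U U"
      unfolding a_form_commute[of P U ?D] by (rule a_form_diff[OF VH[OF W] VH[OF U] VH[OF U]])
    finally show ?thesis by (simp add: a_form_commute[of P U W])
  qed
  define s where "s = L2_inner \<Omega> x y"
  define zs where "zs = Z_form \<Omega> \<T> x y"
  \<comment> \<open>Splitting lumped products into L2 and Z parts merges the coefficients L and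
    (gamma - 1) L of the mixed L2 product into gamma L; only the Z part keeps the factor gamma -
    1.\<close>
  have lxy: "lumped \<T> x y = zs + s" and lyy: "lumped \<T> y y = Z_form \<Omega> \<T> y y + L2_inner \<Omega> y y"
    by (simp_all add: zs_def s_def Z_form_def)
  \<comment> \<open>The coupling term is the elasticity equation of \<open>W\<close> tested with
    \<open>U\<close>.\<close>
  have WU: "biot_alpha P * L2_inner \<Omega> (divergence \<Omega> U) y = a_form \<Omega> P W U"
    unfolding eqW[OF U] by (simp only: L2_inner_commute)
  have "(\<gamma> - 1) * L * zs \<le> \<bar>1 - \<gamma>\<bar> * L * \<bar>zs\<bar>"
  proof -
    have "(\<gamma> - 1) * zs \<le> \<bar>1 - \<gamma>\<bar> * \<bar>zs\<bar>" using abs_ge_self[of "(\<gamma> - 1) * zs"] by (simp add: abs_mult abs_minus_commute)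
    then have "L * ((\<gamma> - 1) * zs) \<le> L * (\<bar>1 - \<gamma>\<bar> * \<bar>zs\<bar>)" using L0 by (intro mult_left_mono) auto
    then show ?thesis by (simp add: mult_ac)
  qed
  also have "\<dots> \<le> \<bar>1 - \<gamma>\<bar> * L * ((Z_form \<Omega> \<T> x x + Z_form \<Omega> \<T> y y) / 2)"
    using Z_form_le[OF x y] L0 by (intro mult_left_mono) (auto simp: zs_def)
  finally have Zle: "(\<gamma> - 1) * L * zs \<le> \<bar>1 - \<gamma>\<bar> * L * ((Z_form \<Omega> \<T> x x + Z_form \<Omega> \<T> y y) / 2)" .
  have \<beta>0: "0 \<le> inv_beta P * L2_inner \<Omega> y y" using \<beta> by (simp add: L2_inner_self_nonneg)
  have U0: "0 \<le> a_form \<Omega> P U U" by (rule a_form_nonneg[OF params])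
  have "inv_beta P * L2_inner \<Omega> y y + \<gamma> * L * (Z_form \<Omega> \<T> y y + L2_inner \<Omega> y y) + \<tau> * ap_form \<Omega> P y y
    = - a_form \<Omega> P W U + L * s + (\<gamma> - 1) * L * (zs + s)"
    using eq unfolding lxy lyy s_def[symmetric] WU[symmetric] by simp
  then have "2 * (\<gamma> * L) * L2_inner \<Omega> y y + 2 * (\<gamma> * L) * Z_form \<Omega> \<T> y y + 2 * (\<tau> * ap_form \<Omega> P y y)
    + 2 * a_form \<Omega> P W U \<le> 2 * (\<gamma> * L) * s + \<bar>1 - \<gamma>\<bar> * L * (Z_form \<Omega> \<T> x x + Z_form \<Omega> \<T> y y)"
    using \<beta>0 Zle by (simp add: algebra_simps)
  \<comment> \<open>When the two inequalities are added, the cross terms 2 a(W, U) and 2 gamma L (x,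
    y) cancel.\<close>
  moreover have "a_form \<Omega> P W W - 2 * a_form \<Omega> P W U + a_form \<Omega> P U U
    \<le> \<gamma> * L * L2_inner \<Omega> y y - 2 * (\<gamma> * L) * s + \<gamma> * L * L2_inner \<Omega> x x"
    using aD unfolding DD dd s_def[symmetric] by (simp add: algebra_simps)
  ultimately have "\<gamma> * L * L2_inner \<Omega> y y + (2 * (\<gamma> * L) - \<bar>1 - \<gamma>\<bar> * L) * Z_form \<Omega> \<T> y y
      + 2 * (\<tau> * ap_form \<Omega> P y y) + a_form \<Omega> P W W
    \<le> \<gamma> * L * L2_inner \<Omega> x x + \<bar>1 - \<gamma>\<bar> * L * Z_form \<Omega> \<T> x x"
    using U0 by (simp add: algebra_simps)
  then have "(\<gamma> * L * L2_inner \<Omega> y y + (2 * (\<gamma> * L) - \<bar>1 - \<gamma>\<bar> * L) * Z_form \<Omega> \<T> y y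
      + 2 * (\<tau> * ap_form \<Omega> P y y) + a_form \<Omega> P W W) / (\<gamma> * L)
    \<le> (\<gamma> * L * L2_inner \<Omega> x x + \<bar>1 - \<gamma>\<bar> * L * Z_form \<Omega> \<T> x x) / (\<gamma> * L)"
    using \<gamma>L(1) by (intro divide_right_mono) auto
  moreover have "(\<gamma> * L * L2_inner \<Omega> y y + (2 * (\<gamma> * L) - \<bar>1 - \<gamma>\<bar> * L) * Z_form \<Omega> \<T> y y
      + 2 * (\<tau> * ap_form \<Omega> P y y) + a_form \<Omega> P W W) / (\<gamma> * L)
    = L2_inner \<Omega> y y + (2 - \<bar>1 - \<gamma>\<bar> / \<gamma>) * Z_form \<Omega> \<T> y y
      + 2 * \<tau> / (\<gamma> * L) * ap_form \<Omega> P y y + a_form \<Omega> P W W / (\<gamma> * L)"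
    using L0 \<gamma> by (simp add: add_divide_distrib diff_divide_distrib left_diff_distrib)
  moreover have "(\<gamma> * L * L2_inner \<Omega> x x + \<bar>1 - \<gamma>\<bar> * L * Z_form \<Omega> \<T> x x) / (\<gamma> * L)
    = L2_inner \<Omega> x x + \<bar>1 - \<gamma>\<bar> / \<gamma> * Z_form \<Omega> \<T> x x"
    using L0 \<gamma> by (simp add: add_divide_distrib)
  ultimately show ?thesis by simp
qed

text \<open>By the error equation a quotient with nonzero denominator equals a(W, w) / (alpha
  |w|_A), which Cauchy-Schwarz bounds by |W|_A / alpha.\<close>

lemma inf_sup_bound:
  assumes inf_sup: "weak_inf_sup \<Omega> \<T> V P \<eta> \<epsilon>" and q: "q \<in> Q_space \<Omega> \<T>" and W: "W \<in> V"
    and eqW: "\<And>v. v \<in> V \<Longrightarrow> a_form \<Omega> P W v = biot_alpha P * L2_inner \<Omega> q (divergence \<Omega> v)"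
  shows "\<eta> * L2_norm \<Omega> q \<le> sqrt \<kappa> * A_norm \<Omega> P W / biot_alpha P + \<epsilon> * h_grad_norm \<Omega> \<T> q"
proof -
  have \<alpha>: "0 < biot_alpha P" using params by (simp add: admissible_params_def)
  have An: "0 \<le> A_norm \<Omega> P w" for w by (simp add: A_norm_def a_form_nonneg[OF params])
  have "L2_inner \<Omega> q (divergence \<Omega> w) / A_norm \<Omega> P w \<le> A_norm \<Omega> P W / biot_alpha P" if w: "w \<in> V" for w
  proof (cases "A_norm \<Omega> P w = 0")
    case True
    \<comment> \<open>Division by zero yields 0, and the right side is nonnegative.\<close>
    then show ?thesis using An[of W] \<alpha> by simp
  next
    case False
    then have pos: "0 < A_norm \<Omega> P w" using An[of w] by simp
    have "biot_alpha P * L2_inner \<Omega> q (divergence \<Omega> w) \<le> A_norm \<Omega> P W * A_norm \<Omega> P w"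
      using a_form_Cauchy_Schwarz[OF params V_H1_0_vec[OF W] V_H1_0_vec[OF w]]
      unfolding eqW[OF w] by linarith
    then show ?thesis using pos \<alpha> by (simp add: field_simps)
  qed
  then have "(SUP w\<in>{w\<in>V. \<exists>x\<in>\<Omega>. w x \<noteq> 0}. ereal (L2_inner \<Omega> q (divergence \<Omega> w) / A_norm \<Omega> P w))
      \<le> ereal (A_norm \<Omega> P W / biot_alpha P)"
    by (intro SUP_least) simp
  moreover have "ereal (\<eta> / sqrt \<kappa> * L2_norm \<Omega> q - \<epsilon> / sqrt \<kappa> * h_grad_norm \<Omega> \<T> q)
      \<le> (SUP w\<in>{w\<in>V. \<exists>x\<in>\<Omega>. w x \<noteq> 0}. ereal (L2_inner \<Omega> q (divergence \<Omega> w) / A_norm \<Omega> P w))"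
    using inf_sup q unfolding weak_inf_sup_def kappa by blast
  ultimately have "ereal (\<eta> / sqrt \<kappa> * L2_norm \<Omega> q - \<epsilon> / sqrt \<kappa> * h_grad_norm \<Omega> \<T> q)
      \<le> ereal (A_norm \<Omega> P W / biot_alpha P)" by (rule order_trans[rotated])
  then have "\<eta> / sqrt \<kappa> * L2_norm \<Omega> q - \<epsilon> / sqrt \<kappa> * h_grad_norm \<Omega> \<T> q \<le> A_norm \<Omega> P W / biot_alpha P"
    by simp
  then have "sqrt \<kappa> * (\<eta> / sqrt \<kappa> * L2_norm \<Omega> q - \<epsilon> / sqrt \<kappa> * h_grad_norm \<Omega> \<T> q)
      \<le> sqrt \<kappa> * (A_norm \<Omega> P W / biot_alpha P)"
    using kappa_pos by (intro mult_left_mono) auto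
  moreover have "sqrt \<kappa> * (\<eta> / sqrt \<kappa> * L2_norm \<Omega> q - \<epsilon> / sqrt \<kappa> * h_grad_norm \<Omega> \<T> q)
      = \<eta> * L2_norm \<Omega> q - \<epsilon> * h_grad_norm \<Omega> \<T> q"
  proof -
    have "sqrt \<kappa> \<noteq> 0" using kappa_pos by simp
    then show ?thesis by (simp add: right_diff_distrib)
  qed
  ultimately show ?thesis by simp
qed

end

text \<open>The equation for \<open>\<theta>\<close> makes Young's inequality with weight \<open>2 \<theta>\<close> balance exactly.\<close>

lemma contraction_estimate:
  fixes \<theta> \<omega> \<eta> \<epsilon> \<delta> C N G s z :: real
  assumes \<theta>: "0 < \<theta>" and \<omega>: "0 < \<omega>" and nonneg: "0 \<le> \<eta>" "0 \<le> N"
    and bound: "\<eta> * N \<le> s + \<epsilon> * G" and G: "G\<^sup>2 \<le> C * z"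
    and root: "2 * (1 - \<delta>) * \<theta>\<^sup>2 + ((1 - \<delta>) - \<eta>\<^sup>2 * \<delta> / (2 * \<omega>) - \<epsilon>\<^sup>2 * C / (2 * \<omega>)) * \<theta>
      - \<epsilon>\<^sup>2 * C / (4 * \<omega>) = 0"
  shows "\<eta>\<^sup>2 / (\<omega> * (1 + 2 * \<theta>)) * (N\<^sup>2 + \<delta> * z) \<le> s\<^sup>2 / \<omega> + 2 * (1 - \<delta>) * z"
proof -
  have "(\<eta> * N)\<^sup>2 \<le> (s + \<epsilon> * G)\<^sup>2" using bound nonneg by (intro power_mono) auto
  also have "\<dots> \<le> (1 + 2 * \<theta>) * s\<^sup>2 + (1 + 1 / (2 * \<theta>)) * (\<epsilon> * G)\<^sup>2"
  proof -
    have "0 \<le> (2 * \<theta> * s - \<epsilon> * G)\<^sup>2 / (2 * \<theta>)" using \<theta> by simp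
    also have "\<dots> = 2 * \<theta> * s\<^sup>2 - 2 * s * (\<epsilon> * G) + 1 / (2 * \<theta>) * (\<epsilon> * G)\<^sup>2"
    proof -
      have alg: "(2 * t * a - b)\<^sup>2 / (2 * t) = 2 * t * a\<^sup>2 - 2 * a * b + 1 / (2 * t) * b\<^sup>2" if "t > 0" for t a b :: real
        using that by (simp add: field_simps power2_eq_square)
      show ?thesis by (rule alg[OF \<theta>])
    qed
    finally show ?thesis by (simp add: power2_sum distrib_right)
  qed
  also have "(1 + 1 / (2 * \<theta>)) * (\<epsilon> * G)\<^sup>2 \<le> (1 + 1 / (2 * \<theta>)) * (\<epsilon>\<^sup>2 * (C * z))"
    unfolding power_mult_distrib using \<theta> G by (intro mult_left_mono) auto
  finally have young: "\<eta>\<^sup>2 * N\<^sup>2 \<le> (1 + 2 * \<theta>) * s\<^sup>2 + (1 + 1 / (2 * \<theta>)) * (\<epsilon>\<^sup>2 * (C * z))"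
    by (simp add: power_mult_distrib)
  \<comment> \<open>Scaling the root equation by 2 omega/theta isolates the surplus weight 2 omega
    (1 - delta) (1 + 2 theta) of Z, which must pay for the delta part of the contracted quantity and
    for the mesh term of Young's inequality.\<close>
  have "4 * \<omega> * (2 * (1 - \<delta>) * \<theta>\<^sup>2 + ((1 - \<delta>) - \<eta>\<^sup>2 * \<delta> / (2 * \<omega>) - \<epsilon>\<^sup>2 * C / (2 * \<omega>)) * \<theta>
      - \<epsilon>\<^sup>2 * C / (4 * \<omega>)) / (2 * \<theta>)
    = 2 * \<omega> * (1 - \<delta>) * (1 + 2 * \<theta>) - \<eta>\<^sup>2 * \<delta> - (1 + 1 / (2 * \<theta>)) * (\<epsilon>\<^sup>2 * C)"
    using \<theta> \<omega> by (simp add: field_simps power2_eq_square)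
  then have bal: "2 * \<omega> * (1 - \<delta>) * (1 + 2 * \<theta>) = \<eta>\<^sup>2 * \<delta> + (1 + 1 / (2 * \<theta>)) * (\<epsilon>\<^sup>2 * C)"
    unfolding root by simp
  have "\<eta>\<^sup>2 * (N\<^sup>2 + \<delta> * z) \<le> (1 + 2 * \<theta>) * s\<^sup>2 + ((1 + 1 / (2 * \<theta>)) * (\<epsilon>\<^sup>2 * C) + \<eta>\<^sup>2 * \<delta>) * z"
    using young by (simp add: distrib_left distrib_right mult_ac)
  also have "\<dots> = (1 + 2 * \<theta>) * s\<^sup>2 + (2 * \<omega> * (1 - \<delta>) * (1 + 2 * \<theta>)) * z"
    unfolding bal by simp
  also have "\<dots> = (\<omega> * (1 + 2 * \<theta>)) * (s\<^sup>2 / \<omega> + 2 * (1 - \<delta>) * z)"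
    using \<omega> by (simp add: field_simps)
  finally show ?thesis
    using \<theta> \<omega> by (simp add: divide_le_eq mult.commute pos_divide_le_eq)
qed

text \<open>A positive leading coefficient makes the quadratic nonnegative far out, so the
  intermediate value theorem supplies a root together with its lower bound.\<close>

lemma ex_root_ge:
  fixes a b c x :: real
  assumes "0 < a" "a * x\<^sup>2 + b * x - c \<le> 0"
  shows "\<exists>t\<ge>x. a * t\<^sup>2 + b * t - c = 0"
proof -
  \<comment> \<open>Here the quadratic term outweighs the other two: \<open>M \<ge> 1\<close> allows
    |c| to be replaced by |c| M.\<close>
  define M where "M = max x ((\<bar>b\<bar> + \<bar>c\<bar>) / a + 1)"
  have M: "x \<le> M" "1 \<le> M" "\<bar>b\<bar> + \<bar>c\<bar> \<le> a * M"
  proof -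
    have "(\<bar>b\<bar> + \<bar>c\<bar>) / a + 1 \<le> M" unfolding M_def by (rule max.cobounded2)
    moreover have "0 \<le> (\<bar>b\<bar> + \<bar>c\<bar>) / a" using assms(1) by simp
    ultimately show "1 \<le> M" by linarith
    have "(\<bar>b\<bar> + \<bar>c\<bar>) / a \<le> M" using \<open>(\<bar>b\<bar> + \<bar>c\<bar>) / a + 1 \<le> M\<close> by linarith
    then show "\<bar>b\<bar> + \<bar>c\<bar> \<le> a * M" using assms(1) by (simp add: divide_le_eq mult.commute)
  qed (simp add: M_def)
  have "\<bar>b\<bar> * M + \<bar>c\<bar> * 1 \<le> \<bar>b\<bar> * M + \<bar>c\<bar> * M" using M by (intro add_left_mono mult_left_mono) auto
  also have "\<dots> = (\<bar>b\<bar> + \<bar>c\<bar>) * M" by (simp add: distrib_right)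
  also have "\<dots> \<le> (a * M) * M" using M by (intro mult_right_mono) auto
  finally have "\<bar>b\<bar> * M + \<bar>c\<bar> \<le> a * M\<^sup>2" by (simp add: power2_eq_square)
  moreover have "- (\<bar>b\<bar> * M) \<le> b * M" using mult_right_mono[of "- \<bar>b\<bar>" b M] M by simp
  ultimately have "0 \<le> a * M\<^sup>2 + b * M - c" by linarith
  moreover have "continuous_on {x..M} (\<lambda>t. a * t\<^sup>2 + b * t - c)" by (intro continuous_intros)
  ultimately obtain t where "x \<le> t" "a * t\<^sup>2 + b * t - c = 0"
    using IVT'[of "\<lambda>t. a * t\<^sup>2 + b * t - c" x 0 M] assms(2) M(1) by blast
  then show ?thesis by blast
qed

section \<open>Convergence\<close>

text \<open>\<open>A\<close>, \<open>l\<close>, \<open>d\<close> and \<open>a\<close> stand for L2,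
  lumped, divergence and Darcy products with the test function; the suffixes 1, m, 0 and p mean new
  iterate, previous iterate, old time level and exact discrete solution. Subtraction removes the old
  time level and the source.\<close>

lemma scheme_difference:
  fixes \<beta> \<gamma> L \<alpha> \<tau> :: real
  assumes "\<tau> \<noteq> 0"
    and "\<beta> * ((A1 - A0) / \<tau>) + \<gamma> * L * ((l1 - l0) / \<tau>) + a1
      = - \<alpha> * ((dm - d0) / \<tau>) + L * ((Am - A0) / \<tau>) + (\<gamma> - 1) * L * ((lm - l0) / \<tau>) + g"
    and "\<beta> * ((Ap - A0) / \<tau>) + \<alpha> * ((dp - d0) / \<tau>) + ap + L * ((lp - l0) / \<tau>) - L * ((Ap - A0) / \<tau>) = g"
  shows "\<beta> * (A1 - Ap) + \<gamma> * L * (l1 - lp) + \<tau> * (a1 - ap)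
      = - \<alpha> * (dm - dp) + L * (Am - Ap) + (\<gamma> - 1) * L * (lm - lp)"
proof -
  \<comment> \<open>With the reciprocal as a variable subject to \<open>\<tau> * t = 1\<close>, the
    claim is a polynomial consequence of the two equations.\<close>
  define t where "t = 1 / \<tau>"
  have t: "X / \<tau> = X * t" "\<tau> * (X * t) = X" for X using assms(1) by (simp_all add: t_def)
  have 1: "\<tau> * (\<beta> * ((A1 - A0) * t) + \<gamma> * L * ((l1 - l0) * t) + a1)
      = \<tau> * (- \<alpha> * ((dm - d0) * t) + L * ((Am - A0) * t) + (\<gamma> - 1) * L * ((lm - l0) * t) + g)"
    using assms(2) unfolding t(1) by (rule arg_cong)
  have 2: "\<tau> * (\<beta> * ((Ap - A0) * t) + \<alpha> * ((dp - d0) * t) + ap + L * ((lp - l0) * t) - L * ((Ap - A0) * t)) = \<tau> * g"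
    using assms(3) unfolding t(1) by (rule arg_cong)
  have "\<tau> * t = 1" using t(2)[of 1] by simp
  with 1 2 show ?thesis by algebra
qed

text \<open>The constants \<open>\<eta>\<close>, \<open>\<epsilon>\<close> are fixed for a whole
  family of meshes and parameters. The rate at \<open>i = 1\<close> carries a proviso because the
  energy comparison needs the elasticity equation of the preceding pair, and only the starting pair
  is not an output of Step 2.\<close>

theorem theorem1:
  fixes \<Omega> :: "(real^'d) set"
    and Vh :: "(real^'d) set set \<Rightarrow> (real^'d \<Rightarrow> real^'d) set"
    and \<F> :: "((real^'d) set set \<times> biot_params) set"
    and \<eta> \<epsilon> :: real
    and \<T> :: "(real^'d) set set" and P :: biot_params
    and \<tau> L \<gamma> \<omega> :: real
    and f u_old u :: "real^'d \<Rightarrow> real^'d" and g p_old p :: "real^'d \<Rightarrow> real"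
    and us :: "nat \<Rightarrow> real^'d \<Rightarrow> real^'d" and ps :: "nat \<Rightarrow> real^'d \<Rightarrow> real"
  assumes dim: "CARD('d) \<le> 3"
    and domain: "bounded_domain \<Omega>"
    and spaces: "Vh \<in> {V_lin \<Omega>, V_mini \<Omega>}"
    and family: "\<And>\<T> P. (\<T>, P) \<in> \<F> \<Longrightarrow> simplicial_partition \<Omega> \<T> \<and> admissible_params P"
    and constants: "\<eta> > 0" "\<epsilon> > 0"
    and inf_sup: "\<And>\<T> P. (\<T>, P) \<in> \<F> \<Longrightarrow> weak_inf_sup \<Omega> \<T> (Vh \<T>) P \<eta> \<epsilon>"
    and member: "(\<T>, P) \<in> \<F>"
    and step: "\<tau> > 0"
    and gamma: "1/2 < \<gamma>" "\<gamma> \<le> 2"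
    and omega: "\<omega> \<ge> 1"
    and L: "\<gamma> * L = \<omega> * ((biot_alpha P)\<^sup>2 / (lame_lambda P + 2 * lame_mu P / real CARD('d)))"
    and data: "in_L2 \<Omega> f" "in_L2 \<Omega> g"
    and previous: "u_old \<in> Vh \<T>" "p_old \<in> Q_space \<Omega> \<T>"
    and scheme: "stabilized_scheme \<Omega> \<T> (Vh \<T>) P \<tau> L f g u_old p_old u p"
    and iteration: "iterative_method \<Omega> \<T> (Vh \<T>) P \<tau> L \<gamma> f g u_old p_old us ps"
  shows "((\<lambda>i. L2_norm \<Omega> (\<lambda>x. ps i x - p x)) \<longlonglongrightarrow> 0 \<and>
          (\<lambda>i. L2_norm \<Omega> (\<lambda>x. us i x - u x)) \<longlonglongrightarrow> 0 \<and>
          (\<lambda>i. A_norm \<Omega> P (\<lambda>x. us i x - u x)) \<longlonglongrightarrow> 0) \<and>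
    (\<forall>C1 C2. C1 > 0 \<and> C2 > 0 \<and>
       (\<forall>q\<in>Q_space \<Omega> \<T>. C1 * Z_form \<Omega> \<T> q q \<le> (h_grad_norm \<Omega> \<T> q)\<^sup>2 \<and>
                        (h_grad_norm \<Omega> \<T> q)\<^sup>2 \<le> C2 * Z_form \<Omega> \<T> q q) \<longrightarrow>
       (let is_root = (\<lambda>\<theta>.
              \<theta> \<ge> \<epsilon>\<^sup>2 * C2 * \<gamma> / (4 * \<omega> * (\<gamma> - \<bar>1 - \<gamma>\<bar>)) \<and>
              (2 * (\<gamma> - \<bar>1 - \<gamma>\<bar>) / \<gamma>) * \<theta>\<^sup>2
              + ((\<gamma> - \<bar>1 - \<gamma>\<bar>) / \<gamma> - \<eta>\<^sup>2 * \<bar>1 - \<gamma>\<bar> / (2 * \<omega> * \<gamma>) - \<epsilon>\<^sup>2 * C2 / (2 * \<omega>)) * \<theta>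
              - \<epsilon>\<^sup>2 * C2 / (4 * \<omega>) = 0);
            E = (\<lambda>i. (L2_norm \<Omega> (\<lambda>x. ps i x - p x))\<^sup>2
                   + \<bar>1 - \<gamma>\<bar> / \<gamma> * Z_form \<Omega> \<T> (\<lambda>x. ps i x - p x) (\<lambda>x. ps i x - p x))
        in (\<exists>\<theta>. is_root \<theta>) \<and>
           (\<forall>\<theta>. is_root \<theta> \<longrightarrow>
              (\<forall>i\<ge>1. (i = 1 \<longrightarrow> elasticity_eq \<Omega> (Vh \<T>) P f u_old p_old) \<longrightarrow>
                 E i \<le> 1 / (1 + \<eta>\<^sup>2 / (\<omega> * (1 + 2 * \<theta>))) * E (i - 1)))))"
proof -
  have "open \<Omega>" "bounded \<Omega>" using domain by (auto simp: bounded_domain_def)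
  then interpret bounded_open_vec \<Omega> by unfold_locales
  define V where "V = Vh \<T>"
  define \<kappa> where "\<kappa> = lame_lambda P + 2 * lame_mu P / real CARD('d)"
  have V: "V = V_lin \<Omega> \<T> \<or> V = V_mini \<Omega> \<T>" using spaces by (auto simp: V_def)
  interpret biot_discretization \<Omega> \<T> V P \<kappa>
  proof
    show "simplicial_partition \<Omega> \<T>" "admissible_params P" using family[OF member] by auto
    show "V \<subseteq> H1_0_vec \<Omega>" using V V_mini_subset by (auto simp: V_lin_def)
    show "(\<lambda>x. c *\<^sub>R v x + w x) \<in> V" if "v \<in> V" "w \<in> V" for v w c
      using V that V_lin_lin V_mini_lin by auto
  qed (rule \<kappa>_def)
  define \<alpha> where "\<alpha> = biot_alpha P"
  have \<alpha>: "0 < \<alpha>" using params by (simp add: admissible_params_def \<alpha>_def)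
  have \<gamma>0: "0 < \<gamma>" using gamma by simp
  have L': "\<gamma> * L = \<omega> * (\<alpha>\<^sup>2 / \<kappa>)" using L by (simp only: \<alpha>_def \<kappa>_def)
  have \<gamma>L: "0 < \<gamma> * L" unfolding L' using omega \<alpha> kappa_pos by simp
  define \<delta> where "\<delta> = \<bar>1 - \<gamma>\<bar> / \<gamma>"
  \<comment> \<open>Here \<open>\<gamma> > 1/2\<close> enters: it is equivalent to |1 - gamma| <
    gamma for positive gamma.\<close>
  have \<delta>: "0 \<le> \<delta>" "\<delta> < 1" using gamma by (auto simp: \<delta>_def abs_if)
  have IS: "weak_inf_sup \<Omega> \<T> V P \<eta> \<epsilon>" unfolding V_def by (rule inf_sup[OF member])
  define e where "e i = (\<lambda>x. ps i x - p x)" for i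
  define w where "w i = (\<lambda>x. us i x - u x)" for i
  have sch: "u \<in> V" "p \<in> Q_space \<Omega> \<T>" "elasticity_eq \<Omega> V P f u p"
    using scheme by (auto simp: stabilized_scheme_def V_def)
  have it: "us 0 = u_old" "ps 0 = p_old" using iteration by (auto simp: iterative_method_def)
  have itQ: "ps i \<in> Q_space \<Omega> \<T>" and itV: "us i \<in> V" for i
    using iteration previous by (cases "i = 0"; auto simp: iterative_method_def V_def)+
  have itE: "elasticity_eq \<Omega> V P f (us i) (ps i)" if "i \<ge> 1" for i
    using iteration that by (auto simp: iterative_method_def V_def)
  have eQ: "e i \<in> Q_space \<Omega> \<T>" for i unfolding e_def by (rule Q_space_diff[OF itQ sch(2)])
  have wV: "w i \<in> V" for i unfolding w_def by (rule V_diff[OF itV sch(1)])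
  \<comment> \<open>The load cancels, so the errors satisfy a homogeneous elasticity
    equation.\<close>
  have err: "a_form \<Omega> P (w i) v = biot_alpha P * L2_inner \<Omega> (e i) (divergence \<Omega> v)"
    if el: "elasticity_eq \<Omega> V P f (us i) (ps i)" and v: "v \<in> V" for i v
  proof -
    have "a_form \<Omega> P (w i) v = a_form \<Omega> P (us i) v - a_form \<Omega> P u v"
      unfolding w_def by (rule a_form_diff[OF V_H1_0_vec[OF itV] V_H1_0_vec[OF sch(1)] V_H1_0_vec[OF v]])
    moreover have "L2_inner \<Omega> (e i) (divergence \<Omega> v)
      = L2_inner \<Omega> (ps i) (divergence \<Omega> v) - L2_inner \<Omega> p (divergence \<Omega> v)"
      unfolding e_def
      by (rule L2_inner_diff_left[OF in_L2_Q[OF itQ] in_L2_Q[OF sch(2)] in_L2_divergence[OF V_H1_0_vec[OF v]]])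
    moreover have "a_form \<Omega> P (us i) v - biot_alpha P * L2_inner \<Omega> (ps i) (divergence \<Omega> v)
      = a_form \<Omega> P u v - biot_alpha P * L2_inner \<Omega> p (divergence \<Omega> v)"
      using el sch(3) v by (simp add: elasticity_eq_def)
    ultimately show ?thesis by (simp add: right_diff_distrib)
  qed
  have diff_eq: "inv_beta P * L2_inner \<Omega> (e i) (e i) + \<gamma> * L * lumped \<T> (e i) (e i) + \<tau> * ap_form \<Omega> P (e i) (e i)
      = - biot_alpha P * L2_inner \<Omega> (divergence \<Omega> (w (i - 1))) (e i) + L * L2_inner \<Omega> (e (i - 1)) (e i)
        + (\<gamma> - 1) * L * lumped \<T> (e (i - 1)) (e i)" if i: "i \<ge> 1" for i
  proof -
    define q where "q = e i"
    have q: "q \<in> Q_space \<Omega> \<T>" unfolding q_def by (rule eQ)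
    note L2 = in_L2_Q[OF q] in_L2_Q[OF sch(2)] in_L2_Q[OF itQ] in_L2_Q[OF previous(2)]
    have pV: "u_old \<in> V" using previous(1) by (simp add: V_def)
    note VH = V_H1_0_vec[OF itV] V_H1_0_vec[OF sch(1)] V_H1_0_vec[OF pV]
    have H: "inv_beta P * L2_inner \<Omega> (\<lambda>x. (ps i x - p_old x) / \<tau>) q
        + \<gamma> * L * lumped \<T> (\<lambda>x. (ps i x - p_old x) / \<tau>) q + ap_form \<Omega> P (ps i) q
      = - biot_alpha P * L2_inner \<Omega> (divergence \<Omega> (\<lambda>x. (us (i - 1) x - u_old x) /\<^sub>R \<tau>)) q
        + L * L2_inner \<Omega> (\<lambda>x. (ps (i - 1) x - p_old x) / \<tau>) q
        + (\<gamma> - 1) * L * lumped \<T> (\<lambda>x. (ps (i - 1) x - p_old x) / \<tau>) q + L2_inner \<Omega> g q"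
      using iteration i q unfolding iterative_method_def by blast
    have S: "inv_beta P * L2_inner \<Omega> (\<lambda>x. (p x - p_old x) / \<tau>) q
        + biot_alpha P * L2_inner \<Omega> (divergence \<Omega> (\<lambda>x. (u x - u_old x) /\<^sub>R \<tau>)) q
        + ap_form \<Omega> P p q + L * lumped \<T> (\<lambda>x. (p x - p_old x) / \<tau>) q
        - L * L2_inner \<Omega> (\<lambda>x. (p x - p_old x) / \<tau>) q = L2_inner \<Omega> g q"
      using scheme q unfolding stabilized_scheme_def by blast
    have "\<tau> \<noteq> 0" using step by simp
    from scheme_difference[OF this
      H[unfolded L2_inner_quotient[OF L2(3,4,1)] lumped_quotient L2_inner_divergence_quotient[OF VH(1,3) L2(1)]]
      S[unfolded L2_inner_quotient[OF L2(2,4,1)] lumped_quotient L2_inner_divergence_quotient[OF VH(2,3) L2(1)]]]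
    have "inv_beta P * L2_inner \<Omega> (e i) q + \<gamma> * L * lumped \<T> (e i) q + \<tau> * ap_form \<Omega> P (e i) q
      = - biot_alpha P * L2_inner \<Omega> (divergence \<Omega> (w (i - 1))) q + L * L2_inner \<Omega> (e (i - 1)) q
        + (\<gamma> - 1) * L * lumped \<T> (e (i - 1)) q"
      unfolding e_def w_def L2_inner_diff_left[OF L2(3,2,1)] lumped_diff_left
        L2_inner_divergence_diff[OF VH(1,2) L2(1)] ap_form_diff[OF Q_H1_0[OF itQ] Q_H1_0[OF sch(2)] Q_H1_0[OF q]] .
    then show ?thesis unfolding q_def .
  qed
  define E where "E i = L2_inner \<Omega> (e i) (e i) + \<delta> * Z_form \<Omega> \<T> (e i) (e i)" for i
  define A where "A i = a_form \<Omega> P (w i) (w i)" for i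
  have A0: "0 \<le> A i" for i unfolding A_def by (rule a_form_nonneg[OF params])
  have Z0: "0 \<le> Z_form \<Omega> \<T> (e i) (e i)" for i by (rule Z_nonneg[OF eQ])
  have ap0: "0 \<le> 2 * \<tau> / (\<gamma> * L) * ap_form \<Omega> P (e i) (e i)" for i
    using step \<gamma>L ap_form_nonneg[of "e i"] by (intro mult_nonneg_nonneg) auto
  have E0: "0 \<le> E i" for i using \<delta> Z0[of i] by (simp add: E_def L2_inner_self_nonneg)
  have energy: "E i + 2 * (1 - \<delta>) * Z_form \<Omega> \<T> (e i) (e i)
      + 2 * \<tau> / (\<gamma> * L) * ap_form \<Omega> P (e i) (e i) + A i / (\<gamma> * L) \<le> E (i - 1)"
    if i: "i \<ge> 1" and old: "i = 1 \<longrightarrow> elasticity_eq \<Omega> V P f u_old p_old" for i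
  proof -
    have el: "elasticity_eq \<Omega> V P f (us (i - 1)) (ps (i - 1))"
      using old it itE[of "i - 1"] i by (cases "i = 1") auto
    \<comment> \<open>Of the Z term the part with weight delta belongs to \<open>E i\<close>; the
      remaining 2 (1 - delta) is surplus for the rate.\<close>
    have "(2 - \<delta>) * Z_form \<Omega> \<T> (e i) (e i)
      = \<delta> * Z_form \<Omega> \<T> (e i) (e i) + 2 * (1 - \<delta>) * Z_form \<Omega> \<T> (e i) (e i)"
      by (simp add: algebra_simps)
    then show ?thesis
      using energy_step[OF eQ eQ wV wV err[OF el] err[OF itE[OF i]] \<gamma>0 omega L'[unfolded \<alpha>_def] diff_eq[OF i]]
      unfolding E_def A_def \<delta>_def[symmetric] by linarith
  qed
  have inf_sup_e: "\<eta> * L2_norm \<Omega> (e i) \<le> sqrt \<kappa> * A_norm \<Omega> P (w i) / \<alpha> + \<epsilon> * h_grad_norm \<Omega> \<T> (e i)"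
    if "i \<ge> 1" for i
    unfolding \<alpha>_def by (rule inf_sup_bound[OF IS eQ wV err[OF itE[OF that]]])

  \<comment> \<open>The shift by one skips the first iteration, where the energy estimate is
    conditional.\<close>
  have "decseq (\<lambda>n. E (n + 1))"
  proof (rule decseq_SucI)
    fix n
    have "0 \<le> 2 * (1 - \<delta>) * Z_form \<Omega> \<T> (e (n + 2)) (e (n + 2))" using \<delta> Z0 by simp
    moreover have "0 \<le> A (n + 2) / (\<gamma> * L)" using A0 \<gamma>L by simp
    ultimately show "E (Suc n + 1) \<le> E (n + 1)" using energy[of "n + 2"] ap0[of "n + 2"] by simp
  qed
  then have "convergent (\<lambda>n. E (n + 1))"
    using E0 by (intro Bseq_monoseq_convergent decseq_imp_monoseq decseq_bounded) auto
  then obtain l where l: "(\<lambda>n. E (n + 1)) \<longlonglongrightarrow> l" by (auto simp: convergent_def)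
  have dE: "(\<lambda>n. E (n + 1) - E (n + 2)) \<longlonglongrightarrow> 0"
    using tendsto_diff[OF l LIMSEQ_ignore_initial_segment[OF l, of 1]] by simp
  \<comment> \<open>Quantities dominated by decrements of a convergent sequence vanish in the
    limit.\<close>
  have lim: "F \<longlonglongrightarrow> 0" if F: "\<And>i. i \<ge> 2 \<Longrightarrow> 0 \<le> F i \<and> F i \<le> c * (E (i - 1) - E i)" for F c
  proof (rule LIMSEQ_offset)
    show "(\<lambda>n. F (n + 2)) \<longlonglongrightarrow> 0"
    proof (rule Lim_null_comparison)
      show "\<forall>\<^sub>F n in sequentially. norm (F (n + 2)) \<le> c * (E (n + 1) - E (n + 2))"
      proof (intro always_eventually allI)
        fix n show "norm (F (n + 2)) \<le> c * (E (n + 1) - E (n + 2))" using F[of "n + 2"] by simp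
      qed
      show "(\<lambda>n. c * (E (n + 1) - E (n + 2))) \<longlonglongrightarrow> 0" using tendsto_mult[OF tendsto_const dE, of c] by simp
    qed
  qed
  have "A \<longlonglongrightarrow> 0"
  proof (rule lim)
    fix i :: nat assume i: "i \<ge> 2"
    have "0 \<le> 2 * (1 - \<delta>) * Z_form \<Omega> \<T> (e i) (e i)" using \<delta> Z0 by simp
    then have "A i / (\<gamma> * L) \<le> E (i - 1) - E i" using energy[of i] ap0[of i] i by simp
    then show "0 \<le> A i \<and> A i \<le> \<gamma> * L * (E (i - 1) - E i)"
      using A0[of i] \<gamma>L by (simp add: pos_divide_le_eq mult.commute)
  qed
  then have "(\<lambda>i. sqrt (A i)) \<longlonglongrightarrow> 0" using tendsto_real_sqrt by fastforce
  then have An: "(\<lambda>i. A_norm \<Omega> P (w i)) \<longlonglongrightarrow> 0" by (simp add: A_norm_def A_def)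
  have "(\<lambda>i. ap_form \<Omega> P (e i) (e i)) \<longlonglongrightarrow> 0"
  proof (rule lim)
    fix i :: nat assume i: "i \<ge> 2"
    have "0 \<le> 2 * (1 - \<delta>) * Z_form \<Omega> \<T> (e i) (e i)" using \<delta> Z0 by simp
    moreover have "0 \<le> A i / (\<gamma> * L)" using A0 \<gamma>L by simp
    ultimately have "2 * \<tau> / (\<gamma> * L) * ap_form \<Omega> P (e i) (e i) \<le> E (i - 1) - E i" using energy[of i] i by simp
    then have "\<gamma> * L / (2 * \<tau>) * (2 * \<tau> / (\<gamma> * L) * ap_form \<Omega> P (e i) (e i)) \<le> \<gamma> * L / (2 * \<tau>) * (E (i - 1) - E i)"
      using step \<gamma>L by (intro mult_left_mono) auto
    moreover have "\<gamma> * L / (2 * \<tau>) * (2 * \<tau> / (\<gamma> * L) * ap_form \<Omega> P (e i) (e i)) = ap_form \<Omega> P (e i) (e i)"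
      using step \<gamma>L by auto
    ultimately show "0 \<le> ap_form \<Omega> P (e i) (e i) \<and> ap_form \<Omega> P (e i) (e i) \<le> \<gamma> * L / (2 * \<tau>) * (E (i - 1) - E i)"
      using ap_form_nonneg[of "e i"] by simp
  qed
  \<comment> \<open>The Darcy energy bounds the mesh-weighted gradient, so the second term of the
    inf-sup bound tends to zero as well.\<close>
  from tendsto_real_sqrt[OF tendsto_mult[OF tendsto_const this, of "(\<Sum>T\<in>\<T>. (diameter T)\<^sup>2) / conductivity P"]]
  have "(\<lambda>i. sqrt ((\<Sum>T\<in>\<T>. (diameter T)\<^sup>2) / conductivity P * ap_form \<Omega> P (e i) (e i))) \<longlonglongrightarrow> 0" by simp
  then have hn: "(\<lambda>i. h_grad_norm \<Omega> \<T> (e i)) \<longlonglongrightarrow> 0"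
  proof (rule Lim_null_comparison[rotated], intro always_eventually allI)
    fix i
    have "conductivity P > 0" using params by (simp add: admissible_params_def)
    then have "(h_grad_norm \<Omega> \<T> (e i))\<^sup>2 \<le> (\<Sum>T\<in>\<T>. (diameter T)\<^sup>2) / conductivity P * ap_form \<Omega> P (e i) (e i)"
      using h_grad_norm_le[OF partition Q_H1_0[OF eQ], of i] by (simp add: ap_form_eq)
    then show "norm (h_grad_norm \<Omega> \<T> (e i)) \<le> sqrt ((\<Sum>T\<in>\<T>. (diameter T)\<^sup>2) / conductivity P * ap_form \<Omega> P (e i) (e i))"
      using h_grad_norm_nonneg[of \<T> "e i"] by (simp add: real_le_rsqrt)
  qed
  have pc: "(\<lambda>i. L2_norm \<Omega> (e i)) \<longlonglongrightarrow> 0"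
  proof (rule Lim_null_comparison)
    have "(\<lambda>i. (sqrt \<kappa> * A_norm \<Omega> P (w i) / \<alpha> + \<epsilon> * h_grad_norm \<Omega> \<T> (e i)) / \<eta>) \<longlonglongrightarrow> (sqrt \<kappa> * 0 / \<alpha> + \<epsilon> * 0) / \<eta>"
      using \<alpha> constants by (intro tendsto_intros An hn) auto
    then show "(\<lambda>i. (sqrt \<kappa> * A_norm \<Omega> P (w i) / \<alpha> + \<epsilon> * h_grad_norm \<Omega> \<T> (e i)) / \<eta>) \<longlonglongrightarrow> 0" by simp
    show "\<forall>\<^sub>F i in sequentially. norm (L2_norm \<Omega> (e i))
        \<le> (sqrt \<kappa> * A_norm \<Omega> P (w i) / \<alpha> + \<epsilon> * h_grad_norm \<Omega> \<T> (e i)) / \<eta>"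
      using eventually_ge_at_top[of 1]
    proof eventually_elim
      case (elim i)
      show ?case using inf_sup_e[OF elim] constants(1) L2_norm_nonneg[of \<Omega> "e i"]
        by (simp add: pos_le_divide_eq mult.commute)
    qed
  qed
  obtain C where C: "\<forall>v\<in>H1_0_vec \<Omega>. L2_norm \<Omega> v \<le> C * A_norm \<Omega> P v"
    using L2_norm_le_A_norm[OF params] by blast
  have uc: "(\<lambda>i. L2_norm \<Omega> (w i)) \<longlonglongrightarrow> 0"
  proof (rule Lim_null_comparison)
    show "(\<lambda>i. C * A_norm \<Omega> P (w i)) \<longlonglongrightarrow> 0" using tendsto_mult[OF tendsto_const An, of C] by simp
    show "\<forall>\<^sub>F i in sequentially. norm (L2_norm \<Omega> (w i)) \<le> C * A_norm \<Omega> P (w i)"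
    proof (intro always_eventually allI)
      fix i show "norm (L2_norm \<Omega> (w i)) \<le> C * A_norm \<Omega> P (w i)"
        using C V_H1_0_vec[OF wV[of i]] L2_norm_nonneg[of \<Omega> "w i"] by simp
    qed
  qed

  have \<delta>': "(\<gamma> - \<bar>1 - \<gamma>\<bar>) / \<gamma> = 1 - \<delta>" using \<gamma>0 by (simp add: \<delta>_def diff_divide_distrib)
  have \<gamma>1: "\<gamma> - \<bar>1 - \<gamma>\<bar> = \<gamma> * (1 - \<delta>)" using \<gamma>0 by (simp add: \<delta>_def algebra_simps)
  have \<theta>0: "0 < \<epsilon>\<^sup>2 * C2 * \<gamma> / (4 * \<omega> * (\<gamma> - \<bar>1 - \<gamma>\<bar>))" if "C2 > 0" for C2
    unfolding \<gamma>1 using that constants omega \<gamma>0 \<delta>(2) by simp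
  have coeff: "(2 * (\<gamma> - \<bar>1 - \<gamma>\<bar>) / \<gamma>) * \<theta>\<^sup>2
      + ((\<gamma> - \<bar>1 - \<gamma>\<bar>) / \<gamma> - \<eta>\<^sup>2 * \<bar>1 - \<gamma>\<bar> / (2 * \<omega> * \<gamma>) - \<epsilon>\<^sup>2 * C2 / (2 * \<omega>)) * \<theta>
      - \<epsilon>\<^sup>2 * C2 / (4 * \<omega>)
    = 2 * (1 - \<delta>) * \<theta>\<^sup>2 + ((1 - \<delta>) - \<eta>\<^sup>2 * \<delta> / (2 * \<omega>) - \<epsilon>\<^sup>2 * C2 / (2 * \<omega>)) * \<theta>
      - \<epsilon>\<^sup>2 * C2 / (4 * \<omega>)" for \<theta> C2
  proof -
    have "2 * (\<gamma> - \<bar>1 - \<gamma>\<bar>) / \<gamma> = 2 * (1 - \<delta>)" unfolding \<delta>'[symmetric] by (simp only: times_divide_eq_right)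
    moreover have "\<eta>\<^sup>2 * \<bar>1 - \<gamma>\<bar> / (2 * \<omega> * \<gamma>) = \<eta>\<^sup>2 * \<delta> / (2 * \<omega>)" by (simp add: \<delta>_def)
    ultimately show ?thesis by (simp only: \<delta>')
  qed
  have root: "\<exists>\<theta>\<ge>\<epsilon>\<^sup>2 * C2 * \<gamma> / (4 * \<omega> * (\<gamma> - \<bar>1 - \<gamma>\<bar>)).
      2 * (1 - \<delta>) * \<theta>\<^sup>2 + ((1 - \<delta>) - \<eta>\<^sup>2 * \<delta> / (2 * \<omega>) - \<epsilon>\<^sup>2 * C2 / (2 * \<omega>)) * \<theta>
        - \<epsilon>\<^sup>2 * C2 / (4 * \<omega>) = 0" if C2: "C2 > 0" for C2
  proof (rule ex_root_ge)
    \<comment> \<open>At the claimed lower bound \<open>t\<close> one has (1 - delta) t = c, and all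
      terms cancel except -(eta^2 delta/(2 omega)) t.\<close>
    define c where "c = \<epsilon>\<^sup>2 * C2 / (4 * \<omega>)"
    define t where "t = \<epsilon>\<^sup>2 * C2 * \<gamma> / (4 * \<omega> * (\<gamma> - \<bar>1 - \<gamma>\<bar>))"
    have t: "t > 0" unfolding t_def by (rule \<theta>0[OF C2])
    have c: "(1 - \<delta>) * t = c" unfolding t_def \<gamma>1 c_def using \<gamma>0 \<delta>(2) by simp
    have "\<epsilon>\<^sup>2 * C2 / (2 * \<omega>) = 2 * c" by (simp add: c_def)
    then have "2 * (1 - \<delta>) * t\<^sup>2 + ((1 - \<delta>) - \<eta>\<^sup>2 * \<delta> / (2 * \<omega>) - \<epsilon>\<^sup>2 * C2 / (2 * \<omega>)) * t - c
      = 2 * t * ((1 - \<delta>) * t) + (1 - \<delta>) * t - \<eta>\<^sup>2 * \<delta> / (2 * \<omega>) * t - 2 * c * t - c"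
      by (simp add: algebra_simps power2_eq_square)
    also have "\<dots> = - (\<eta>\<^sup>2 * \<delta> / (2 * \<omega>) * t)" unfolding c by simp
    also have "\<dots> \<le> 0" using \<delta>(1) omega t by simp
    finally show "2 * (1 - \<delta>) * t\<^sup>2 + ((1 - \<delta>) - \<eta>\<^sup>2 * \<delta> / (2 * \<omega>) - \<epsilon>\<^sup>2 * C2 / (2 * \<omega>)) * t
        - \<epsilon>\<^sup>2 * C2 / (4 * \<omega>) \<le> 0"
      unfolding c_def .
  qed (use \<delta>(2) in simp)
  have rate: "E i \<le> 1 / (1 + \<eta>\<^sup>2 / (\<omega> * (1 + 2 * \<theta>))) * E (i - 1)"
    if C2: "C2 > 0" and G: "(h_grad_norm \<Omega> \<T> (e i))\<^sup>2 \<le> C2 * Z_form \<Omega> \<T> (e i) (e i)"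
      and \<theta>: "\<theta> \<ge> \<epsilon>\<^sup>2 * C2 * \<gamma> / (4 * \<omega> * (\<gamma> - \<bar>1 - \<gamma>\<bar>))"
        "2 * (1 - \<delta>) * \<theta>\<^sup>2 + ((1 - \<delta>) - \<eta>\<^sup>2 * \<delta> / (2 * \<omega>) - \<epsilon>\<^sup>2 * C2 / (2 * \<omega>)) * \<theta>
          - \<epsilon>\<^sup>2 * C2 / (4 * \<omega>) = 0"
      and i: "i \<ge> 1" "i = 1 \<longrightarrow> elasticity_eq \<Omega> V P f u_old p_old" for C2 \<theta> i
  proof -
    define k where "k = \<eta>\<^sup>2 / (\<omega> * (1 + 2 * \<theta>))"
    define s where "s = sqrt \<kappa> * A_norm \<Omega> P (w i) / \<alpha>"
    have \<theta>pos: "0 < \<theta>" using \<theta>0[OF C2] \<theta>(1) by linarith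
    have k0: "0 \<le> k" unfolding k_def using \<theta>pos omega by simp
    have "s\<^sup>2 = \<kappa> * A i / \<alpha>\<^sup>2"
      unfolding s_def A_norm_def A_def power_divide power_mult_distrib
      using kappa_pos a_form_nonneg[OF params, of "w i"] by simp
    \<comment> \<open>The relation gamma L = omega alpha^2/kappa identifies the elastic surplus of
      the energy estimate with the \<open>s\<close> term of the contraction estimate.\<close>
    then have s: "s\<^sup>2 / \<omega> = A i / (\<gamma> * L)"
      unfolding L' by (simp add: mult.commute)
    have "k * E i \<le> s\<^sup>2 / \<omega> + 2 * (1 - \<delta>) * Z_form \<Omega> \<T> (e i) (e i)"
      unfolding k_def E_def L2_norm_squared[symmetric]
      by (rule contraction_estimate[OF \<theta>pos _ _ L2_norm_nonneg inf_sup_e[OF i(1), folded s_def] G \<theta>(2)])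
        (use constants omega in auto)
    \<comment> \<open>The elastic and Z surpluses cover \<open>k * E i\<close>; the nonnegative
      Darcy term is discarded.\<close>
    then have "E i + k * E i \<le> E (i - 1)"
      using energy[OF i] ap0[of i] unfolding s by linarith
    then have "E i * (1 + k) \<le> E (i - 1)" by (simp add: algebra_simps)
    then have "E i \<le> E (i - 1) / (1 + k)" using k0 by (simp add: pos_le_divide_eq)
    then show ?thesis unfolding k_def by simp
  qed
  have E_eq: "(L2_norm \<Omega> (\<lambda>x. ps i x - p x))\<^sup>2
      + \<bar>1 - \<gamma>\<bar> / \<gamma> * Z_form \<Omega> \<T> (\<lambda>x. ps i x - p x) (\<lambda>x. ps i x - p x) = E i" for i
    by (simp only: E_def e_def \<delta>_def L2_norm_squared)
  have conv: "(\<lambda>i. L2_norm \<Omega> (\<lambda>x. ps i x - p x)) \<longlonglongrightarrow> 0 \<and>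
      (\<lambda>i. L2_norm \<Omega> (\<lambda>x. us i x - u x)) \<longlonglongrightarrow> 0 \<and>
      (\<lambda>i. A_norm \<Omega> P (\<lambda>x. us i x - u x)) \<longlonglongrightarrow> 0"
    using pc uc An by (simp only: e_def w_def simp_thms)
  show ?thesis
  proof (rule conjI[OF conv], intro allI impI)
    fix C1 C2 :: real
    assume "C1 > 0 \<and> C2 > 0 \<and>
      (\<forall>q\<in>Q_space \<Omega> \<T>. C1 * Z_form \<Omega> \<T> q q \<le> (h_grad_norm \<Omega> \<T> q)\<^sup>2 \<and>
        (h_grad_norm \<Omega> \<T> q)\<^sup>2 \<le> C2 * Z_form \<Omega> \<T> q q)"
    then have C2: "C2 > 0" and G: "\<And>i. (h_grad_norm \<Omega> \<T> (e i))\<^sup>2 \<le> C2 * Z_form \<Omega> \<T> (e i) (e i)"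
      using eQ by blast+
    show "let is_root = (\<lambda>\<theta>.
              \<theta> \<ge> \<epsilon>\<^sup>2 * C2 * \<gamma> / (4 * \<omega> * (\<gamma> - \<bar>1 - \<gamma>\<bar>)) \<and>
              (2 * (\<gamma> - \<bar>1 - \<gamma>\<bar>) / \<gamma>) * \<theta>\<^sup>2
              + ((\<gamma> - \<bar>1 - \<gamma>\<bar>) / \<gamma> - \<eta>\<^sup>2 * \<bar>1 - \<gamma>\<bar> / (2 * \<omega> * \<gamma>) - \<epsilon>\<^sup>2 * C2 / (2 * \<omega>)) * \<theta>
              - \<epsilon>\<^sup>2 * C2 / (4 * \<omega>) = 0);
            E = (\<lambda>i. (L2_norm \<Omega> (\<lambda>x. ps i x - p x))\<^sup>2
                   + \<bar>1 - \<gamma>\<bar> / \<gamma> * Z_form \<Omega> \<T> (\<lambda>x. ps i x - p x) (\<lambda>x. ps i x - p x))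
        in (\<exists>\<theta>. is_root \<theta>) \<and>
           (\<forall>\<theta>. is_root \<theta> \<longrightarrow>
              (\<forall>i\<ge>1. (i = 1 \<longrightarrow> elasticity_eq \<Omega> (Vh \<T>) P f u_old p_old) \<longrightarrow>
                 E i \<le> 1 / (1 + \<eta>\<^sup>2 / (\<omega> * (1 + 2 * \<theta>))) * E (i - 1)))"
      unfolding Let_def coeff E_eq V_def[symmetric]
    proof (rule conjI)
      show "\<exists>\<theta>. \<theta> \<ge> \<epsilon>\<^sup>2 * C2 * \<gamma> / (4 * \<omega> * (\<gamma> - \<bar>1 - \<gamma>\<bar>)) \<and>
          2 * (1 - \<delta>) * \<theta>\<^sup>2 + ((1 - \<delta>) - \<eta>\<^sup>2 * \<delta> / (2 * \<omega>) - \<epsilon>\<^sup>2 * C2 / (2 * \<omega>)) * \<theta>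
            - \<epsilon>\<^sup>2 * C2 / (4 * \<omega>) = 0"
        by (rule root[OF C2])
    qed (use rate[OF C2 G] in blast)
  qed
qed

end
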